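(* Let $\boldsymbol{X}=\boldsymbol{V}_h\times Q_h$, let $\mathcal{A}=\begin{pmatrix}A_{\boldsymbol{u}}&\alpha B^T\\ \alpha B&-\tau A_p-\eta h^2L_p\end{pmatrix}:\boldsymbol{X}\to\boldsymbol{X}'$ with $\eta=\delta\frac{\alpha^2}{\zeta^2}$, $\delta>0$, and $\zeta=\sqrt{\lambda+2\mu/d}$. Let $$\mathcal{B}_D=\begin{pmatrix}A_{\boldsymbol{u}}&0\\0&\tau A_p+\eta h^2L_p+\frac{\alpha^2}{\zeta^2}M\end{pmatrix}^{-1},\qquad \mathcal{M}_D=\begin{pmatrix}H_{\boldsymbol{u}}&0\\0&H_p\end{pmatrix},$$ where $H_{\boldsymbol{u}}:\boldsymbol{V}_h'\to\boldsymbol{V}_h$ and $H_p:Q_h'\to Q_h$ are symmetric positive definite and there are positive constants $c_{1,\boldsymbol{u}},c_{2,\boldsymbol{u}},c_{1,p},c_{2,p}$ such that $$c_{1,\boldsymbol{u}}(H_{\boldsymbol{u}}\boldsymbol{u},\boldsymbol{u})\le(A_{\boldsymbol{u}}^{-1}\boldsymbol{u},\boldsymbol{u})\le c_{2,\boldsymbol{u}}(H_{\boldsymbol{u}}\boldsymbol{u},\boldsymbol{u})\quad\text{for all }\boldsymbol{u}\in\boldsymbol{V}_h',$$ $$c_{1,p}(H_pp,p)\le\Big(\big(\tau A_p+\eta h^2L_p+\tfrac{\alpha^2}{\zeta^2}M\big)^{-1}p,p\Big)\le c_{2,p}(H_pp,p)\quad\text{for all }p\in Q_h'.$$ Then $\kappa(\mathcal{B}_D\mathcal{A})=\mathcal{O}(1)$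 and $\kappa(\mathcal{M}_D\mathcal{A})=\mathcal{O}(1)$; that is, both condition numbers are bounded by constants independent of the physical and discretization parameters.
   Context: Setting. $\Omega\subset\mathbb{R}^d$, $d\in\{2,3\}$, is a bounded open set with regular boundary. Physical parameters: Lamé coefficients $\lambda\ge 0$, $\mu>0$; Biot–Willis constant $\alpha>0$; hydraulic conductivity $K>0$. Discretization parameters: mesh size $h>0$, time step size $\tau>0$. $(\cdot,\cdot)$ and $\|\cdot\|$ are the $L^2(\Omega)$ inner product and norm (also used for the duality pairing between a finite-dimensional space and its dual), $\|\cdot\|_1$ is the $H^1(\Omega)$ norm, and $\varepsilon(\boldsymbol{u})=\frac12(\nabla\boldsymbol{u}+\nabla\boldsymbol{u}^t)$. Bilinear forms: $a(\boldsymbol{u},\boldsymbol{v})=2\mu\int_\Omega\varepsilon(\boldsymbol{u}):\varepsilon(\boldsymbol{v})+\lambda\int_\Omega\operatorname{div}\boldsymbol{u}\,\operatorname{div}\boldsymbol{v}$ and $a_p(p,q)=\int_\Omega K\nabla p\cdot\nabla q$. Finite-element spaces: $\boldsymbol{V}_h\subset\boldsymbol{H}^1_0(\Omega)=H_0^1(\Omega)^d$ and $Q_h\subset H^1_0(\Omega)$ are the finite-element spaces for displacement and pressure given by the $\mathbb{P}_1$-$\mathbb{P}_1$ pair or the Mini element on a mesh of size $h$. The pair is taken to satisfy the weak inf-sup condition $$\sup_{0\ne\boldsymbol{v}\in\boldsymbol{V}_h}\frac{(\operatorname{div}\boldsymbol{v},q)}{\|\boldsymbol{v}\|_1}\ge\gamma_B^0\|q\|-\xi^0h\|\nabla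 q\|\qquad\text{for all }q\in Q_h,$$ with constants $\gamma_B^0>0$, $\xi^0\ge0$ that do not depend on $h$ ($\xi^0=0$ for the Mini element). Discrete operators: $A_{\boldsymbol{u}}:\boldsymbol{V}_h\to\boldsymbol{V}_h'$, $B:\boldsymbol{V}_h\to Q_h'$, $A_p,L_p,M:Q_h\to Q_h'$ are defined by $(A_{\boldsymbol{u}}\boldsymbol{u},\boldsymbol{v})=a(\boldsymbol{u},\boldsymbol{v})$, $(B\boldsymbol{u},q)=-(\operatorname{div}\boldsymbol{u},q)$, $(A_pp,q)=a_p(p,q)$, $(L_pp,q)=(\nabla p,\nabla q)$, $(Mp,q)=\int_\Omega pq$ (pressure mass operator); $B^T:Q_h\to\boldsymbol{V}_h'$ is the adjoint of $B$. Condition number: for a symmetric positive definite $\mathcal{M}:\boldsymbol{X}'\to\boldsymbol{X}$, $\mathcal{M}\mathcal{A}$ is symmetric in the inner product $(\boldsymbol{x},\boldsymbol{y})_{\mathcal{M}^{-1}}=\langle\mathcal{M}^{-1}\boldsymbol{x},\boldsymbol{y}\rangle$ on $\boldsymbol{X}$, and $\kappa(\mathcal{M}\mathcal{A})=\|\mathcal{M}\mathcal{A}\|\,\|(\mathcal{M}\mathcal{A})^{-1}\|$ with operator norms induced by $\|\cdot\|_{\mathcal{M}^{-1}}$. "Independent of the physical and discretization parameters" means independent of $\lambda,\mu,K,\alpha,h,\tau$; the bounds may depend on $d,\gamma_B^0,\xi^0,\delta$ and, for $\mathcal{M}_D$, on $c_{1,\boldsymbol{u}},c_{2,\boldsymbol{u}},c_{1,p},c_{2,p}$.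 *)

theory Defs
  imports "HOL-Analysis.Analysis" "HOL-Library.Function_Algebras"
begin

section \<open>Functions as a real vector space\<close>

text \<open>Finite-element spaces and their duals are sets of functions with pointwise operations; the
  library provides everything except the scalar multiplication.\<close>

instantiation "fun" :: (type, scaleR) scaleR
begin

definition scaleR_fun_def: "c *\<^sub>R f = (\<lambda>x. c *\<^sub>R f x)"

instance ..

end

instance "fun" :: (type, real_vector) real_vector
  by standard
    (simp_all add: scaleR_fun_def plus_fun_def fun_eq_iff scaleR_add_right scaleR_add_left)


section \<open>Domains and differential operators\<close>

text \<open>"Regular boundary" is read as Lipschitz boundary: near each boundary point the domain is the
  strict epigraph, in some unit direction \<open>e\<close>, of a Lipschitz function of the coordinates
  orthogonal to \<open>e\<close> (encoded as a function on the whole space that is invariant along \<open>e\<close>).\<close>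

definition lipschitz_boundary :: "'a::euclidean_space set \<Rightarrow> bool" where
  "lipschitz_boundary \<Omega> \<longleftrightarrow>
     (\<forall>x\<in>frontier \<Omega>. \<exists>r>0. \<exists>e g L. norm e = 1 \<and> L-lipschitz_on UNIV g \<and>
        (\<forall>y t. g (y + t *\<^sub>R e) = g y) \<and>
        \<Omega> \<inter> ball x r = {y \<in> ball x r. (g y :: real) < y \<bullet> e})"

text \<open>All derivatives below are classical pointwise ones. They are applied only to continuous
  piecewise polynomials, which are differentiable off the element boundaries (a null set) and whose
  classical gradient is a representative of the weak one. The integrals are over the Lebesgue
  measure, so the values on that null set do not matter.\<close>

definition grad :: "(real^'n \<Rightarrow> real) \<Rightarrow> real^'n \<Rightarrow> real^'n" where
  "grad q x = (\<chi> i. frechet_derivative q (at x) (axis i 1))"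

definition Jac :: "(real^'n \<Rightarrow> real^'n) \<Rightarrow> real^'n \<Rightarrow> real^'n^'n" where
  "Jac u x = jacobian u (at x)"

definition strain :: "(real^'n \<Rightarrow> real^'n) \<Rightarrow> real^'n \<Rightarrow> real^'n^'n" where
  "strain u x = (1/2) *\<^sub>R (Jac u x + transpose (Jac u x))"

definition divg :: "(real^'n \<Rightarrow> real^'n) \<Rightarrow> real^'n \<Rightarrow> real" where
  "divg u x = trace (Jac u x)"

text \<open>Used for scalars, vectors and matrices; on matrices \<open>\<bullet>\<close> is the Frobenius product.\<close>

definition L2_inner :: "(real^'n) set \<Rightarrow> (real^'n \<Rightarrow> 'b::real_inner) \<Rightarrow> (real^'n \<Rightarrow> 'b) \<Rightarrow> real" where
  "L2_inner \<Omega> f g = (LINT x:\<Omega>|lebesgue. f x \<bullet> g x)"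

definition L2_norm :: "(real^'n) set \<Rightarrow> (real^'n \<Rightarrow> 'b::real_inner) \<Rightarrow> real" where
  "L2_norm \<Omega> f = sqrt (L2_inner \<Omega> f f)"

definition H1_norm :: "(real^'n) set \<Rightarrow> (real^'n \<Rightarrow> real^'n) \<Rightarrow> real" where
  "H1_norm \<Omega> v = sqrt ((L2_norm \<Omega> v)\<^sup>2 + (L2_norm \<Omega> (Jac v))\<^sup>2)"

definition a_form :: "(real^'n) set \<Rightarrow> real \<Rightarrow> real \<Rightarrow> (real^'n \<Rightarrow> real^'n) \<Rightarrow> (real^'n \<Rightarrow> real^'n) \<Rightarrow> real" where
  "a_form \<Omega> lam \<mu> u v =
     2 * \<mu> * L2_inner \<Omega> (strain u) (strain v) + lam * L2_inner \<Omega> (divg u) (divg v)"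

definition ap_form :: "(real^'n) set \<Rightarrow> real \<Rightarrow> (real^'n \<Rightarrow> real) \<Rightarrow> (real^'n \<Rightarrow> real) \<Rightarrow> real" where
  "ap_form \<Omega> K p q = L2_inner \<Omega> (\<lambda>x. K *\<^sub>R grad p x) (grad q)"


section \<open>Finite-element spaces\<close>

text \<open>A conforming simplicial mesh of size \<open>h\<close>. Only \<open>\<Union>\<T> \<subseteq> closure \<Omega>\<close> is required, so that meshes
  of inscribed polyhedra are allowed when the domain is not itself polyhedral.\<close>

definition mesh :: "(real^'n) set \<Rightarrow> real \<Rightarrow> (real^'n) set set \<Rightarrow> bool" where
  "mesh \<Omega> h \<T> \<longleftrightarrow> triangulation \<T> \<and> \<T> \<noteq> {} \<and> (\<forall>S\<in>\<T>. int CARD('n) simplex S) \<and>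
     \<Union>\<T> \<subseteq> closure \<Omega> \<and> h = Max (diameter ` \<T>)"

text \<open>Functions are defined on the whole space and extended by zero. Being continuous, piecewise
  affine and zero off \<open>\<Omega>\<close>, the elements of \<open>P1\<close> belong to \<open>H\<^sup>1\<^sub>0(\<Omega>)\<close>.\<close>

definition P1 :: "(real^'n) set \<Rightarrow> (real^'n) set set \<Rightarrow> (real^'n \<Rightarrow> real) set" where
  "P1 \<Omega> \<T> = {q. continuous_on UNIV q \<and> (\<forall>x. x \<notin> \<Omega> \<inter> \<Union>\<T> \<longrightarrow> q x = 0) \<and>
     (\<forall>S\<in>\<T>. \<exists>a b. \<forall>x\<in>S. q x = a \<bullet> x + b)}"

definition barycentric :: "(real^'n) set \<Rightarrow> real^'n \<Rightarrow> real^'n \<Rightarrow> real" where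
  "barycentric C x = (THE w. (\<forall>c. c \<notin> C \<longrightarrow> w c = 0) \<and> sum w C = 1 \<and> (\<Sum>c\<in>C. w c *\<^sub>R c) = x)"

definition bubble :: "(real^'n) set \<Rightarrow> real^'n \<Rightarrow> real" where
  "bubble S x = (let C = {c. c extreme_point_of S} in
     if x \<in> S then \<Prod>c\<in>C. barycentric C x c else 0)"

definition P1_vec :: "(real^'n) set \<Rightarrow> (real^'n) set set \<Rightarrow> (real^'n \<Rightarrow> real^'n) set" where
  "P1_vec \<Omega> \<T> = {v. \<forall>i. (\<lambda>x. v x $ i) \<in> P1 \<Omega> \<T>}"

definition Mini_vec :: "(real^'n) set \<Rightarrow> (real^'n) set set \<Rightarrow> (real^'n \<Rightarrow> real^'n) set" where
  "Mini_vec \<Omega> \<T> =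
     {v. \<exists>w\<in>P1_vec \<Omega> \<T>. \<exists>\<beta>. \<forall>x. v x = w x + (\<Sum>S\<in>\<T>. bubble S x *\<^sub>R \<beta> S)}"

text \<open>The supremum is taken in the extended reals, so the condition fails if \<open>V = {0}\<close>.\<close>

definition weak_inf_sup ::
  "(real^'n) set \<Rightarrow> real \<Rightarrow> real \<Rightarrow> real \<Rightarrow> (real^'n \<Rightarrow> real^'n) set \<Rightarrow> (real^'n \<Rightarrow> real) set \<Rightarrow> bool" where
  "weak_inf_sup \<Omega> h \<gamma> \<xi> V Q \<longleftrightarrow>
     (\<forall>q\<in>Q. (SUP v\<in>V - {0}. ereal (L2_inner \<Omega> (divg v) q / H1_norm \<Omega> v))
        \<ge> ereal (\<gamma> * L2_norm \<Omega> q - \<xi> * h * L2_norm \<Omega> (grad q)))"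

definition fe_pair ::
  "(real^'n) set \<Rightarrow> real \<Rightarrow> real \<Rightarrow> real \<Rightarrow> (real^'n \<Rightarrow> real^'n) set \<Rightarrow> (real^'n \<Rightarrow> real) set \<Rightarrow> bool" where
  "fe_pair \<Omega> h \<gamma> \<xi> V Q \<longleftrightarrow>
     (\<exists>\<T>. mesh \<Omega> h \<T> \<and> Q = P1 \<Omega> \<T> \<and> (V = P1_vec \<Omega> \<T> \<or> V = Mini_vec \<Omega> \<T> \<and> \<xi> = 0)) \<and>
     weak_inf_sup \<Omega> h \<gamma> \<xi> V Q"


section \<open>Dual spaces, preconditioners and condition numbers\<close>

text \<open>Functionals on a subspace are represented by functions that vanish off it; this makes them
  unique, and closed under the pointwise operations.\<close>

definition functional_on :: "'a set \<Rightarrow> ('a \<Rightarrow> real) \<Rightarrow> 'a \<Rightarrow> real" where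
  "functional_on V f = (\<lambda>v. if v \<in> V then f v else 0)"

definition dual :: "'a::real_vector set \<Rightarrow> ('a \<Rightarrow> real) set" where
  "dual V = {f. (\<forall>u\<in>V. \<forall>v\<in>V. f (u + v) = f u + f v) \<and> (\<forall>c. \<forall>v\<in>V. f (c *\<^sub>R v) = c * f v) \<and>
     (\<forall>v. v \<notin> V \<longrightarrow> f v = 0)}"

definition spd :: "'a::real_vector set \<Rightarrow> (('a \<Rightarrow> real) \<Rightarrow> 'a) \<Rightarrow> bool" where
  "spd V H \<longleftrightarrow> H ` dual V \<subseteq> V \<and>
     (\<forall>f\<in>dual V. \<forall>g\<in>dual V. H (f + g) = H f + H g) \<and>
     (\<forall>c. \<forall>f\<in>dual V. H (c *\<^sub>R f) = c *\<^sub>R H f) \<and>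
     (\<forall>f\<in>dual V. \<forall>g\<in>dual V. g (H f) = f (H g)) \<and>
     (\<forall>f\<in>dual V. f \<noteq> 0 \<longrightarrow> 0 < f (H f))"

text \<open>The dual of \<open>V \<times> Q\<close> is identified with \<open>dual V \<times> dual Q\<close> through this pairing.\<close>

fun pairing :: "('a \<Rightarrow> real) \<times> ('b \<Rightarrow> real) \<Rightarrow> 'a \<times> 'b \<Rightarrow> real" where
  "pairing (f, g) (v, q) = f v + g q"

definition inv_norm ::
  "'a set \<Rightarrow> 'b set \<Rightarrow> (('a::real_vector \<Rightarrow> real) \<times> ('b::real_vector \<Rightarrow> real) \<Rightarrow> 'a \<times> 'b) \<Rightarrow> 'a \<times> 'b \<Rightarrow> real" where
  "inv_norm V Q M x = sqrt (pairing (the_inv_into (dual V \<times> dual Q) M x) x)"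

definition op_norm :: "'x::zero set \<Rightarrow> ('x \<Rightarrow> real) \<Rightarrow> ('x \<Rightarrow> 'x) \<Rightarrow> ennreal" where
  "op_norm X N T = (SUP x\<in>X - {0}. ennreal (N (T x) / N x))"

text \<open>As usual, the condition number of a singular operator is \<open>\<infinity>\<close>; hence a finite bound on it
  includes the invertibility of \<open>M \<circ> A\<close> on \<open>V \<times> Q\<close>.\<close>

definition cond_number ::
  "'a set \<Rightarrow> 'b set \<Rightarrow> (('a::real_vector \<Rightarrow> real) \<times> ('b::real_vector \<Rightarrow> real) \<Rightarrow> 'a \<times> 'b)
     \<Rightarrow> ('a \<times> 'b \<Rightarrow> ('a \<Rightarrow> real) \<times> ('b \<Rightarrow> real)) \<Rightarrow> ennreal" where
  "cond_number V Q M A =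
     (let X = V \<times> Q; T = M \<circ> A; N = inv_norm V Q M in
      if bij_betw T X X then op_norm X N T * op_norm X N (the_inv_into X T) else \<infinity>)"


section \<open>Discrete operators\<close>

definition A_u :: "(real^'n) set \<Rightarrow> (real^'n \<Rightarrow> real^'n) set \<Rightarrow> real \<Rightarrow> real
    \<Rightarrow> (real^'n \<Rightarrow> real^'n) \<Rightarrow> (real^'n \<Rightarrow> real^'n) \<Rightarrow> real" where
  "A_u \<Omega> V lam \<mu> u = functional_on V (\<lambda>v. a_form \<Omega> lam \<mu> u v)"

definition B_op :: "(real^'n) set \<Rightarrow> (real^'n \<Rightarrow> real) set
    \<Rightarrow> (real^'n \<Rightarrow> real^'n) \<Rightarrow> (real^'n \<Rightarrow> real) \<Rightarrow> real" where
  "B_op \<Omega> Q u = functional_on Q (\<lambda>q. - L2_inner \<Omega> (divg u) q)"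

definition BT_op :: "(real^'n) set \<Rightarrow> (real^'n \<Rightarrow> real^'n) set \<Rightarrow> (real^'n \<Rightarrow> real) set
    \<Rightarrow> (real^'n \<Rightarrow> real) \<Rightarrow> (real^'n \<Rightarrow> real^'n) \<Rightarrow> real" where
  "BT_op \<Omega> V Q q = functional_on V (\<lambda>v. B_op \<Omega> Q v q)"

definition A_p :: "(real^'n) set \<Rightarrow> (real^'n \<Rightarrow> real) set \<Rightarrow> real
    \<Rightarrow> (real^'n \<Rightarrow> real) \<Rightarrow> (real^'n \<Rightarrow> real) \<Rightarrow> real" where
  "A_p \<Omega> Q K p = functional_on Q (\<lambda>q. ap_form \<Omega> K p q)"

definition L_p :: "(real^'n) set \<Rightarrow> (real^'n \<Rightarrow> real) set
    \<Rightarrow> (real^'n \<Rightarrow> real) \<Rightarrow> (real^'n \<Rightarrow> real) \<Rightarrow> real" where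
  "L_p \<Omega> Q p = functional_on Q (\<lambda>q. L2_inner \<Omega> (grad p) (grad q))"

definition M_op :: "(real^'n) set \<Rightarrow> (real^'n \<Rightarrow> real) set
    \<Rightarrow> (real^'n \<Rightarrow> real) \<Rightarrow> (real^'n \<Rightarrow> real) \<Rightarrow> real" where
  "M_op \<Omega> Q p = functional_on Q (\<lambda>q. L2_inner \<Omega> p q)"

definition zeta :: "'n::finite itself \<Rightarrow> real \<Rightarrow> real \<Rightarrow> real" where
  "zeta _ lam \<mu> = sqrt (lam + 2 * \<mu> / real CARD('n))"

definition eta :: "'n::finite itself \<Rightarrow> real \<Rightarrow> real \<Rightarrow> real \<Rightarrow> real \<Rightarrow> real" where
  "eta d \<delta> \<alpha> lam \<mu> = \<delta> * (\<alpha>\<^sup>2 / (zeta d lam \<mu>)\<^sup>2)"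

definition A_block :: "(real^'n) set \<Rightarrow> (real^'n \<Rightarrow> real^'n) set \<Rightarrow> (real^'n \<Rightarrow> real) set
    \<Rightarrow> real \<Rightarrow> real \<Rightarrow> real \<Rightarrow> real \<Rightarrow> real \<Rightarrow> real \<Rightarrow> real
    \<Rightarrow> (real^'n \<Rightarrow> real^'n) \<times> (real^'n \<Rightarrow> real)
    \<Rightarrow> ((real^'n \<Rightarrow> real^'n) \<Rightarrow> real) \<times> ((real^'n \<Rightarrow> real) \<Rightarrow> real)" where
  "A_block \<Omega> V Q \<delta> lam \<mu> \<alpha> K h \<tau> = (\<lambda>(u, p).
     (A_u \<Omega> V lam \<mu> u + \<alpha> *\<^sub>R BT_op \<Omega> V Q p,
      \<alpha> *\<^sub>R B_op \<Omega> Q u - \<tau> *\<^sub>R A_p \<Omega> Q K p - (eta TYPE('n) \<delta> \<alpha> lam \<mu> * h\<^sup>2) *\<^sub>R L_p \<Omega> Q p))"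

definition S_p :: "(real^'n) set \<Rightarrow> (real^'n \<Rightarrow> real) set
    \<Rightarrow> real \<Rightarrow> real \<Rightarrow> real \<Rightarrow> real \<Rightarrow> real \<Rightarrow> real \<Rightarrow> real
    \<Rightarrow> (real^'n \<Rightarrow> real) \<Rightarrow> (real^'n \<Rightarrow> real) \<Rightarrow> real" where
  "S_p \<Omega> Q \<delta> lam \<mu> \<alpha> K h \<tau> p =
     \<tau> *\<^sub>R A_p \<Omega> Q K p + (eta TYPE('n) \<delta> \<alpha> lam \<mu> * h\<^sup>2) *\<^sub>R L_p \<Omega> Q p
       + (\<alpha>\<^sup>2 / (zeta TYPE('n) lam \<mu>)\<^sup>2) *\<^sub>R M_op \<Omega> Q p"

definition B_D :: "(real^'n) set \<Rightarrow> (real^'n \<Rightarrow> real^'n) set \<Rightarrow> (real^'n \<Rightarrow> real) set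
    \<Rightarrow> real \<Rightarrow> real \<Rightarrow> real \<Rightarrow> real \<Rightarrow> real \<Rightarrow> real \<Rightarrow> real
    \<Rightarrow> ((real^'n \<Rightarrow> real^'n) \<Rightarrow> real) \<times> ((real^'n \<Rightarrow> real) \<Rightarrow> real)
    \<Rightarrow> (real^'n \<Rightarrow> real^'n) \<times> (real^'n \<Rightarrow> real)" where
  "B_D \<Omega> V Q \<delta> lam \<mu> \<alpha> K h \<tau> =
     the_inv_into (V \<times> Q) (map_prod (A_u \<Omega> V lam \<mu>) (S_p \<Omega> Q \<delta> lam \<mu> \<alpha> K h \<tau>))"

definition spectrally_equivalent ::
  "'a::real_vector set \<Rightarrow> real \<Rightarrow> real \<Rightarrow> (('a \<Rightarrow> real) \<Rightarrow> 'a) \<Rightarrow> ('a \<Rightarrow> 'a \<Rightarrow> real) \<Rightarrow> bool" where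
  "spectrally_equivalent V c\<^sub>1 c\<^sub>2 H A \<longleftrightarrow>
     (\<forall>f\<in>dual V. c\<^sub>1 * f (H f) \<le> f (the_inv_into V A f) \<and> f (the_inv_into V A f) \<le> c\<^sub>2 * f (H f))"

definition admissible :: "(real^'n) set \<Rightarrow> (real^'n \<Rightarrow> real^'n) set \<Rightarrow> (real^'n \<Rightarrow> real) set
    \<Rightarrow> real \<Rightarrow> real \<Rightarrow> real \<Rightarrow> real \<Rightarrow> real \<Rightarrow> real \<Rightarrow> real \<Rightarrow> real \<Rightarrow> bool" where
  "admissible \<Omega> V Q \<gamma> \<xi> lam \<mu> \<alpha> K h \<tau> \<longleftrightarrow>
     open \<Omega> \<and> bounded \<Omega> \<and> lipschitz_boundary \<Omega> \<and>
     0 \<le> lam \<and> 0 < \<mu> \<and> 0 < \<alpha> \<and> 0 < K \<and> 0 < h \<and> 0 < \<tau> \<and> fe_pair \<Omega> h \<gamma> \<xi> V Q"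

end

theory Submission
  imports Defs
begin

text \<open>Put \<open>s = \<tau> A\<^sub>p + \<eta> h\<^sup>2 L\<^sub>p + \<alpha>\<^sup>2 / \<zeta>\<^sup>2 M\<close>, \<open>c = \<tau> A\<^sub>p + \<eta> h\<^sup>2 L\<^sub>p\<close>, and measure
  \<open>(u, p)\<close> in the energy norm \<open>a(u, u) + s(p, p)\<close>. Pointwise
  \<open>\<zeta>\<^sup>2 (div v)\<^sup>2 \<le> 2 \<mu> \<epsilon>(v) : \<epsilon>(v) + \<lambda> (div v)\<^sup>2 \<le> d \<zeta>\<^sup>2 \<bar>\<nabla>v\<bar>\<^sup>2\<close>. The first inequality bounds
  \<open>\<A>\<close> by \<open>2\<close> from the energy norm to its dual. For stability, let \<open>R\<close> be the dual norm of the
  residual \<open>\<A> (u, p)\<close>. Testing with \<open>(u, -p)\<close> gives \<open>a(u, u) + c(p, p) \<le> R \<cdot> energy\<close>; testing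
  with \<open>(v, 0)\<close> and using the second inequality in the weak inf-sup condition controls
  \<open>\<alpha> \<parallel>p\<parallel> / \<zeta>\<close> by \<open>R\<close>, \<open>a(u, u)\<close> and \<open>c(p, p)\<close>, because the defect
  \<open>\<xi> h \<parallel>\<nabla>p\<parallel>\<close> is dominated by the stabilization. Spectral equivalence transfers both bounds to
  the norm of the preconditioner at the cost of the factor \<open>c\<^sub>2 / c\<^sub>1\<close>. Korn's inequality is
  needed only qualitatively, for the invertibility of \<open>A\<^sub>u\<close>.\<close>

section \<open>Forms and functionals on finite-dimensional subspaces\<close>

text \<open>The bound is fixed before the domain, so no inequality with a domain-dependent constant
  may enter an estimate. Hence the energy is compared with the H1 norm only from above, where a
  pointwise matrix inequality suffices; the reverse comparison would bring in the constant of Korn's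
  inequality. The weight \<alpha>^2 / \<zeta>^2 of the mass term does two jobs: it gives the
  coupling \<alpha> (div v, q) the bound 1 in the energy norm, and it cancels all parameters from
  the inf-sup estimate. What survives is \<xi> / (\<gamma> sqrt \<delta>) and sqrt d / \<gamma>, the
  two numbers \<open>k\<^sub>0\<close> and \<open>k\<^sub>1\<close> on which the abstract bound
  depends. The operator \<open>B_D\<close> needs no argument of its own: it is the preconditioner
  made of the exact inverses, with both equivalence constants equal to 1. Invertibility, which the
  finiteness of \<open>cond_number\<close> includes, comes from the stability estimate itself: a
  vector with zero residual is zero, and the spaces are finite-dimensional.\<close>

definition finite_dim :: "'a::real_vector set \<Rightarrow> bool" where
  "finite_dim W \<longleftrightarrow> subspace W \<and> (\<exists>B. finite B \<and> W \<subseteq> span B)"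

text \<open>The spanning set in \<open>finite_dim\<close> may lie outside the space, so that
  discontinuous functions can be used to span \<open>P1\<close>. A maximal independent subset of the
  space is still finite, since it is no larger than that spanning set.\<close>

lemma finite_dim_basis:
  assumes "finite_dim W"
  obtains B where "finite B" "independent B" "span B = W"
proof -
  obtain C where C: "finite C" "W \<subseteq> span C" and W: "subspace W"
    using assms by (auto simp: finite_dim_def)
  obtain B where B: "B \<subseteq> W" "independent B" "W \<subseteq> span B"
    by (rule basis_exists)
  have "finite B"
    using independent_span_bound[OF C(1) B(2)] B(1) C(2) by auto
  moreover have "span B = W"
    using B W span_minimal by blast
  ultimately show ?thesis using B that by blast
qed

lemma finite_dim_Times:
  fixes V :: "'a::real_vector set" and Q :: "'b::real_vector set"
  assumes "finite_dim V" "finite_dim Q"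
  shows "finite_dim (V \<times> Q)"
proof -
  obtain B C where B: "finite B" "V \<subseteq> span B" and C: "finite C" "Q \<subseteq> span C"
    and sub: "subspace V" "subspace Q"
    using assms by (auto simp: finite_dim_def)
  let ?D = "(\<lambda>v. (v, 0)) ` B \<union> (\<lambda>q. (0, q)) ` C :: ('a \<times> 'b) set"
  have l1: "linear (\<lambda>v::'a. (v, 0::'b))" by (rule linearI) auto
  have l2: "linear (\<lambda>q::'b. (0::'a, q))" by (rule linearI) auto
  have "x \<in> span ?D" if x: "x \<in> V \<times> Q" for x
  proof -
    have "(fst x, 0::'b) \<in> span ((\<lambda>v. (v, 0)) ` B)"
      unfolding linear_span_image[OF l1] using B x by (cases x) auto
    moreover have "(0::'a, snd x) \<in> span ((\<lambda>q. (0, q)) ` C)"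
      unfolding linear_span_image[OF l2] using C x by (cases x) auto
    ultimately have "(fst x, 0) + (0, snd x) \<in> span ?D"
      by (metis (no_types, lifting) span_add span_mono subsetD sup_ge1 sup_ge2)
    then show ?thesis by simp
  qed
  moreover have "subspace (V \<times> Q)"
    using sub unfolding subspace_def by (auto simp: zero_prod_def)
  ultimately show ?thesis
    unfolding finite_dim_def using B C by (intro conjI exI[of _ ?D]) auto
qed

text \<open>The maps that arise below are linear only on a subspace, while \<open>linear\<close>
  speaks of the whole type. Prescribing the values on a basis of the subspace closes this
  gap.\<close>

lemma linear_on_subspace_extend:
  assumes "finite_dim W"
    and add: "\<And>x y. x \<in> W \<Longrightarrow> y \<in> W \<Longrightarrow> f (x + y) = f x + f y"
    and scale: "\<And>c x. x \<in> W \<Longrightarrow> f (c *\<^sub>R x) = c *\<^sub>R f x"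
  obtains g where "linear g" "\<And>x. x \<in> W \<Longrightarrow> g x = f x"
proof -
  obtain B where B: "finite B" "independent B" "span B = W"
    using finite_dim_basis[OF assms(1)] .
  obtain g where g: "linear g" "\<And>x. x \<in> B \<Longrightarrow> g x = f x"
    using linear_independent_extend[OF B(2), of f] by auto
  have "x \<in> W \<and> g x = f x" if "x \<in> span B" for x
    using that
  proof (induction rule: span_induct_alt)
    case base
    have z: "0 \<in> W" using B(3) span_zero by auto
    have "f 0 = 0" using scale[OF z, of 0] by simp
    then show ?case using z linear_0[OF g(1)] by simp
  next
    case (step c x y)
    then have x: "x \<in> W" using B(3) span_base by auto
    then have cx: "c *\<^sub>R x \<in> W" using B(3) span_scale by auto
    have "c *\<^sub>R x + y \<in> W" using cx step(2) B(3) span_add by auto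
    then show ?case
      using step(2) g(2)[OF step(1)] x cx by (simp add: add scale linear_add[OF g(1)] linear_scale[OF g(1)])
  qed
  then show ?thesis using that g B by blast
qed

text \<open>The image of a basis is independent and has as many elements as the basis. A vector of
  \<open>W\<close> outside its span would yield an independent set in \<open>W\<close> with one
  element too many.\<close>

lemma inj_on_finite_dim_imp_surj:
  assumes W: "finite_dim W" and lin: "linear g" and inj: "inj_on g W" and im: "g ` W \<subseteq> W"
  shows "g ` W = W"
proof -
  obtain B where B: "finite B" "independent B" "span B = W"
    using finite_dim_basis[OF W] .
  have ind: "independent (g ` B)"
    using B inj lin linear_independent_injective_image by blast
  have card: "card (g ` B) = card B"
    using B inj by (metis card_image inj_on_subset span_superset)
  have "w \<in> span (g ` B)" if w: "w \<in> W" for w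
  proof (rule ccontr)
    assume n: "w \<notin> span (g ` B)"
    then have "independent (insert w (g ` B))"
      by (simp add: ind independent_insertI)
    moreover have "insert w (g ` B) \<subseteq> span B"
      using w im B span_superset by blast
    ultimately have "card (insert w (g ` B)) \<le> card B"
      using independent_span_bound[OF B(1), of "insert w (g ` B)"] by simp
    moreover have "w \<notin> g ` B" using n span_base[of w "g ` B"] by auto
    ultimately show False using B(1) card by auto
  qed
  then show ?thesis
    using im B(3) linear_span_image[OF lin, of B] by auto
qed

section \<open>Dual functionals and their representation by forms\<close>

lemma dual_add: "f \<in> dual V \<Longrightarrow> u \<in> V \<Longrightarrow> v \<in> V \<Longrightarrow> f (u + v) = f u + f v"
  and dual_scale: "f \<in> dual V \<Longrightarrow> v \<in> V \<Longrightarrow> f (c *\<^sub>R v) = c * f v"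
  and dual_outside: "f \<in> dual V \<Longrightarrow> v \<notin> V \<Longrightarrow> f v = 0"
  by (auto simp: dual_def)

lemma dual_eqI: "f \<in> dual V \<Longrightarrow> g \<in> dual V \<Longrightarrow> (\<And>v. v \<in> V \<Longrightarrow> f v = g v) \<Longrightarrow> f = g"
  by (rule ext) (metis dual_outside)

text \<open>With a basis \<open>B\<close>, nondegeneracy says that \<open>u \<mapsto> (\<Sum>b\<in>B. k u b *\<^sub>R b)\<close> is injective on \<open>W\<close>,
  hence surjective, and the coefficients of the image can be prescribed.\<close>

lemma nondegenerate_form_represents:
  fixes k :: "'a::real_vector \<Rightarrow> 'a \<Rightarrow> real"
  assumes W: "finite_dim W"
    and kadd: "\<And>x y z. x \<in> W \<Longrightarrow> y \<in> W \<Longrightarrow> z \<in> W \<Longrightarrow> k (x + y) z = k x z + k y z"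
    and kscale: "\<And>c x z. x \<in> W \<Longrightarrow> z \<in> W \<Longrightarrow> k (c *\<^sub>R x) z = c * k x z"
    and kdual: "\<And>x. x \<in> W \<Longrightarrow> functional_on W (k x) \<in> dual W"
    and nondeg: "\<And>x. x \<in> W \<Longrightarrow> (\<And>y. y \<in> W \<Longrightarrow> k x y = 0) \<Longrightarrow> x = 0"
    and f: "f \<in> dual W"
  obtains x where "x \<in> W" "\<And>y. y \<in> W \<Longrightarrow> f y = k x y"
proof -
  obtain B where B: "finite B" "independent B" "span B = W"
    using finite_dim_basis[OF W] .
  have BW: "B \<subseteq> W" using B span_superset by blast
  have sub: "subspace W" using W finite_dim_def by blast
  define T where "T = (\<lambda>x. \<Sum>b\<in>B. k x b *\<^sub>R b)"
  have agree: "f1 y = f2 y"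
    if "f1 \<in> dual W" "f2 \<in> dual W" "\<And>b. b \<in> B \<Longrightarrow> f1 b = f2 b" "y \<in> W" for f1 f2 y
  proof -
    have "y \<in> W \<and> f1 y = f2 y" if "y \<in> span B" using that
    proof (induction rule: span_induct_alt)
      case base
      show ?case
        using subspace_0[OF sub] dual_scale[OF \<open>f1 \<in> dual W\<close>, of 0 0]
          dual_scale[OF \<open>f2 \<in> dual W\<close>, of 0 0] by simp
    next
      case (step c x z)
      have "x \<in> W" using step(1) BW by blast
      then show ?case using step sub \<open>f1 \<in> dual W\<close> \<open>f2 \<in> dual W\<close> \<open>\<And>b. b \<in> B \<Longrightarrow> f1 b = f2 b\<close>
        by (simp add: dual_add dual_scale subspace_add subspace_scale)
    qed
    then show ?thesis using that B by blast
  qed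
  have zero: "(\<lambda>_. 0) \<in> dual W" by (simp add: dual_def)
  obtain g where g: "linear g" "\<And>x. x \<in> W \<Longrightarrow> g x = T x"
  proof (rule linear_on_subspace_extend[OF W, of T])
    show "T (x + y) = T x + T y" if "x \<in> W" "y \<in> W" for x y
      unfolding T_def sum.distrib[symmetric]
      by (rule sum.cong) (use that BW kadd in \<open>auto simp: scaleR_left.add\<close>)
    show "T (c *\<^sub>R x) = c *\<^sub>R T x" if "x \<in> W" for c x
      unfolding T_def scaleR_right.sum
      by (rule sum.cong) (use that BW kscale in auto)
  qed blast
  have coeff: "\<And>b. b \<in> B \<Longrightarrow> c b = d b"
    if "(\<Sum>b\<in>B. c b *\<^sub>R b) = (\<Sum>b\<in>B. d b *\<^sub>R b)" for c d :: "'a \<Rightarrow> real"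
  proof -
    have "(\<Sum>b\<in>B. (c b - d b) *\<^sub>R b) = 0"
      using that by (simp add: scaleR_left_diff_distrib sum_subtractf)
    then show "c b = d b" if "b \<in> B" for b
      using independentD[OF B(2,1) order_refl \<open>(\<Sum>b\<in>B. (c b - d b) *\<^sub>R b) = 0\<close> that] by simp
  qed
  have inj: "inj_on g W"
  proof (rule linear_inj_on_iff_eq_0[OF g(1) sub, THEN iffD2], safe)
    fix x assume x: "x \<in> W" "g x = 0"
    have "k x b = 0" if "b \<in> B" for b
      using coeff[of "k x" "\<lambda>_. 0"] x g(2)[of x] that by (simp add: T_def)
    then have "k x y = 0" if "y \<in> W" for y
      using agree[OF kdual[OF x(1)] zero _ that] BW that by (auto simp: functional_on_def)
    then show "x = 0" using nondeg x by blast
  qed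
  have TW: "(\<Sum>b\<in>B. c b *\<^sub>R b) \<in> W" for c
    using BW sub by (intro subspace_sum subspace_scale) auto
  then have "g ` W \<subseteq> W" using g(2) by (auto simp: T_def)
  from inj_on_finite_dim_imp_surj[OF W g(1) inj this]
  obtain x where x: "x \<in> W" "g x = (\<Sum>b\<in>B. f b *\<^sub>R b)"
    using TW[of f] by (metis imageE)
  have kb: "f b = functional_on W (k x) b" if "b \<in> B" for b
    using coeff[of "k x" f] x g(2)[of x] that BW by (auto simp: T_def functional_on_def)
  have "f y = k x y" if "y \<in> W" for y
    using agree[OF f kdual[OF x(1)] kb that] that by (simp add: functional_on_def)
  then show ?thesis using that x by blast
qed

text \<open>Semidefiniteness is the common ground of all forms in use: L2 products of derivatives
  before definiteness is established, the stabilization, and the form that a preconditioner induces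
  on the dual space.\<close>

locale psd_form =
  fixes W :: "'a::real_vector set" and k :: "'a \<Rightarrow> 'a \<Rightarrow> real"
  assumes subsp: "subspace W"
    and add_left: "x \<in> W \<Longrightarrow> y \<in> W \<Longrightarrow> z \<in> W \<Longrightarrow> k (x + y) z = k x z + k y z"
    and scale_left: "x \<in> W \<Longrightarrow> z \<in> W \<Longrightarrow> k (c *\<^sub>R x) z = c * k x z"
    and sym: "x \<in> W \<Longrightarrow> y \<in> W \<Longrightarrow> k x y = k y x"
    and nonneg: "x \<in> W \<Longrightarrow> 0 \<le> k x x"
begin

lemmas mem = subspace_add[OF subsp] subspace_scale[OF subsp] subspace_0[OF subsp]
  subspace_neg[OF subsp] subspace_diff[OF subsp]

lemma add_right: "x \<in> W \<Longrightarrow> y \<in> W \<Longrightarrow> z \<in> W \<Longrightarrow> k z (x + y) = k z x + k z y"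
  by (metis add_left mem(1) sym)

lemma scale_right: "x \<in> W \<Longrightarrow> z \<in> W \<Longrightarrow> k z (c *\<^sub>R x) = c * k z x"
  by (metis scale_left mem(2) sym)

lemma zero_left: "z \<in> W \<Longrightarrow> k 0 z = 0"
  using scale_left[of 0 z 0] mem(3) by simp

lemma neg_right: "x \<in> W \<Longrightarrow> z \<in> W \<Longrightarrow> k z (- x) = - k z x"
  using scale_right[of x z "-1"] by simp

lemma neg_left: "x \<in> W \<Longrightarrow> z \<in> W \<Longrightarrow> k (- x) z = - k x z"
  using scale_left[of x z "-1"] by simp

lemma diff_left: "x \<in> W \<Longrightarrow> y \<in> W \<Longrightarrow> z \<in> W \<Longrightarrow> k (x - y) z = k x z - k y z"
  using add_left[of x "- y" z] by (simp add: mem(4) neg_left)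

lemma functional_in_dual:
  assumes x: "x \<in> W"
  shows "functional_on W (k x) \<in> dual W"
  unfolding dual_def mem_Collect_eq
proof (intro conjI ballI allI impI)
  fix u v assume "u \<in> W" "v \<in> W"
  then show "functional_on W (k x) (u + v) = functional_on W (k x) u + functional_on W (k x) v"
    using x by (simp add: functional_on_def mem(1) add_right)
next
  fix c v assume "v \<in> W"
  then show "functional_on W (k x) (c *\<^sub>R v) = c * functional_on W (k x) v"
    using x by (simp add: functional_on_def mem(2) scale_right)
qed (simp add: functional_on_def)

lemma Cauchy_Schwarz:
  assumes x: "x \<in> W" and y: "y \<in> W"
  shows "\<bar>k x y\<bar> \<le> sqrt (k x x) * sqrt (k y y)"
proof -
  have q: "0 \<le> k x x + 2 * t * k x y + t\<^sup>2 * k y y" for t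
  proof -
    have "0 \<le> k (x + t *\<^sub>R y) (x + t *\<^sub>R y)" by (simp add: mem nonneg x y)
    also have "\<dots> = k x x + 2 * t * k x y + t\<^sup>2 * k y y"
      using x y mem by (simp add: add_left add_right scale_left scale_right sym[of y x]
          power2_eq_square algebra_simps)
    finally show ?thesis .
  qed
  have "(k x y)\<^sup>2 \<le> k x x * k y y"
  proof (cases "k y y = 0")
    case True
    have "k x y = 0"
    proof (rule ccontr)
      assume n: "k x y \<noteq> 0"
      \<comment> \<open>This choice of \<open>t\<close> makes the affine function
        \<open>k x x + 2 * t * k x y\<close> equal to -1.\<close>
      then show False
        using q[of "- (k x x + 1) / (2 * k x y)"] True by (simp add: field_simps)
    qed
    then show ?thesis using True by simp
  next
    case False
    then have "0 < k y y" using nonneg[OF y] by simp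
    then show ?thesis using q[of "- k x y / k y y"]
      by (simp add: field_simps power2_eq_square)
  qed
  then have "sqrt ((k x y)\<^sup>2) \<le> sqrt (k x x * k y y)" by (rule real_sqrt_le_mono)
  then show ?thesis by (simp add: real_sqrt_mult)
qed

end

section \<open>Inner products and the Riesz isomorphism\<close>

locale inner_form = psd_form +
  assumes fin: "finite_dim W"
    and definite: "x \<in> W \<Longrightarrow> k x x = 0 \<Longrightarrow> x = 0"
begin

abbreviation riesz :: "'a \<Rightarrow> 'a \<Rightarrow> real" where
  "riesz x \<equiv> functional_on W (k x)"

lemma riesz_inj: "inj_on riesz W"
proof (rule inj_onI)
  fix x y assume xy: "x \<in> W" "y \<in> W" "riesz x = riesz y"
  then have "k x (x - y) = k y (x - y)"
    using mem(5) by (metis functional_on_def)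
  then have "k (x - y) (x - y) = 0" using xy mem(5) diff_left by simp
  then have "x - y = 0" using xy mem(5) definite by blast
  then show "x = y" by simp
qed

lemma riesz_surj: "riesz ` W = dual W"
proof
  show "riesz ` W \<subseteq> dual W" using functional_in_dual by blast
  show "dual W \<subseteq> riesz ` W"
  proof
    fix f assume f: "f \<in> dual W"
    obtain x where x: "x \<in> W" "\<And>y. y \<in> W \<Longrightarrow> f y = k x y"
      by (rule nondegenerate_form_represents[OF fin _ _ _ _ f, of k])
        (use add_left scale_left functional_in_dual definite in auto)
    have "f = riesz x"
      by (rule dual_eqI[OF f functional_in_dual[OF x(1)]]) (simp add: functional_on_def x(2))
    then show "f \<in> riesz ` W" using x by blast
  qed
qed

abbreviation unriesz :: "('a \<Rightarrow> real) \<Rightarrow> 'a" where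
  "unriesz \<equiv> the_inv_into W riesz"

lemma unriesz_mem: "f \<in> dual W \<Longrightarrow> unriesz f \<in> W"
  using the_inv_into_into[OF riesz_inj, of f W] by (simp add: riesz_surj)

lemma riesz_unriesz: "f \<in> dual W \<Longrightarrow> riesz (unriesz f) = f"
  using f_the_inv_into_f[OF riesz_inj] riesz_surj by blast

lemma apply_unriesz: "f \<in> dual W \<Longrightarrow> y \<in> W \<Longrightarrow> f y = k (unriesz f) y"
  by (metis functional_on_def riesz_unriesz)

lemma unriesz_riesz: "x \<in> W \<Longrightarrow> unriesz (riesz x) = x"
  by (rule the_inv_into_f_f[OF riesz_inj])

lemma dual_norm_nonneg: "f \<in> dual W \<Longrightarrow> 0 \<le> f (unriesz f)"
  using apply_unriesz nonneg unriesz_mem by metis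

lemma dual_Cauchy_Schwarz:
  assumes "f \<in> dual W" "y \<in> W"
  shows "\<bar>f y\<bar> \<le> sqrt (f (unriesz f)) * sqrt (k y y)"
  using Cauchy_Schwarz[of "unriesz f" y] apply_unriesz unriesz_mem assms by metis

text \<open>Makes the exact inverse an admissible preconditioner, so that \<open>B_D\<close> falls
  under the general bound.\<close>

lemma spd_unriesz: "spd W unriesz"
  unfolding spd_def
proof (intro conjI ballI allI impI)
  show "unriesz ` dual W \<subseteq> W" using unriesz_mem by blast
next
  fix f g assume fg: "f \<in> dual W" "g \<in> dual W"
  have "f + g = riesz (unriesz f + unriesz g)"
  proof
    fix y
    show "(f + g) y = riesz (unriesz f + unriesz g) y"
      using fg unriesz_mem
      by (cases "y \<in> W") (auto simp: functional_on_def add_left apply_unriesz dual_outside)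
  qed
  then show "unriesz (f + g) = unriesz f + unriesz g"
    using fg unriesz_riesz[OF mem(1)[OF unriesz_mem unriesz_mem], of f g] by simp
  show "g (unriesz f) = f (unriesz g)"
    using apply_unriesz[OF fg(2) unriesz_mem[OF fg(1)]] apply_unriesz[OF fg(1) unriesz_mem[OF fg(2)]]
      sym[OF unriesz_mem[OF fg(1)] unriesz_mem[OF fg(2)]] by simp
next
  fix c f assume f: "f \<in> dual W"
  have "c *\<^sub>R f = riesz (c *\<^sub>R unriesz f)"
  proof
    fix y
    show "(c *\<^sub>R f) y = riesz (c *\<^sub>R unriesz f) y"
      using f unriesz_mem
      by (cases "y \<in> W") (auto simp: functional_on_def scale_left apply_unriesz dual_outside scaleR_fun_def)
  qed
  then show "unriesz (c *\<^sub>R f) = c *\<^sub>R unriesz f"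
    using f unriesz_riesz[OF mem(2)[OF unriesz_mem], of f c] by simp
next
  fix f assume f: "f \<in> dual W" "f \<noteq> 0"
  then have u: "unriesz f \<in> W" "f (unriesz f) = k (unriesz f) (unriesz f)"
    using apply_unriesz unriesz_mem by auto
  moreover have "k (unriesz f) (unriesz f) \<noteq> 0"
  proof
    assume "k (unriesz f) (unriesz f) = 0"
    then have z: "unriesz f = 0" using definite u by blast
    have "f = riesz 0" using riesz_unriesz f z by metis
    also have "\<dots> = 0" using zero_left by (auto simp: functional_on_def fun_eq_iff)
    finally show False using f by blast
  qed
  ultimately show "0 < f (unriesz f)"
    using nonneg by (metis less_eq_real_def)
qed

end

section \<open>Preconditioned saddle point operators\<close>

text \<open>Absorption: if \<open>X\<close> exceeds \<open>R\<close>, then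
  \<open>R\<^sup>2 \<le> R * X\<close>, so both terms on the right become multiples of
  \<open>R * X\<close> and one factor \<open>X\<close> cancels.\<close>

lemma real_quadratic_bound:
  fixes X R :: real
  assumes "0 \<le> X" "0 \<le> R" "1 \<le> k" "X\<^sup>2 \<le> k1 * R * X + k2 * R\<^sup>2" "k1 + k2 \<le> k" "0 \<le> k2"
  shows "X \<le> k * R"
proof (cases "X \<le> R")
  case True
  then show ?thesis using assms mult_right_mono[of 1 k R] by linarith
next
  case False
  then have "R\<^sup>2 \<le> R * X" using assms by (simp add: power2_eq_square mult_left_mono)
  then have "k2 * R\<^sup>2 \<le> k2 * (R * X)" using assms by (intro mult_left_mono)
  then have "X * X \<le> (k1 + k2) * (R * X)" using assms by (simp add: power2_eq_square algebra_simps)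
  also have "\<dots> \<le> k * (R * X)" using assms by (intro mult_right_mono) auto
  finally have "X * X \<le> (k * R) * X" by (simp add: algebra_simps)
  then show ?thesis using False assms mult_le_cancel_right[of X X "k * R"] by auto
qed

text \<open>The norm of \<open>H f\<close> in which \<open>H A\<close> is measured is \<open>sqrt (f (H f))\<close>, whereas \<open>f (unriesz f)\<close>
  is the squared dual norm of \<open>f\<close>.\<close>

locale equivalent_preconditioner = inner_form W k
  for W :: "'a::real_vector set" and k :: "'a \<Rightarrow> 'a \<Rightarrow> real" +
  fixes H :: "('a \<Rightarrow> real) \<Rightarrow> 'a" and c\<^sub>1 c\<^sub>2 :: real
  assumes spd: "spd W H" and c1_pos: "0 < c\<^sub>1" and c2_pos: "0 < c\<^sub>2"
    and lower: "f \<in> dual W \<Longrightarrow> c\<^sub>1 * f (H f) \<le> f (unriesz f)"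
    and upper: "f \<in> dual W \<Longrightarrow> f (unriesz f) \<le> c\<^sub>2 * f (H f)"
begin

lemma H_mem: "f \<in> dual W \<Longrightarrow> H f \<in> W"
  using spd unfolding spd_def by blast

lemma H_add: "f \<in> dual W \<Longrightarrow> g \<in> dual W \<Longrightarrow> H (f + g) = H f + H g"
  using spd unfolding spd_def by blast

lemma H_scale: "f \<in> dual W \<Longrightarrow> H (c *\<^sub>R f) = c *\<^sub>R H f"
  using spd unfolding spd_def by blast

lemma H_sym: "f \<in> dual W \<Longrightarrow> g \<in> dual W \<Longrightarrow> g (H f) = f (H g)"
  using spd unfolding spd_def by blast

lemma H_pos: "f \<in> dual W \<Longrightarrow> f \<noteq> 0 \<Longrightarrow> 0 < f (H f)"
  using spd unfolding spd_def by blast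

lemma H_nonneg: "f \<in> dual W \<Longrightarrow> 0 \<le> f (H f)"
  using H_pos[of f] by (cases "f = 0") auto

lemma riesz_add: "x \<in> W \<Longrightarrow> y \<in> W \<Longrightarrow> riesz (x + y) = riesz x + riesz y"
  by (auto simp: functional_on_def fun_eq_iff add_left)

lemma riesz_scale: "x \<in> W \<Longrightarrow> riesz (c *\<^sub>R x) = c *\<^sub>R riesz x"
  by (auto simp: functional_on_def fun_eq_iff scale_left scaleR_fun_def)

lemma riesz_apply: "y \<in> W \<Longrightarrow> riesz x y = k x y"
  by (simp add: functional_on_def)

lemma dual_diff_in_dual: "f \<in> dual W \<Longrightarrow> g \<in> dual W \<Longrightarrow> f + (-1) *\<^sub>R g \<in> dual W"
  by (simp add: dual_def scaleR_fun_def algebra_simps)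

text \<open>If two functionals have the same image, their difference d satisfies d (H d) = 0, and
  strict positivity leaves only d = 0.\<close>

lemma H_inj: "inj_on H (dual W)"
proof (rule inj_onI)
  fix f g assume fg: "f \<in> dual W" "g \<in> dual W" "H f = H g"
  let ?d = "f + (-1) *\<^sub>R g"
  have mg: "(-1) *\<^sub>R g \<in> dual W"
    using fg(2) by (simp add: dual_def scaleR_fun_def algebra_simps)
  have d: "?d \<in> dual W" using dual_diff_in_dual fg by blast
  have "H ?d = 0" using fg H_add[OF fg(1) mg] H_scale[OF fg(2), of "-1"] by simp
  then have "?d (H ?d) = 0" using dual_scale[OF d mem(3), of 0] by simp
  then have "?d = 0" using H_pos[OF d] by fastforce
  then show "f = g" by (simp add: fun_eq_iff scaleR_fun_def)
qed

text \<open>The form \<open>k (H (riesz x)) y\<close> is nondegenerate on \<open>W\<close>: if it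
  vanishes for all \<open>y\<close>, then \<open>y = x\<close> gives
  \<open>riesz x (H (riesz x)) = 0\<close>. Representing \<open>riesz u\<close> by it yields
  \<open>z\<close> with \<open>u = H (riesz z)\<close>.\<close>

lemma H_surj: "H ` dual W = W"
proof
  show "H ` dual W \<subseteq> W" using H_mem by blast
  show "W \<subseteq> H ` dual W"
  proof
    fix u assume u: "u \<in> W"
    have r: "riesz x \<in> dual W" if "x \<in> W" for x using functional_in_dual that .
    have HR: "H (riesz x) \<in> W" if "x \<in> W" for x using H_mem r that by blast
    let ?k = "\<lambda>x y. k (H (riesz x)) y"
    obtain z where z: "z \<in> W" "\<And>y. y \<in> W \<Longrightarrow> riesz u y = ?k z y"
    proof (rule nondegenerate_form_represents[OF fin, of ?k "riesz u"])
      fix x assume x: "x \<in> W" "\<And>y. y \<in> W \<Longrightarrow> ?k x y = 0"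
      have "riesz x (H (riesz x)) = 0"
        using x HR sym riesz_apply by metis
      then have "riesz x = 0" using H_pos[OF r[OF x(1)]] by fastforce
      then have "k x x = 0" using riesz_apply[OF x(1), of x] by simp
      then show "x = 0" using definite x(1) by blast
    qed (use u r HR in \<open>auto simp: riesz_add riesz_scale H_add H_scale add_left scale_left
        intro: functional_in_dual\<close>)
    have "riesz u = riesz (H (riesz z))"
      by (rule dual_eqI[OF r[OF u] r[OF HR[OF z(1)]]]) (use z riesz_apply in auto)
    then have "u = H (riesz z)"
      using inj_onD[OF riesz_inj _ u HR[OF z(1)]] by blast
    then show "u \<in> H ` dual W" using r z(1) by blast
  qed
qed

lemma H_bij: "bij_betw H (dual W) W"
  by (simp add: bij_betw_def H_inj H_surj)

lemma H_Cauchy_Schwarz: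
  assumes f: "f \<in> dual W" and g: "g \<in> dual W"
  shows "\<bar>g (H f)\<bar> \<le> sqrt (f (H f)) * sqrt (g (H g))"
proof -
  have dual_sub: "subspace (dual W)"
    unfolding subspace_def dual_def by (auto simp: scaleR_fun_def algebra_simps)
  interpret D: psd_form "dual W" "\<lambda>f g. g (H f)"
  proof
    show "subspace (dual W)" by (rule dual_sub)
    show "h (H (f + g)) = h (H f) + h (H g)" if "f \<in> dual W" "g \<in> dual W" "h \<in> dual W" for f g h
      using that by (simp add: H_add dual_add H_mem)
    show "h (H (c *\<^sub>R f)) = c * h (H f)" if "f \<in> dual W" "h \<in> dual W" for c f h
      using that by (simp add: H_scale dual_scale H_mem)
    show "g (H f) = f (H g)" if "f \<in> dual W" "g \<in> dual W" for f g
      using that by (rule H_sym)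
    show "0 \<le> f (H f)" if "f \<in> dual W" for f using that by (rule H_nonneg)
  qed
  show ?thesis using D.Cauchy_Schwarz[OF f g] .
qed

text \<open>For \<open>u = H f\<close> the right-hand side is the squared norm of \<open>u\<close>
  defined by the inverse of \<open>H\<close>, so the hypothesis on inverses is turned into one on
  the operators themselves. With \<open>g = riesz u\<close>, Cauchy-Schwarz for \<open>H\<close>
  bounds \<open>(k u u)\<^sup>2\<close> by \<open>f (H f) * g (H g)\<close>, the hypothesis at
  \<open>g\<close> bounds \<open>c\<^sub>1 * g (H g)\<close> by \<open>k u u\<close>, and one factor
  \<open>k u u\<close> cancels.\<close>

lemma inverse_norm_lower:
  assumes f: "f \<in> dual W"
  shows "c\<^sub>1 * k (H f) (H f) \<le> f (H f)"
proof -
  define u where "u = H f"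
  have u: "u \<in> W" using H_mem f u_def by blast
  define g where "g = riesz u"
  have g: "g \<in> dual W" using functional_in_dual u g_def by blast
  have a: "k u u = g (H f)" unfolding g_def using u by (simp add: functional_on_def u_def)
  have "g (unriesz g) = k u u" unfolding g_def using u unriesz_riesz by (simp add: functional_on_def)
  then have b: "c\<^sub>1 * g (H g) \<le> k u u" using lower[OF g] by simp
  have nn: "0 \<le> k u u" using nonneg u .
  have "(k u u)\<^sup>2 \<le> (sqrt (f (H f)) * sqrt (g (H g)))\<^sup>2"
    using H_Cauchy_Schwarz[OF f g] nn by (intro power_mono) (auto simp: a)
  also have "\<dots> = f (H f) * g (H g)" using H_nonneg f g by (simp add: power_mult_distrib)
  finally have "c\<^sub>1 * (k u u)\<^sup>2 \<le> f (H f) * (c\<^sub>1 * g (H g))"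
    using c1_pos by (simp add: mult_left_mono algebra_simps)
  also have "\<dots> \<le> f (H f) * k u u" using b H_nonneg[OF f] by (rule mult_left_mono)
  finally have "(c\<^sub>1 * k u u) * k u u \<le> f (H f) * k u u" by (simp add: power2_eq_square)
  then show ?thesis
    using nn H_nonneg[OF f] unfolding u_def[symmetric]
    by (cases "k u u = 0") (auto simp: mult_le_cancel_right)
qed

text \<open>The counterpart for the other constant. Here Cauchy-Schwarz pairs \<open>f\<close> with
  \<open>u = H f\<close> in the norm of \<open>k\<close> and its dual, the hypothesis is applied at
  \<open>f\<close>, and one factor \<open>f u\<close> cancels.\<close>

lemma inverse_norm_upper:
  assumes f: "f \<in> dual W"
  shows "f (H f) \<le> c\<^sub>2 * k (H f) (H f)"
proof -
  define u where "u = H f"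
  have u: "u \<in> W" using H_mem f u_def by blast
  have nn: "0 \<le> k u u" "0 \<le> f u" using nonneg u H_nonneg f u_def by auto
  have "(f u)\<^sup>2 \<le> (sqrt (f (unriesz f)) * sqrt (k u u))\<^sup>2"
    using dual_Cauchy_Schwarz[OF f u] nn by (intro power_mono) auto
  also have "\<dots> = f (unriesz f) * k u u" using dual_norm_nonneg[OF f] nn by (simp add: power_mult_distrib)
  also have "\<dots> \<le> (c\<^sub>2 * f u) * k u u" using upper[OF f] nn unfolding u_def by (intro mult_right_mono)
  finally have "f u * f u \<le> (c\<^sub>2 * k u u) * f u" by (simp add: power2_eq_square algebra_simps)
  then show ?thesis
    using nn c2_pos unfolding u_def[symmetric]
    by (cases "f u = 0") (auto simp: mult_le_cancel_right)
qed

end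

locale saddle_point =
  a: inner_form V a + s: inner_form Q s + c: psd_form Q c
  for V :: "'v::real_vector set" and a and Q :: "'q::real_vector set" and s c +
  fixes b :: "'v \<Rightarrow> 'q \<Rightarrow> real" and k\<^sub>0 k\<^sub>1 :: real
  assumes b_add_left: "u \<in> V \<Longrightarrow> v \<in> V \<Longrightarrow> q \<in> Q \<Longrightarrow> b (u + v) q = b u q + b v q"
    and b_scale_left: "v \<in> V \<Longrightarrow> q \<in> Q \<Longrightarrow> b (r *\<^sub>R v) q = r * b v q"
    and b_add_right: "v \<in> V \<Longrightarrow> p \<in> Q \<Longrightarrow> q \<in> Q \<Longrightarrow> b v (p + q) = b v p + b v q"
    and b_scale_right: "v \<in> V \<Longrightarrow> q \<in> Q \<Longrightarrow> b v (r *\<^sub>R q) = r * b v q"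
    and c_le_s: "q \<in> Q \<Longrightarrow> c q q \<le> s q q"
    and b_bound: "v \<in> V \<Longrightarrow> q \<in> Q \<Longrightarrow> \<bar>b v q\<bar> \<le> sqrt (a v v) * sqrt (s q q)"
    and k0_nonneg: "0 \<le> k\<^sub>0" and k1_nonneg: "0 \<le> k\<^sub>1"
    and inf_sup: "q \<in> Q \<Longrightarrow> 0 \<le> R \<Longrightarrow> (\<And>v. v \<in> V \<Longrightarrow> b v q \<le> R * sqrt (a v v)) \<Longrightarrow>
      sqrt (s q q - c q q) \<le> k\<^sub>0 * sqrt (c q q) + k\<^sub>1 * R"
begin

fun saddle_operator :: "'v \<times> 'q \<Rightarrow> ('v \<Rightarrow> real) \<times> ('q \<Rightarrow> real)" where
  "saddle_operator (u, p) =
     (functional_on V (\<lambda>v. a u v + b v p), functional_on Q (\<lambda>q. b u q - c p q))"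

fun saddle_form :: "'v \<times> 'q \<Rightarrow> 'v \<times> 'q \<Rightarrow> real" where
  "saddle_form (u, p) (v, q) = a u v + b v p + b u q - c p q"

fun energy :: "'v \<times> 'q \<Rightarrow> real" where
  "energy (u, p) = sqrt (a u u + s p p)"

text \<open>The sum of the coefficients in the quadratic inequality for the energy, 1 + 2 (k0 +
  k1)^2 for the mixed term and 2 k1^2 for the squared residual.\<close>

definition stability_constant :: real where
  "stability_constant = 1 + 2 * (k\<^sub>0 + k\<^sub>1)\<^sup>2 + 2 * k\<^sub>1\<^sup>2"

lemma pairing_saddle_operator:
  "y \<in> V \<times> Q \<Longrightarrow> pairing (saddle_operator x) y = saddle_form x y"
  by (cases x; cases y) (auto simp: functional_on_def)

lemma energy_nonneg: "x \<in> V \<times> Q \<Longrightarrow> 0 \<le> energy x"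
  using a.nonneg s.nonneg by (cases x) auto

text \<open>Each of the four blocks has bound 1 in the norms of \<open>a\<close> and
  \<open>s\<close>, so the form is at most a product of two sums of two norms. Each sum exceeds the
  corresponding energy by at most the factor sqrt 2, hence the constant 2.\<close>

lemma saddle_form_le:
  assumes "x \<in> V \<times> Q" "y \<in> V \<times> Q"
  shows "saddle_form x y \<le> 2 * energy x * energy y"
proof -
  obtain u p v q where xy: "x = (u, p)" "y = (v, q)" and m: "u \<in> V" "v \<in> V" "p \<in> Q" "q \<in> Q"
    using assms by (cases x; cases y) auto
  define nu nv np nq where "nu = sqrt (a u u)" and "nv = sqrt (a v v)"
    and "np = sqrt (s p p)" and "nq = sqrt (s q q)"
  have nn: "0 \<le> a u u" "0 \<le> a v v" "0 \<le> s p p" "0 \<le> s q q"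
    using m a.nonneg s.nonneg by auto
  have sq: "a u u = nu\<^sup>2" "a v v = nv\<^sup>2" "s p p = np\<^sup>2" "s q q = nq\<^sup>2"
    using nn by (auto simp: nu_def nv_def np_def nq_def)
  have nn': "0 \<le> nu" "0 \<le> nv" "0 \<le> np" "0 \<le> nq"
    using nn by (auto simp: nu_def nv_def np_def nq_def)
  have t1: "a u v \<le> nu * nv"
    using a.Cauchy_Schwarz[OF m(1,2)] by (simp add: nu_def nv_def)
  have t2: "b v p \<le> nv * np" "b u q \<le> nu * nq"
    using b_bound[OF m(2,3)] b_bound[OF m(1,4)] by (auto simp: nu_def nv_def np_def nq_def)
  have "\<bar>c p q\<bar> \<le> sqrt (c p p) * sqrt (c q q)" using c.Cauchy_Schwarz m by blast
  also have "\<dots> \<le> np * nq"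
    unfolding np_def nq_def using c_le_s m c.nonneg nn
    by (intro mult_mono real_sqrt_le_mono) auto
  finally have t3: "- c p q \<le> np * nq" by simp
  have "saddle_form x y \<le> (nu + np) * (nv + nq)"
    using t1 t2 t3 by (simp add: xy algebra_simps)
  also have "\<dots> \<le> (sqrt 2 * energy x) * (sqrt 2 * energy y)"
  proof (intro mult_mono)
    have le: "r + t \<le> sqrt 2 * sqrt (r\<^sup>2 + t\<^sup>2)" for r t :: real
    proof -
      have "(r + t)\<^sup>2 \<le> 2 * (r\<^sup>2 + t\<^sup>2)"
        using zero_le_power2[of "r - t"] by (simp add: power2_eq_square algebra_simps)
      then have "r + t \<le> sqrt (2 * (r\<^sup>2 + t\<^sup>2))" by (rule real_le_rsqrt)
      then show ?thesis by (simp only: real_sqrt_mult)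
    qed
    show "nu + np \<le> sqrt 2 * energy x" "nv + nq \<le> sqrt 2 * energy y"
      using le by (auto simp: xy sq)
  qed (use nn' nn in \<open>auto simp: xy\<close>)
  also have "\<dots> = (sqrt 2 * sqrt 2) * (energy x * energy y)" by (simp only: ac_simps)
  finally show ?thesis by simp
qed

lemma stability:
  assumes x: "x \<in> V \<times> Q" and R: "0 \<le> R"
    and res: "\<And>y. y \<in> V \<times> Q \<Longrightarrow> saddle_form x y \<le> R * energy y"
  shows "energy x \<le> stability_constant * R"
proof -
  obtain u p where xup: "x = (u, p)" and m: "u \<in> V" "p \<in> Q" using x by auto
  define X where "X = energy x"
  define E where "E = sqrt (a u u + c p p)"
  have nn: "0 \<le> a u u" "0 \<le> c p p" "0 \<le> s p p" "c p p \<le> s p p"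
    using m a.nonneg c.nonneg s.nonneg c_le_s by auto
  \<comment> \<open>The sign change cancels the two coupling terms, makes the pressure block
    positive, and leaves the energy of the test vector equal to that of \<open>x\<close>.\<close>
  have "saddle_form x (u, - p) = a u u + c p p"
    using m b_scale_right[of u p "-1"] by (simp add: xup c.neg_right)
  moreover have "energy (u, - p) = X"
    using m by (simp add: xup X_def s.neg_left s.neg_right s.mem)
  ultimately have E: "E\<^sup>2 \<le> R * X"
    using res[of "(u, - p)"] m nn by (simp add: E_def s.mem)
  have aE: "sqrt (a u u) \<le> E" "sqrt (c p p) \<le> E" "0 \<le> E" using nn by (auto simp: E_def)
  \<comment> \<open>The test vector \<open>(v, 0)\<close> isolates \<open>b v p\<close> up to
    \<open>a u v\<close>, which costs the additional \<open>E\<close>.\<close>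
  have "b v p \<le> (R + E) * sqrt (a v v)" if v: "v \<in> V" for v
  proof -
    have "a u v + b v p \<le> R * sqrt (a v v)"
      using res[of "(v, 0)"] v m b_scale_right[of u 0 0] s.mem(3) c.zero_left[OF m(2)]
        c.sym[OF m(2) s.mem(3)] s.zero_left[OF s.mem(3)]
      by (simp add: xup)
    moreover have "- a u v \<le> sqrt (a u u) * sqrt (a v v)"
      using a.Cauchy_Schwarz[OF m(1) v] by simp
    moreover have "sqrt (a u u) * sqrt (a v v) \<le> E * sqrt (a v v)"
      using aE a.nonneg[OF v] by (intro mult_right_mono) auto
    ultimately show ?thesis by (simp add: algebra_simps)
  qed
  from inf_sup[OF m(2) _ this]
  have "sqrt (s p p - c p p) \<le> k\<^sub>0 * sqrt (c p p) + k\<^sub>1 * (R + E)"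
    using R aE by simp
  also have "\<dots> \<le> k\<^sub>0 * E + k\<^sub>1 * (R + E)"
    using aE k0_nonneg by (simp add: mult_left_mono)
  finally have "sqrt (s p p - c p p) \<le> (k\<^sub>0 + k\<^sub>1) * E + k\<^sub>1 * R"
    by (simp add: algebra_simps)
  \<comment> \<open>The estimate is squared because \<open>E\<close> is controlled only through
    \<open>E\<^sup>2 \<le> R * X\<close>; the inequality (x + y)^2 \<le> 2 x^2 + 2 y^2 removes the
    cross term and produces the factors 2 in \<open>stability_constant\<close>.\<close>
  then have "(sqrt (s p p - c p p))\<^sup>2 \<le> ((k\<^sub>0 + k\<^sub>1) * E + k\<^sub>1 * R)\<^sup>2"
    using nn by (intro power_mono) auto
  also have "\<dots> \<le> 2 * ((k\<^sub>0 + k\<^sub>1) * E)\<^sup>2 + 2 * (k\<^sub>1 * R)\<^sup>2"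
    using sum_squares_bound[of "(k\<^sub>0 + k\<^sub>1) * E" "k\<^sub>1 * R"] by (simp add: power2_sum)
  finally have "s p p - c p p \<le> 2 * (k\<^sub>0 + k\<^sub>1)\<^sup>2 * E\<^sup>2 + 2 * k\<^sub>1\<^sup>2 * R\<^sup>2"
    using nn by (simp add: power_mult_distrib)
  moreover have "X\<^sup>2 = E\<^sup>2 + (s p p - c p p)"
    using nn by (simp add: X_def xup E_def)
  moreover have "2 * (k\<^sub>0 + k\<^sub>1)\<^sup>2 * E\<^sup>2 \<le> 2 * (k\<^sub>0 + k\<^sub>1)\<^sup>2 * (R * X)"
    using E by (intro mult_left_mono) auto
  ultimately have "X\<^sup>2 \<le> (1 + 2 * (k\<^sub>0 + k\<^sub>1)\<^sup>2) * R * X + (2 * k\<^sub>1\<^sup>2) * R\<^sup>2"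
    using E by (simp add: algebra_simps)
  moreover have "0 \<le> X" using energy_nonneg[OF x] by (simp add: X_def)
  moreover have "1 \<le> stability_constant" by (simp add: stability_constant_def)
  ultimately have "X \<le> stability_constant * R"
    using R real_quadratic_bound[of X R stability_constant "1 + 2 * (k\<^sub>0 + k\<^sub>1)\<^sup>2" "2 * k\<^sub>1\<^sup>2"]
    by (simp add: stability_constant_def)
  then show ?thesis by (simp add: X_def)
qed

lemma saddle_operator_dual: "x \<in> V \<times> Q \<Longrightarrow> saddle_operator x \<in> dual V \<times> dual Q"
  by (cases x) (auto simp: dual_def functional_on_def a.mem s.mem a.add_right a.scale_right
      b_add_left b_scale_left b_add_right b_scale_right c.add_right c.scale_right algebra_simps)

lemma saddle_form_nondegenerate:
  assumes x: "x \<in> V \<times> Q" and z: "\<And>y. y \<in> V \<times> Q \<Longrightarrow> saddle_form x y = 0"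
  shows "x = 0"
proof -
  have "energy x \<le> stability_constant * 0"
    by (rule stability[OF x]) (use z energy_nonneg in auto)
  moreover obtain u p where xup: "x = (u, p)" and m: "u \<in> V" "p \<in> Q" using x by auto
  ultimately have "a u u + s p p = 0" using a.nonneg[OF m(1)] s.nonneg[OF m(2)] by simp
  then have "a u u = 0" "s p p = 0" using a.nonneg[OF m(1)] s.nonneg[OF m(2)] by auto
  then show ?thesis using a.definite s.definite m by (simp add: xup zero_prod_def)
qed

lemma saddle_form_add_left:
  "x \<in> V \<times> Q \<Longrightarrow> x' \<in> V \<times> Q \<Longrightarrow> y \<in> V \<times> Q \<Longrightarrow>
    saddle_form (x + x') y = saddle_form x y + saddle_form x' y"
  by (cases x; cases x'; cases y)
    (auto simp: a.add_left b_add_left b_add_right c.add_left)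

lemma saddle_form_scale_left:
  "x \<in> V \<times> Q \<Longrightarrow> y \<in> V \<times> Q \<Longrightarrow> saddle_form (r *\<^sub>R x) y = r * saddle_form x y"
  by (cases x; cases y)
    (auto simp: a.scale_left b_scale_left b_scale_right c.scale_left algebra_simps)

lemma pairing_in_dual:
  assumes "f \<in> dual V" "g \<in> dual Q"
  shows "functional_on (V \<times> Q) (pairing (f, g)) \<in> dual (V \<times> Q)"
  using assms by (auto simp: dual_def functional_on_def a.mem s.mem algebra_simps)

text \<open>Both halves follow from nondegeneracy on the finite-dimensional space
  \<open>V \<times> Q\<close>. For surjectivity a pair of functionals is read, through
  \<open>pairing\<close>, as one functional on that product and then represented by
  \<open>saddle_form\<close>.\<close>

lemma saddle_operator_bij: "bij_betw saddle_operator (V \<times> Q) (dual V \<times> dual Q)"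
  unfolding bij_betw_def
proof
  have sub: "subspace (V \<times> Q)"
    using finite_dim_Times[OF a.fin s.fin] by (simp add: finite_dim_def)
  show "inj_on saddle_operator (V \<times> Q)"
  proof (rule inj_onI)
    fix x x' assume x: "x \<in> V \<times> Q" "x' \<in> V \<times> Q" "saddle_operator x = saddle_operator x'"
    have "x - x' = 0"
    proof (rule saddle_form_nondegenerate)
      show d: "x - x' \<in> V \<times> Q" using sub x subspace_diff by blast
      fix y assume y: "y \<in> V \<times> Q"
      have "saddle_form x y = saddle_form x' y"
        using pairing_saddle_operator[OF y, of x] pairing_saddle_operator[OF y, of x'] x(3) by simp
      moreover have "saddle_form x y = saddle_form (x - x') y + saddle_form x' y"
        using saddle_form_add_left[OF d x(2) y] by simp
      ultimately show "saddle_form (x - x') y = 0" by simp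
    qed
    then show "x = x'" by simp
  qed
  have "h \<in> saddle_operator ` (V \<times> Q)" if h: "h \<in> dual V \<times> dual Q" for h
  proof -
    obtain f g where hfg: "h = (f, g)" and fg: "f \<in> dual V" "g \<in> dual Q" using h by auto
    have sf: "functional_on (V \<times> Q) (saddle_form x) = functional_on (V \<times> Q) (pairing (saddle_operator x))" for x
      by (auto simp: functional_on_def fun_eq_iff simp del: pairing.simps saddle_form.simps
          saddle_operator.simps pairing_saddle_operator simp: pairing_saddle_operator)
    obtain x where x: "x \<in> V \<times> Q"
        "\<And>y. y \<in> V \<times> Q \<Longrightarrow> functional_on (V \<times> Q) (pairing (f, g)) y = saddle_form x y"
    proof (rule nondegenerate_form_represents[OF finite_dim_Times[OF a.fin s.fin] _ _ _ _
          pairing_in_dual[OF fg], of saddle_form])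
      show "functional_on (V \<times> Q) (saddle_form x) \<in> dual (V \<times> Q)" if "x \<in> V \<times> Q" for x
        using pairing_in_dual saddle_operator_dual[OF that] sf
        by (cases "saddle_operator x") auto
      show "saddle_form (x + y) z = saddle_form x z + saddle_form y z"
        if "x \<in> V \<times> Q" "y \<in> V \<times> Q" "z \<in> V \<times> Q" for x y z
        using that by (rule saddle_form_add_left)
      show "saddle_form (r *\<^sub>R x) z = r * saddle_form x z"
        if "x \<in> V \<times> Q" "z \<in> V \<times> Q" for r x z
        using that by (rule saddle_form_scale_left)
      show "x = 0" if "x \<in> V \<times> Q" "\<And>y. y \<in> V \<times> Q \<Longrightarrow> saddle_form x y = 0" for x
        using that by (rule saddle_form_nondegenerate)
    qed (rule that, assumption, simp)
    have eq: "pairing (f, g) y = pairing (saddle_operator x) y" if "y \<in> V \<times> Q" for y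
      using x(2)[OF that] that by (simp add: functional_on_def pairing_saddle_operator)
    obtain f' g' where fg': "saddle_operator x = (f', g')" "f' \<in> dual V" "g' \<in> dual Q"
      using saddle_operator_dual[OF x(1)] by (cases "saddle_operator x") auto
    \<comment> \<open>Testing with vectors \<open>(v, 0)\<close> and \<open>(0, q)\<close> separates
      the components; vanishing at 0 removes the contribution of the other one.\<close>
    have z: "f 0 = 0" "f' 0 = 0" "g 0 = 0" "g' 0 = 0"
      using dual_scale[of _ V 0 0] dual_scale[of _ Q 0 0] fg fg' a.mem(3) s.mem(3) by auto
    have "f = f'"
      by (rule dual_eqI[OF fg(1) fg'(2)])
        (use eq[of "(_, 0)"] z s.mem(3) fg'(1) in auto)
    moreover have "g = g'"
      by (rule dual_eqI[OF fg(2) fg'(3)])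
        (use eq[of "(0, _)"] z a.mem(3) fg'(1) in auto)
    ultimately show ?thesis using fg'(1) hfg x(1) by (metis imageI)
  qed
  then show "saddle_operator ` (V \<times> Q) = dual V \<times> dual Q"
    using saddle_operator_dual by blast
qed

section \<open>Dual energy and the condition number bound\<close>

fun dual_energy :: "('v \<Rightarrow> real) \<times> ('q \<Rightarrow> real) \<Rightarrow> real" where
  "dual_energy (f, g) = sqrt (f (a.unriesz f) + g (s.unriesz g))"

text \<open>The pair of Riesz representatives \<open>y\<close> attains the dual norm D: its energy
  is D and its pairing with the functional is D^2. The bound of the form at \<open>y\<close>
  therefore gives D^2 \<le> 2 D times the energy of \<open>x\<close>.\<close>

lemma dual_energy_le:
  assumes x: "x \<in> V \<times> Q"
  shows "dual_energy (saddle_operator x) \<le> 2 * energy x"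
proof -
  obtain f g where fg: "saddle_operator x = (f, g)" "f \<in> dual V" "g \<in> dual Q"
    using saddle_operator_dual[OF x] by (cases "saddle_operator x") auto
  define y where "y = (a.unriesz f, s.unriesz g)"
  have y: "y \<in> V \<times> Q" using fg a.unriesz_mem s.unriesz_mem by (simp add: y_def)
  define D where "D = dual_energy (f, g)"
  have nn: "0 \<le> f (a.unriesz f)" "0 \<le> g (s.unriesz g)"
    using a.dual_norm_nonneg s.dual_norm_nonneg fg by auto
  have eD: "energy y = D"
    using a.apply_unriesz[OF fg(2) a.unriesz_mem[OF fg(2)]]
      s.apply_unriesz[OF fg(3) s.unriesz_mem[OF fg(3)]] by (simp add: y_def D_def)
  have "D\<^sup>2 = saddle_form x y"
    using pairing_saddle_operator[OF y, of x] nn by (simp add: fg D_def y_def)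
  also have "\<dots> \<le> 2 * energy x * D" using saddle_form_le[OF x y] eD by simp
  finally have "D * D \<le> (2 * energy x) * D" by (simp add: power2_eq_square)
  moreover have "0 \<le> D" using nn by (simp add: D_def)
  ultimately have "D \<le> 2 * energy x"
    using energy_nonneg[OF x] by (cases "D = 0") (auto simp: mult_le_cancel_right)
  then show ?thesis by (simp add: D_def fg)
qed

text \<open>The dual energy of the residual is an admissible \<open>R\<close> in
  \<open>stability\<close>, by Cauchy-Schwarz in each component and once more in the plane.\<close>

lemma energy_le_dual_energy:
  assumes x: "x \<in> V \<times> Q"
  shows "energy x \<le> stability_constant * dual_energy (saddle_operator x)"
proof -
  obtain f g where fg: "saddle_operator x = (f, g)" "f \<in> dual V" "g \<in> dual Q"
    using saddle_operator_dual[OF x] by (cases "saddle_operator x") auto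
  have nn: "0 \<le> f (a.unriesz f)" "0 \<le> g (s.unriesz g)"
    using a.dual_norm_nonneg s.dual_norm_nonneg fg by auto
  show ?thesis
  proof (rule stability[OF x])
    show "0 \<le> dual_energy (saddle_operator x)" using nn by (simp add: fg)
    fix y assume y: "y \<in> V \<times> Q"
    obtain v q where vq: "y = (v, q)" "v \<in> V" "q \<in> Q" using y by auto
    have nn': "0 \<le> a v v" "0 \<le> s q q" using vq a.nonneg s.nonneg by auto
    have "saddle_form x y = f v + g q"
      using pairing_saddle_operator[OF y, of x] by (simp add: fg vq)
    also have "\<dots> \<le> sqrt (f (a.unriesz f)) * sqrt (a v v) + sqrt (g (s.unriesz g)) * sqrt (s q q)"
      using a.dual_Cauchy_Schwarz[OF fg(2) vq(2)] s.dual_Cauchy_Schwarz[OF fg(3) vq(3)] by linarith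
    also have "\<dots> \<le> sqrt ((sqrt (f (a.unriesz f)))\<^sup>2 + (sqrt (g (s.unriesz g)))\<^sup>2) *
        sqrt ((sqrt (a v v))\<^sup>2 + (sqrt (s q q))\<^sup>2)"
    proof -
      have cs: "\<alpha> * \<beta> + \<gamma> * \<delta> \<le> sqrt (\<alpha>\<^sup>2 + \<gamma>\<^sup>2) * sqrt (\<beta>\<^sup>2 + \<delta>\<^sup>2)" for \<alpha> \<beta> \<gamma> \<delta> :: real
        using norm_cauchy_schwarz[of "(\<alpha>, \<gamma>)" "(\<beta>, \<delta>)"] by (simp add: norm_Pair)
      show ?thesis by (rule cs)
    qed
    also have "\<dots> = dual_energy (saddle_operator x) * energy y"
      using nn nn' by (simp add: fg vq)
    finally show "saddle_form x y \<le> dual_energy (saddle_operator x) * energy y" .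
  qed
qed

lemma stability_constant_pos: "0 < stability_constant"
  unfolding stability_constant_def by (simp add: add_pos_nonneg)

text \<open>The squared norm of \<open>M (f, g)\<close> is \<open>f (Hu f) + g (Hp g)\<close>. It is
  comparable with the squared energy of \<open>M (f, g)\<close> as well as with the squared dual
  energy of \<open>(f, g)\<close>. Each of the two operator norms uses both comparisons, which costs
  two square roots: \<open>2 / c\<^sub>1\<close> for the operator and
  \<open>stability_constant * c\<^sub>2\<close> for its inverse. The map \<open>M\<close> is
  prescribed only on pairs of dual functionals because an operator built with
  \<open>the_inv_into\<close> is unspecified elsewhere.\<close>

theorem cond_number_saddle_operator_le:
  assumes Hu: "equivalent_preconditioner V a Hu c\<^sub>1 c\<^sub>2" and Hp: "equivalent_preconditioner Q s Hp c\<^sub>1 c\<^sub>2"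
    and M: "\<And>f g. f \<in> dual V \<Longrightarrow> g \<in> dual Q \<Longrightarrow> M (f, g) = (Hu f, Hp g)"
  shows "cond_number V Q M saddle_operator \<le> ennreal (2 * stability_constant * c\<^sub>2 / c\<^sub>1)"
proof -
  interpret u: equivalent_preconditioner V a Hu c\<^sub>1 c\<^sub>2 by (rule Hu)
  interpret p: equivalent_preconditioner Q s Hp c\<^sub>1 c\<^sub>2 by (rule Hp)
  note c12 = u.c1_pos u.c2_pos
  define X' where "X' = dual V \<times> dual Q"
  have M': "M h = map_prod Hu Hp h" if "h \<in> X'" for h
    using that M by (auto simp: X'_def)
  have Mbij: "bij_betw M X' (V \<times> Q)"
    using bij_betw_cong[of X' M "map_prod Hu Hp"] M'
      bij_betw_map_prod[OF u.H_bij p.H_bij] unfolding X'_def by blast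
  define T where "T = M \<circ> saddle_operator"
  define N where "N = inv_norm V Q M"
  have Tbij: "bij_betw T (V \<times> Q) (V \<times> Q)"
    unfolding T_def using saddle_operator_bij Mbij bij_betw_trans unfolding X'_def by blast
  have NM: "N (M (f, g)) = sqrt (f (Hu f) + g (Hp g))" if "f \<in> dual V" "g \<in> dual Q" for f g
  proof -
    have "the_inv_into X' M (M (f, g)) = (f, g)"
      using Mbij that by (intro the_inv_into_f_f) (auto simp: bij_betw_def X'_def)
    then show ?thesis using M[OF that] by (simp add: N_def inv_norm_def X'_def)
  qed
  have N_energy: "sqrt c\<^sub>1 * energy x \<le> N x \<and> N x \<le> sqrt c\<^sub>2 * energy x" if x: "x \<in> V \<times> Q" for x
  proof -
    obtain f g where fg: "f \<in> dual V" "g \<in> dual Q" "x = M (f, g)"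
    proof -
      have "x \<in> M ` (dual V \<times> dual Q)" using Mbij x by (simp add: bij_betw_def X'_def)
      then show ?thesis using that by auto
    qed
    have xe: "x = (Hu f, Hp g)" using fg M by simp
    have "c\<^sub>1 * (a (Hu f) (Hu f) + s (Hp g) (Hp g)) \<le> f (Hu f) + g (Hp g)"
      using u.inverse_norm_lower[OF fg(1)] p.inverse_norm_lower[OF fg(2)] by (simp add: algebra_simps)
    moreover have "f (Hu f) + g (Hp g) \<le> c\<^sub>2 * (a (Hu f) (Hu f) + s (Hp g) (Hp g))"
      using u.inverse_norm_upper[OF fg(1)] p.inverse_norm_upper[OF fg(2)] by (simp add: algebra_simps)
    ultimately show ?thesis
      unfolding fg(3) NM[OF fg(1,2)] unfolding fg(3)[symmetric] xe
      by (simp flip: real_sqrt_mult)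
  qed
  have N_dual: "sqrt c\<^sub>1 * N (T x) \<le> dual_energy (saddle_operator x) \<and>
      dual_energy (saddle_operator x) \<le> sqrt c\<^sub>2 * N (T x)" if x: "x \<in> V \<times> Q" for x
  proof -
    obtain f g where fg: "saddle_operator x = (f, g)" "f \<in> dual V" "g \<in> dual Q"
      using saddle_operator_dual[OF x] by (cases "saddle_operator x") auto
    have "c\<^sub>1 * (f (Hu f) + g (Hp g)) \<le> f (a.unriesz f) + g (s.unriesz g)"
      using u.lower[OF fg(2)] p.lower[OF fg(3)] by (simp add: algebra_simps)
    moreover have "f (a.unriesz f) + g (s.unriesz g) \<le> c\<^sub>2 * (f (Hu f) + g (Hp g))"
      using u.upper[OF fg(2)] p.upper[OF fg(3)] by (simp add: algebra_simps)
    ultimately show ?thesis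
      by (simp add: T_def fg NM flip: real_sqrt_mult)
  qed
  have N_nonneg: "0 \<le> N x" if "x \<in> V \<times> Q" for x
  proof -
    have "0 \<le> sqrt c\<^sub>1 * energy x" using energy_nonneg[OF that] c12 by simp
    then show ?thesis using N_energy[OF that] by linarith
  qed
  have le1: "N (T x) \<le> 2 / c\<^sub>1 * N x" if x: "x \<in> V \<times> Q" for x
  proof -
    have "c\<^sub>1 * N (T x) = sqrt c\<^sub>1 * (sqrt c\<^sub>1 * N (T x))" using c12 by simp
    also have "\<dots> \<le> sqrt c\<^sub>1 * (2 * energy x)"
      using N_dual[OF x] dual_energy_le[OF x] c12 by (intro mult_left_mono) auto
    also have "\<dots> \<le> 2 * N x" using N_energy[OF x] by (simp add: algebra_simps)
    finally show ?thesis using c12 by (simp add: field_simps)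
  qed
  have le2: "N x \<le> stability_constant * c\<^sub>2 * N (T x)" if x: "x \<in> V \<times> Q" for x
  proof -
    have "N x \<le> sqrt c\<^sub>2 * energy x" using N_energy[OF x] by blast
    also have "\<dots> \<le> sqrt c\<^sub>2 * (stability_constant * dual_energy (saddle_operator x))"
      using energy_le_dual_energy[OF x] c12 by (intro mult_left_mono) auto
    also have "\<dots> \<le> sqrt c\<^sub>2 * (stability_constant * (sqrt c\<^sub>2 * N (T x)))"
      using N_dual[OF x] c12 stability_constant_pos by (intro mult_left_mono) auto
    also have "\<dots> = stability_constant * c\<^sub>2 * N (T x)"
      using c12 by (simp add: algebra_simps)
    finally show ?thesis .
  qed
  \<comment> \<open>For \<open>t = 0\<close> the quotient is 0 by convention, so the bound covers
    this case too.\<close>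
  have ratio: "r / t \<le> k" if "r \<le> k * t" "0 \<le> t" "0 \<le> k" for r t k :: real
    using that by (cases "t = 0") (auto simp: divide_le_eq)
  have "op_norm (V \<times> Q) N T \<le> ennreal (2 / c\<^sub>1)"
    unfolding op_norm_def
    by (rule SUP_least) (use le1 N_nonneg c12 in \<open>auto intro!: ennreal_leI ratio\<close>)
  moreover have "op_norm (V \<times> Q) N (the_inv_into (V \<times> Q) T) \<le> ennreal (stability_constant * c\<^sub>2)"
    unfolding op_norm_def
  proof (rule SUP_least)
    fix y assume y: "y \<in> V \<times> Q - {0}"
    let ?x = "the_inv_into (V \<times> Q) T y"
    have "T ?x = y" using Tbij y by (intro f_the_inv_into_f_bij_betw) auto
    moreover have "?x \<in> V \<times> Q"
      using bij_betw_the_inv_into[OF Tbij] y by (auto simp: bij_betw_def)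
    ultimately show "ennreal (N ?x / N y) \<le> ennreal (stability_constant * c\<^sub>2)"
      using le2[of ?x] N_nonneg[of y] y c12 stability_constant_pos
      by (intro ennreal_leI ratio) auto
  qed
  ultimately have "op_norm (V \<times> Q) N T * op_norm (V \<times> Q) N (the_inv_into (V \<times> Q) T)
      \<le> ennreal (2 / c\<^sub>1) * ennreal (stability_constant * c\<^sub>2)"
    by (rule mult_mono) auto
  also have "\<dots> = ennreal (2 * stability_constant * c\<^sub>2 / c\<^sub>1)"
    using c12 stability_constant_pos by (simp flip: ennreal_mult)
  finally show ?thesis
    using Tbij by (simp add: cond_number_def T_def N_def Let_def)
qed

end

section \<open>Piecewise polynomials\<close>

lemma AE_lebesgue_negligible:
  fixes P :: "'a::euclidean_space \<Rightarrow> bool"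
  shows "(AE x in lebesgue. P x) \<longleftrightarrow> negligible {x. \<not> P x}"
  by (simp add: completion.AE_iff_null_sets negligible_iff_null_sets)

text \<open>The polynomial dependence of the derivative on the base point is carried along because
  it gives continuity up to the boundary of a cell.\<close>

lemma real_polynomial_has_derivative:
  fixes p :: "'a::real_normed_vector \<Rightarrow> real"
  assumes "real_polynomial_function p"
  obtains D where "\<And>x. (p has_derivative D x) (at x)"
    and "\<And>e. real_polynomial_function (\<lambda>x. D x e)"
proof -
  have "\<exists>D. (\<forall>x. (p has_derivative D x) (at x)) \<and> (\<forall>e. real_polynomial_function (\<lambda>x. D x e))"
    using assms
  proof induction
    case (linear f)
    show ?case
      by (rule exI[of _ "\<lambda>x. f"]) (use linear in \<open>auto intro: bounded_linear_imp_has_derivative\<close>)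
  next
    case (const c)
    show ?case by (rule exI[of _ "\<lambda>x h. 0"]) auto
  next
    case (add f g)
    then obtain D E where "\<And>x. (f has_derivative D x) (at x)" "\<And>e. real_polynomial_function (\<lambda>x. D x e)"
      "\<And>x. (g has_derivative E x) (at x)" "\<And>e. real_polynomial_function (\<lambda>x. E x e)" by blast
    then show ?case
      by (intro exI[of _ "\<lambda>x h. D x h + E x h"]) (auto intro!: has_derivative_add)
  next
    case (mult f g)
    then obtain D E where "\<And>x. (f has_derivative D x) (at x)" "\<And>e. real_polynomial_function (\<lambda>x. D x e)"
      "\<And>x. (g has_derivative E x) (at x)" "\<And>e. real_polynomial_function (\<lambda>x. E x e)" by blast
    then show ?case using mult.hyps
      by (intro exI[of _ "\<lambda>x h. f x * E x h + D x h * g x"]) (auto intro!: has_derivative_mult real_polynomial_function.intros(3,4))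
  qed
  then show ?thesis using that by blast
qed

lemma continuous_on_real_polynomial:
  "real_polynomial_function p \<Longrightarrow> continuous_on S p"
  by (simp add: continuous_at_imp_continuous_on continuous_real_polymonial_function)

text \<open>Serves in place of square integrability: on a bounded domain products of such functions
  are integrable, and the derivatives of finite-element functions are of this kind.\<close>

definition ess_bounded :: "('a::euclidean_space \<Rightarrow> 'b::euclidean_space) \<Rightarrow> bool" where
  "ess_bounded f \<longleftrightarrow> f \<in> borel_measurable lebesgue \<and> (\<exists>B. AE x in lebesgue. norm (f x) \<le> B)"

text \<open>What the calculus needs of a mesh: convexity makes the cell boundaries null sets, and
  together with a nonempty interior it makes every cell the closure of its interior.\<close>

locale cells =
  fixes \<T> :: "'a::euclidean_space set set"
  assumes finite_cells: "finite \<T>"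
    and cell: "S \<in> \<T> \<Longrightarrow> compact S \<and> convex S \<and> interior S \<noteq> {}"
begin

text \<open>A common home for the \<open>P1\<close> functions and the bubbles, free of any degree
  bound.\<close>

definition piecewise_poly :: "('a \<Rightarrow> real) \<Rightarrow> bool" where
  "piecewise_poly f \<longleftrightarrow> continuous_on UNIV f \<and> (\<forall>x. x \<notin> \<Union>\<T> \<longrightarrow> f x = 0) \<and>
     (\<forall>S\<in>\<T>. \<exists>p. real_polynomial_function p \<and> (\<forall>x\<in>S. f x = p x))"

definition skeleton :: "'a set" where
  "skeleton = \<Union>(frontier ` \<T>)"

lemma negligible_skeleton: "negligible skeleton"
  unfolding skeleton_def using finite_cells cell
  by (intro negligible_Union) (auto intro: negligible_convex_frontier)

lemma compact_Union_cells: "compact (\<Union>\<T>)"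
  using finite_cells cell by (intro compact_Union) auto

lemma off_skeleton_cases:
  assumes "x \<notin> skeleton"
  obtains S where "S \<in> \<T>" "x \<in> interior S" | "x \<notin> \<Union>\<T>"
proof (cases "x \<in> \<Union>\<T>")
  case True
  then obtain S where S: "S \<in> \<T>" "x \<in> S" by blast
  then have "x \<in> interior S"
    using assms cell[OF S(1)] by (auto simp: skeleton_def frontier_def closure_closed compact_imp_closed)
  then show ?thesis using S that by blast
qed (use that in blast)

lemma piecewise_poly_continuous: "piecewise_poly f \<Longrightarrow> continuous_on A f"
  by (auto simp: piecewise_poly_def intro: continuous_on_subset)

lemma piecewise_poly_outside: "piecewise_poly f \<Longrightarrow> x \<notin> \<Union>\<T> \<Longrightarrow> f x = 0"
  by (auto simp: piecewise_poly_def)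

lemma piecewise_poly_derivative_on_cell:
  assumes "piecewise_poly f" "S \<in> \<T>"
  obtains p D where "\<And>x. x \<in> S \<Longrightarrow> f x = p x" "\<And>x. (p has_derivative D x) (at x)"
    "\<And>e. continuous_on UNIV (\<lambda>x. D x e)"
    "\<And>x. x \<in> interior S \<Longrightarrow> (f has_derivative D x) (at x)"
proof -
  obtain p where p: "real_polynomial_function p" "\<And>x. x \<in> S \<Longrightarrow> f x = p x"
    using assms by (auto simp: piecewise_poly_def)
  obtain D where D: "\<And>x. (p has_derivative D x) (at x)" "\<And>e. real_polynomial_function (\<lambda>x. D x e)"
    using real_polynomial_has_derivative[OF p(1)] by blast
  have "(f has_derivative D x) (at x)" if "x \<in> interior S" for x
    by (rule has_derivative_transform_within_open[OF D(1) open_interior that])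
      (simp add: p(2)[OF subsetD[OF interior_subset]])
  then show ?thesis
    using that[OF p(2) D(1)] D(2) continuous_on_real_polynomial by blast
qed

lemma piecewise_poly_derivative_outside:
  assumes "piecewise_poly f" "x \<notin> \<Union>\<T>"
  shows "(f has_derivative (\<lambda>_. 0)) (at x)"
proof (rule has_derivative_transform_within_open[where f = "\<lambda>_. 0"])
  show "open (- \<Union>\<T>)" using compact_Union_cells compact_imp_closed by blast
qed (use assms in \<open>auto simp: piecewise_poly_def\<close>)

lemma piecewise_poly_differentiable:
  assumes "piecewise_poly f" "x \<notin> skeleton"
  shows "f differentiable (at x)"
  using assms(2)
proof (cases rule: off_skeleton_cases)
  case (1 S)
  obtain D where "\<And>x. x \<in> interior S \<Longrightarrow> (f has_derivative D x) (at x)"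
    by (rule piecewise_poly_derivative_on_cell[OF assms(1) 1(1)]) (rule that)
  then show ?thesis using 1 by (auto simp: differentiable_def)
next
  case 2
  then show ?thesis
    using piecewise_poly_derivative_outside[OF assms(1)] by (auto simp: differentiable_def)
qed

lemma AE_off_skeleton: "AE x in lebesgue. x \<notin> skeleton"
  using negligible_skeleton by (simp add: AE_lebesgue_negligible)

text \<open>Describes the derivative by a sequence of difference quotients, which is the route to
  its measurability.\<close>

lemma derivative_limit:
  fixes f :: "'a \<Rightarrow> real"
  assumes "f differentiable (at x)"
  shows "(\<lambda>n. (f (x + (1 / real (Suc n)) *\<^sub>R e) - f x) / (1 / real (Suc n)))
    \<longlonglongrightarrow> frechet_derivative f (at x) e"
proof -
  let ?D = "frechet_derivative f (at x)"
  have D: "(f has_derivative ?D) (at x)" using assms frechet_derivative_works by blast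
  have "((\<lambda>t::real. f (x + t *\<^sub>R e)) has_derivative (\<lambda>t. ?D (t *\<^sub>R e))) (at 0)"
    by (rule has_derivative_compose[where g = f, of "\<lambda>t. x + t *\<^sub>R e" "\<lambda>t. t *\<^sub>R e"])
      (auto intro!: derivative_eq_intros D[unfolded has_derivative_def, simplified] simp: D)
  moreover have "(\<lambda>t. ?D (t *\<^sub>R e)) = (*) (?D e)"
    using linear_scale[OF has_derivative_linear[OF D]] by (auto simp: mult.commute)
  ultimately have "((\<lambda>t. f (x + t *\<^sub>R e)) has_field_derivative ?D e) (at 0)"
    by (simp add: has_field_derivative_def)
  then have "((\<lambda>h. (f (x + h *\<^sub>R e) - f x) / h) \<longlongrightarrow> ?D e) (at 0)"
    by (simp add: DERIV_def)
  moreover have "filterlim (\<lambda>n. 1 / real (Suc n)) (at 0) sequentially"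
    unfolding filterlim_at using LIMSEQ_Suc[OF lim_1_over_n] by (auto simp: eventually_sequentially)
  ultimately show ?thesis by (rule filterlim_compose)
qed

text \<open>Measurable as an almost everywhere limit of continuous difference quotients. Bounded
  because on the interior of each of the finitely many cells it agrees with a function that is
  continuous on the whole compact cell.\<close>

lemma ess_bounded_derivative:
  assumes f: "piecewise_poly f"
  shows "ess_bounded (\<lambda>x. frechet_derivative f (at x) e)"
  unfolding ess_bounded_def
proof
  let ?q = "\<lambda>n x. (f (x + (1 / real (Suc n)) *\<^sub>R e) - f x) / (1 / real (Suc n))"
  have "?q n \<in> borel_measurable lebesgue" for n
  proof -
    have "continuous_on UNIV (\<lambda>x. f (x + (1 / real (Suc n)) *\<^sub>R e))"
      by (rule continuous_on_compose2[OF piecewise_poly_continuous[OF f, of UNIV]])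
        (auto intro!: continuous_intros)
    then have "continuous_on UNIV (?q n)"
      using piecewise_poly_continuous[OF f, of UNIV] by (intro continuous_intros) auto
    then have "?q n \<in> borel_measurable borel" by (rule borel_measurable_continuous_onI)
    then show ?thesis by (intro measurable_completion) simp
  qed
  \<comment> \<open>\<open>lim\<close> is a total function, measurable whether or not the quotients
    converge; it equals the derivative off the skeleton, and completeness of the Lebesgue measure
    transfers the measurability.\<close>
  then have "(\<lambda>x. lim (\<lambda>n. ?q n x)) \<in> borel_measurable lebesgue"
    by (rule borel_measurable_lim_metric)
  moreover have "AE x in lebesgue. lim (\<lambda>n. ?q n x) = frechet_derivative f (at x) e"
    using AE_off_skeleton
    by eventually_elim (intro limI derivative_limit piecewise_poly_differentiable[OF f])
  ultimately show "(\<lambda>x. frechet_derivative f (at x) e) \<in> borel_measurable lebesgue"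
    by (rule borel_measurable_AE)
  have "\<exists>B. \<forall>x\<in>interior S. \<bar>frechet_derivative f (at x) e\<bar> \<le> B" if S: "S \<in> \<T>" for S
  proof -
    obtain D where D: "\<And>e. continuous_on UNIV (\<lambda>x. D x e)"
      "\<And>x. x \<in> interior S \<Longrightarrow> (f has_derivative D x) (at x)"
      by (rule piecewise_poly_derivative_on_cell[OF f S]) (rule that)
    have "compact ((\<lambda>x. D x e) ` S)"
      using D(1) cell[OF S] continuous_on_subset by (intro compact_continuous_image) blast+
    then obtain B where B: "\<And>x. x \<in> S \<Longrightarrow> \<bar>D x e\<bar> \<le> B"
      using compact_imp_bounded bounded_iff by (metis imageI real_norm_def)
    have "\<bar>frechet_derivative f (at x) e\<bar> \<le> B" if "x \<in> interior S" for x
      using B[of x] D(2)[OF that] frechet_derivative_at interior_subset that by (metis subsetD)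
    then show ?thesis by blast
  qed
  then obtain B where B: "\<And>S x. S \<in> \<T> \<Longrightarrow> x \<in> interior S \<Longrightarrow> \<bar>frechet_derivative f (at x) e\<bar> \<le> B S"
    by metis
  have "\<bar>frechet_derivative f (at x) e\<bar> \<le> (\<Sum>S\<in>\<T>. \<bar>B S\<bar>)" if "x \<notin> skeleton" for x
    using that
  proof (cases rule: off_skeleton_cases)
    case (1 S)
    have "\<bar>B S\<bar> \<le> (\<Sum>S\<in>\<T>. \<bar>B S\<bar>)" using finite_cells 1(1) by (intro member_le_sum) auto
    then show ?thesis using B[OF 1] by linarith
  next
    case 2
    then have "frechet_derivative f (at x) = (\<lambda>_. 0)"
      using piecewise_poly_derivative_outside[OF f] frechet_derivative_at by metis
    then show ?thesis by (simp add: sum_nonneg)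
  qed
  then show "\<exists>B. AE x in lebesgue. norm (frechet_derivative f (at x) e) \<le> B"
    using AE_off_skeleton by (intro exI[of _ "\<Sum>S\<in>\<T>. \<bar>B S\<bar>"]) (auto elim: eventually_mono)
qed

text \<open>The derivative vanishes on all of every cell, so \<open>f\<close> takes only finitely many values on a line
  in direction \<open>e\<close>; being continuous, it is constant there.\<close>

lemma piecewise_poly_eq_0_if_derivative_0:
  assumes f: "piecewise_poly f" and \<Omega>: "open \<Omega>" "\<Union>\<T> \<subseteq> closure \<Omega>" and e: "e \<noteq> 0"
    and z: "AE x in lebesgue. x \<in> \<Omega> \<longrightarrow> frechet_derivative f (at x) e = 0"
  shows "f x\<^sub>0 = 0"
proof -
  define \<phi> where "\<phi> = (\<lambda>t::real. f (x\<^sub>0 + t *\<^sub>R e))"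
  have cell_const: "\<exists>c. \<forall>t. x\<^sub>0 + t *\<^sub>R e \<in> S \<longrightarrow> \<phi> t = c" if S: "S \<in> \<T>" for S
  proof -
    obtain p D where p: "\<And>x. x \<in> S \<Longrightarrow> f x = p x" and D: "\<And>x. (p has_derivative D x) (at x)"
      and Dc: "\<And>e. continuous_on UNIV (\<lambda>x. D x e)"
      and fD: "\<And>x. x \<in> interior S \<Longrightarrow> (f has_derivative D x) (at x)"
      using piecewise_poly_derivative_on_cell[OF f S] by blast
    \<comment> \<open>From almost everywhere to everywhere on \<open>S\<close>:
      \<open>?U - ?Z\<close> is open and null, hence empty, so \<open>?U\<close> and its closure lie
      in the closed set \<open>?Z\<close>. That closure contains \<open>interior S\<close> because
      \<open>S\<close> lies in the closure of \<Omega>, and \<open>S\<close> lies in the closure of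
      its interior.\<close>
    let ?U = "interior S \<inter> \<Omega>" and ?Z = "{x. D x e = 0}"
    have "closed ?Z" using Dc[of e] by (intro closed_Collect_eq) auto
    have "open (?U - ?Z)" using \<open>closed ?Z\<close> \<Omega>(1) by (intro open_Diff) auto
    moreover have "negligible (?U - ?Z)"
    proof (rule negligible_subset)
      show "negligible {x. \<not> (x \<in> \<Omega> \<longrightarrow> frechet_derivative f (at x) e = 0)}"
        using z by (simp add: AE_lebesgue_negligible)
      show "?U - ?Z \<subseteq> {x. \<not> (x \<in> \<Omega> \<longrightarrow> frechet_derivative f (at x) e = 0)}"
        using fD frechet_derivative_at by fastforce
    qed
    ultimately have "?U \<subseteq> ?Z" using open_not_negligible by blast
    then have "closure ?U \<subseteq> ?Z" using \<open>closed ?Z\<close> by (rule closure_minimal)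
    moreover have "interior S \<subseteq> closure ?U"
      using open_Int_closure_subset[of "interior S" \<Omega>] \<Omega>(2) S interior_subset[of S] by auto
    ultimately have "closure (interior S) \<subseteq> ?Z" using \<open>closed ?Z\<close> by (intro closure_minimal) auto
    then have SZ: "S \<subseteq> ?Z"
      using convex_closure_interior[of S] cell[OF S] closure_subset[of S] by auto
    \<comment> \<open>By convexity the line meets the cell in an interval, where a vanishing
      derivative forces a constant.\<close>
    let ?L = "{t. x\<^sub>0 + t *\<^sub>R e \<in> S}"
    have "convex ?L"
    proof -
      have "?L = (\<lambda>t. t *\<^sub>R e) -` ((+) (- x\<^sub>0) ` S)"
        by (auto simp: image_iff) (metis add.commute add_diff_cancel_left' minus_add_cancel uminus_add_conv_diff)
      moreover have "linear (\<lambda>t. t *\<^sub>R e)" by (simp add: linear_scaleR_left)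
      ultimately show ?thesis using cell[OF S] convex_linear_vimage convex_translation by metis
    qed
    moreover have "((\<lambda>t. p (x\<^sub>0 + t *\<^sub>R e)) has_derivative (\<lambda>h. 0)) (at t within ?L)" if "t \<in> ?L" for t
    proof -
      have "((\<lambda>t. p (x\<^sub>0 + t *\<^sub>R e)) has_derivative (\<lambda>h. D (x\<^sub>0 + t *\<^sub>R e) (h *\<^sub>R e))) (at t within ?L)"
        by (rule has_derivative_compose[OF _ D]) (auto intro!: derivative_eq_intros)
      moreover have "D (x\<^sub>0 + t *\<^sub>R e) (h *\<^sub>R e) = 0" for h
        using linear_scale[OF has_derivative_linear[OF D]] SZ that by auto
      ultimately show ?thesis by simp
    qed
    ultimately obtain c where "\<forall>t\<in>?L. p (x\<^sub>0 + t *\<^sub>R e) = c"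
      using has_derivative_zero_constant[of ?L "\<lambda>t. p (x\<^sub>0 + t *\<^sub>R e)"] by blast
    then show ?thesis using p by (auto simp: \<phi>_def)
  qed
  then obtain c where c: "\<And>S t. S \<in> \<T> \<Longrightarrow> x\<^sub>0 + t *\<^sub>R e \<in> S \<Longrightarrow> \<phi> t = c S" by metis
  have "\<phi> t \<in> insert 0 (c ` \<T>)" for t
    using c piecewise_poly_outside[OF f] by (cases "x\<^sub>0 + t *\<^sub>R e \<in> \<Union>\<T>") (auto simp: \<phi>_def)
  then have "range \<phi> \<subseteq> insert 0 (c ` \<T>)" by blast
  then have "finite (range \<phi>)" using finite_cells finite_subset by blast
  moreover have "continuous_on UNIV \<phi>"
    unfolding \<phi>_def
    by (rule continuous_on_compose2[OF piecewise_poly_continuous[OF f, of UNIV]])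
      (auto intro!: continuous_intros)
  ultimately have "\<phi> constant_on UNIV"
    by (intro continuous_finite_range_constant) auto
  then obtain k where k: "\<And>t. \<phi> t = k" by (auto simp: constant_on_def)
  obtain B where B: "\<And>x. x \<in> \<Union>\<T> \<Longrightarrow> norm x \<le> B"
    using compact_imp_bounded[OF compact_Union_cells] by (auto simp: bounded_iff)
  \<comment> \<open>Large enough for the line to have left the ball of radius \<open>B\<close>
    around 0, and with it all cells.\<close>
  define t where "t = (\<bar>B\<bar> + norm x\<^sub>0 + 1) / norm e"
  have "norm (t *\<^sub>R e) = \<bar>B\<bar> + norm x\<^sub>0 + 1" using e by (simp add: t_def)
  then have "norm (x\<^sub>0 + t *\<^sub>R e) > B" using norm_diff_ineq[of "t *\<^sub>R e" x\<^sub>0] by (simp add: add.commute)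
  then have "x\<^sub>0 + t *\<^sub>R e \<notin> \<Union>\<T>" using B by fastforce
  then have "\<phi> t = 0" using piecewise_poly_outside[OF f] by (simp add: \<phi>_def)
  then show ?thesis using k[of t] k[of 0] by (simp add: \<phi>_def)
qed

end

section \<open>Forms given by \<open>L\<^sup>2\<close> inner products\<close>

lemma ess_bounded_cong_AE:
  assumes "ess_bounded f" "AE x in lebesgue. f x = g x"
  shows "ess_bounded g"
proof -
  obtain B where "AE x in lebesgue. norm (f x) \<le> B" using assms by (auto simp: ess_bounded_def)
  then have "AE x in lebesgue. norm (g x) \<le> B" using assms(2) by eventually_elim simp
  then show ?thesis using assms borel_measurable_AE unfolding ess_bounded_def by blast
qed

lemma ess_bounded_add:
  assumes "ess_bounded f" "ess_bounded g"
  shows "ess_bounded (\<lambda>x. f x + g x)"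
proof -
  obtain B C where "AE x in lebesgue. norm (f x) \<le> B" "AE x in lebesgue. norm (g x) \<le> C"
    using assms by (auto simp: ess_bounded_def)
  then have "AE x in lebesgue. norm (f x + g x) \<le> B + C" by eventually_elim (rule norm_triangle_mono)
  then show ?thesis using assms unfolding ess_bounded_def by auto
qed

lemma ess_bounded_linear:
  assumes "ess_bounded f" "bounded_linear L"
  shows "ess_bounded (\<lambda>x. L (f x))"
proof -
  obtain B where B: "AE x in lebesgue. norm (f x) \<le> B" using assms by (auto simp: ess_bounded_def)
  obtain K where K: "\<And>x. norm (L x) \<le> norm x * K" "0 \<le> K"
    using bounded_linear.nonneg_bounded[OF assms(2)] by blast
  have "AE x in lebesgue. norm (L (f x)) \<le> B * K"
    using B by eventually_elim (meson K mult_right_mono order_trans)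
  moreover have "(\<lambda>x. L (f x)) \<in> borel_measurable lebesgue"
    using assms borel_measurable_continuous_onI[OF linear_continuous_on[OF assms(2), of UNIV]]
    by (auto simp: ess_bounded_def intro: measurable_compose[of f])
  ultimately show ?thesis unfolding ess_bounded_def by blast
qed

lemma ess_bounded_scaleR: "ess_bounded f \<Longrightarrow> ess_bounded (\<lambda>x. c *\<^sub>R f x)"
  using ess_bounded_linear[OF _ bounded_linear_scaleR_right, of f c] .

lemma ess_bounded_inner:
  assumes "ess_bounded f" "ess_bounded g"
  shows "ess_bounded (\<lambda>x. f x \<bullet> g x)"
proof -
  obtain B C where B: "AE x in lebesgue. norm (f x) \<le> B" and C: "AE x in lebesgue. norm (g x) \<le> C"
    using assms by (auto simp: ess_bounded_def)
  have "AE x in lebesgue. norm (f x \<bullet> g x) \<le> \<bar>B\<bar> * \<bar>C\<bar>"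
    using B C
  proof eventually_elim
    case (elim x)
    have "\<bar>f x \<bullet> g x\<bar> \<le> norm (f x) * norm (g x)" by (rule Cauchy_Schwarz_ineq2)
    also have "\<dots> \<le> \<bar>B\<bar> * \<bar>C\<bar>" using elim by (intro mult_mono) auto
    finally show ?case by simp
  qed
  then show ?thesis using assms unfolding ess_bounded_def by auto
qed

lemma ess_bounded_componentwise:
  fixes f :: "'a::euclidean_space \<Rightarrow> 'b::euclidean_space"
  assumes "\<And>b. b \<in> Basis \<Longrightarrow> ess_bounded (\<lambda>x. f x \<bullet> b)"
  shows "ess_bounded f"
proof -
  have "\<forall>b\<in>Basis. \<exists>B. AE x in lebesgue. \<bar>f x \<bullet> b\<bar> \<le> B"
    using assms by (auto simp: ess_bounded_def)
  then obtain B where B: "\<And>b. b \<in> Basis \<Longrightarrow> AE x in lebesgue. \<bar>f x \<bullet> b\<bar> \<le> B b" by metis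
  then have "AE x in lebesgue. \<forall>b\<in>Basis. \<bar>f x \<bullet> b\<bar> \<le> B b"
    by (intro AE_finite_allI) auto
  then have "AE x in lebesgue. norm (f x) \<le> (\<Sum>b\<in>Basis. B b)"
  proof eventually_elim
    case (elim x)
    have "norm (f x) \<le> (\<Sum>b\<in>Basis. \<bar>f x \<bullet> b\<bar>)" by (rule norm_le_l1)
    also have "\<dots> \<le> (\<Sum>b\<in>Basis. B b)" using elim by (intro sum_mono) auto
    finally show ?case .
  qed
  moreover have "f \<in> borel_measurable lebesgue"
    using assms by (subst borel_measurable_euclidean_space) (auto simp: ess_bounded_def)
  ultimately show ?thesis unfolding ess_bounded_def by blast
qed

lemma ess_bounded_continuous_compact_support:
  fixes f :: "'a::euclidean_space \<Rightarrow> 'b::euclidean_space"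
  assumes f: "continuous_on UNIV f" and K: "compact K" and z: "\<And>x. x \<notin> K \<Longrightarrow> f x = 0"
  shows "ess_bounded f"
proof -
  have "compact (f ` K)" using f K continuous_on_subset by (intro compact_continuous_image) auto
  then have "bounded (f ` K)" by (rule compact_imp_bounded)
  then obtain B where B: "\<And>x. x \<in> K \<Longrightarrow> norm (f x) \<le> B" by (auto simp: bounded_iff)
  have "norm (f x) \<le> \<bar>B\<bar>" for x
    using B[of x] z[of x] by (cases "x \<in> K") auto
  moreover have "f \<in> borel_measurable borel" using f by (rule borel_measurable_continuous_onI)
  then have "f \<in> borel_measurable lebesgue" by (intro measurable_completion) simp
  ultimately show ?thesis unfolding ess_bounded_def by blast
qed

lemma psd_form_scale: "psd_form W k \<Longrightarrow> 0 \<le> c \<Longrightarrow> psd_form W (\<lambda>x y. c * k x y)"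
  unfolding psd_form_def by (auto simp: algebra_simps)

lemma psd_form_add:
  "psd_form W k \<Longrightarrow> psd_form W l \<Longrightarrow> psd_form W (\<lambda>x y. k x y + l x y)"
  unfolding psd_form_def by (auto simp: algebra_simps)

lemma L2_inner_nonneg: "0 \<le> L2_inner \<Omega> f f"
  unfolding L2_inner_def set_lebesgue_integral_def by (intro Bochner_Integration.integral_nonneg) simp

section \<open>Integration over the domain and almost everywhere linear operators\<close>

locale bounded_domain =
  fixes \<Omega> :: "(real^'n) set"
  assumes open_domain: "open \<Omega>" and bounded_domain: "bounded \<Omega>"
begin

lemma domain_lmeasurable: "\<Omega> \<in> lmeasurable"
  using open_domain bounded_domain by (intro lmeasurable_open)

lemma ess_bounded_integrable:
  assumes "ess_bounded f"
  shows "set_integrable lebesgue \<Omega> f"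
proof -
  obtain B where "AE x in lebesgue. norm (f x) \<le> B" using assms by (auto simp: ess_bounded_def)
  then have "AE x in lebesgue. x \<in> \<Omega> \<longrightarrow> norm (f x) \<le> B" by eventually_elim simp
  then show ?thesis
    unfolding set_integrable_def
    using assms domain_lmeasurable
    by (intro integrableI_bounded_set_indicator) (auto simp: ess_bounded_def fmeasurable_def)
qed

lemma L2_inner_add_left:
  "ess_bounded f \<Longrightarrow> ess_bounded g \<Longrightarrow> ess_bounded h \<Longrightarrow>
    L2_inner \<Omega> (\<lambda>x. f x + g x) h = L2_inner \<Omega> f h + L2_inner \<Omega> g h"
  unfolding L2_inner_def inner_add_left
  by (intro set_integral_add ess_bounded_integrable ess_bounded_inner)

lemma L2_inner_scaleR_left: "L2_inner \<Omega> (\<lambda>x. c *\<^sub>R f x) g = c * L2_inner \<Omega> f g"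
  unfolding L2_inner_def inner_scaleR_left by (rule set_integral_mult_right)

lemma L2_inner_commute: "L2_inner \<Omega> f g = L2_inner \<Omega> g f"
  unfolding L2_inner_def by (simp add: inner_commute)

lemma L2_inner_cong_AE:
  assumes f: "ess_bounded f" "ess_bounded g" "AE x in lebesgue. f x = f' x"
  shows "L2_inner \<Omega> f g = L2_inner \<Omega> f' g"
  unfolding L2_inner_def
proof (rule set_lebesgue_integral_cong_AE)
  have "ess_bounded f'" using ess_bounded_cong_AE f by blast
  then show "(\<lambda>x. f x \<bullet> g x) \<in> borel_measurable lebesgue" "(\<lambda>x. f' x \<bullet> g x) \<in> borel_measurable lebesgue"
    using f ess_bounded_inner unfolding ess_bounded_def by blast+
  show "\<Omega> \<in> sets lebesgue" using domain_lmeasurable by (simp add: fmeasurableD)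
  show "AE x\<in>\<Omega> in lebesgue. f x \<bullet> g x = f' x \<bullet> g x" using f(3) by eventually_elim simp
qed

lemma L2_inner_mono:
  assumes "ess_bounded f" "ess_bounded g" "AE x in lebesgue. f x \<bullet> f x \<le> c * (g x \<bullet> g x)"
  shows "L2_inner \<Omega> f f \<le> c * L2_inner \<Omega> g g"
proof -
  have "L2_inner \<Omega> f f \<le> (LINT x:\<Omega>|lebesgue. c * (g x \<bullet> g x))"
    unfolding L2_inner_def
  proof (rule set_integral_mono_AE)
    show "set_integrable lebesgue \<Omega> (\<lambda>x. f x \<bullet> f x)"
      using assms by (intro ess_bounded_integrable ess_bounded_inner)
    show "set_integrable lebesgue \<Omega> (\<lambda>x. c * (g x \<bullet> g x))"
      using assms by (intro set_integrable_mult_right ess_bounded_integrable ess_bounded_inner)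
    show "AE x\<in>\<Omega> in lebesgue. f x \<bullet> f x \<le> c * (g x \<bullet> g x)"
      using assms(3) by eventually_elim simp
  qed
  then show ?thesis by (simp add: L2_inner_def)
qed

lemma L2_inner_eq_0D:
  assumes f: "ess_bounded f" and z: "L2_inner \<Omega> f f = 0"
  shows "AE x in lebesgue. x \<in> \<Omega> \<longrightarrow> f x = 0"
proof -
  have "AE x in lebesgue. indicat_real \<Omega> x *\<^sub>R (f x \<bullet> f x) = 0"
    using integral_nonneg_eq_0_iff_AE[of lebesgue "\<lambda>x. indicat_real \<Omega> x *\<^sub>R (f x \<bullet> f x)"]
      ess_bounded_integrable[OF ess_bounded_inner[OF f f]] z
    by (simp add: L2_inner_def set_lebesgue_integral_def set_integrable_def)
  then show ?thesis by eventually_elim (auto simp: indicator_def split: if_splits)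
qed

text \<open>Differential operators are only almost everywhere linear on finite-element functions, because
  the pointwise derivative is a junk value on the element boundaries.\<close>

definition AE_linear :: "'v::real_vector set \<Rightarrow> ('v \<Rightarrow> real^'n \<Rightarrow> 'b::euclidean_space) \<Rightarrow> bool" where
  "AE_linear W D \<longleftrightarrow> subspace W \<and> (\<forall>u\<in>W. ess_bounded (D u)) \<and>
     (\<forall>u\<in>W. \<forall>v\<in>W. AE x in lebesgue. D (u + v) x = D u x + D v x) \<and>
     (\<forall>c. \<forall>u\<in>W. AE x in lebesgue. D (c *\<^sub>R u) x = c *\<^sub>R D u x)"

lemma AE_linear_ess_bounded: "AE_linear W D \<Longrightarrow> u \<in> W \<Longrightarrow> ess_bounded (D u)"
  by (simp add: AE_linear_def)

lemma AE_linear_subset: "AE_linear W D \<Longrightarrow> U \<subseteq> W \<Longrightarrow> subspace U \<Longrightarrow> AE_linear U D"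
  unfolding AE_linear_def by blast

lemma L2_inner_add_AE:
  assumes D: "AE_linear W D" and uv: "u \<in> W" "v \<in> W" and g: "ess_bounded g"
  shows "L2_inner \<Omega> (D (u + v)) g = L2_inner \<Omega> (D u) g + L2_inner \<Omega> (D v) g"
proof -
  have b: "ess_bounded (D u)" "ess_bounded (D v)" "ess_bounded (D (u + v))"
    using D uv by (auto simp: AE_linear_def subspace_add)
  have "L2_inner \<Omega> (D (u + v)) g = L2_inner \<Omega> (\<lambda>x. D u x + D v x) g"
    using D uv b g by (intro L2_inner_cong_AE) (auto simp: AE_linear_def)
  then show ?thesis using b g by (simp add: L2_inner_add_left)
qed

lemma L2_inner_scaleR_AE:
  assumes D: "AE_linear W D" and u: "u \<in> W" and g: "ess_bounded g"
  shows "L2_inner \<Omega> (D (c *\<^sub>R u)) g = c * L2_inner \<Omega> (D u) g"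
proof -
  have b: "ess_bounded (D (c *\<^sub>R u))" using D u by (auto simp: AE_linear_def subspace_scale)
  have "L2_inner \<Omega> (D (c *\<^sub>R u)) g = L2_inner \<Omega> (\<lambda>x. c *\<^sub>R D u x) g"
    using D u b g by (intro L2_inner_cong_AE) (auto simp: AE_linear_def)
  then show ?thesis by (simp add: L2_inner_scaleR_left)
qed

text \<open>Integration does not see null sets, so an operator that is linear only almost everywhere
  still yields an exactly bilinear form.\<close>

lemma psd_form_L2_inner:
  assumes D: "AE_linear W D"
  shows "psd_form W (\<lambda>u v. L2_inner \<Omega> (D u) (D v))"
proof
  show "subspace W" using D by (simp add: AE_linear_def)
qed (use L2_inner_add_AE[OF D] L2_inner_scaleR_AE[OF D] AE_linear_ess_bounded[OF D]
    L2_inner_commute L2_inner_nonneg in auto)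

text \<open>The abstract inequality for the identity operator on the space of all essentially
  bounded functions, where the form is merely semidefinite.\<close>

lemma L2_Cauchy_Schwarz:
  fixes f g :: "real^'n \<Rightarrow> 'b::euclidean_space"
  assumes "ess_bounded f" "ess_bounded g"
  shows "\<bar>L2_inner \<Omega> f g\<bar> \<le> L2_norm \<Omega> f * L2_norm \<Omega> g"
proof -
  have "AE_linear (Collect ess_bounded) (\<lambda>f. f :: real^'n \<Rightarrow> 'b)"
    unfolding AE_linear_def subspace_def
    using ess_bounded_add ess_bounded_scaleR
      ess_bounded_continuous_compact_support[of "\<lambda>x. 0" "{}"]
    by (auto simp: plus_fun_def scaleR_fun_def zero_fun_def)
  from psd_form.Cauchy_Schwarz[OF psd_form_L2_inner[OF this]] assms
  show ?thesis by (simp add: L2_norm_def)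
qed

end

section \<open>Simplices and bubble functions\<close>

lemma sum_fun_apply: "(\<Sum>i\<in>I. f i) x = (\<Sum>i\<in>I. f i x)"
  by (induction I rule: infinite_finite_induct) auto

locale full_simplex =
  fixes C :: "(real^'n) set"
  assumes indep: "\<not> affine_dependent C" and card: "card C = Suc CARD('n)"
begin

lemma finite_vertices: "finite C"
  using indep by (rule aff_independent_finite)

lemma affine_hull_vertices: "affine hull C = UNIV"
  using indep card by (intro affine_independent_span_eq) auto

text \<open>The predicate inside the description that defines \<open>barycentric\<close>. Vanishing
  off \<open>C\<close> makes the weights unique as functions.\<close>

definition is_coords :: "real^'n \<Rightarrow> (real^'n \<Rightarrow> real) \<Rightarrow> bool" where
  "is_coords x w \<longleftrightarrow> (\<forall>c. c \<notin> C \<longrightarrow> w c = 0) \<and> sum w C = 1 \<and> (\<Sum>c\<in>C. w c *\<^sub>R c) = x"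

lemma is_coords_unique:
  assumes "is_coords x w" "is_coords x w'"
  shows "w = w'"
proof (rule ccontr)
  assume "w \<noteq> w'"
  then obtain c where "c \<in> C" "w c - w' c \<noteq> 0"
    using assms by (metis eq_iff_diff_eq_0 ext is_coords_def)
  moreover have "sum (\<lambda>c. w c - w' c) C = 0" "(\<Sum>c\<in>C. (w c - w' c) *\<^sub>R c) = 0"
    using assms by (auto simp: is_coords_def sum_subtractf scaleR_left_diff_distrib)
  ultimately show False
    using indep affine_dependent_explicit_finite[OF finite_vertices] by blast
qed

lemma is_coords_exists: "\<exists>w. is_coords x w"
proof -
  obtain u where u: "sum u C = 1" "(\<Sum>c\<in>C. u c *\<^sub>R c) = x"
    using affine_hull_finite[OF finite_vertices] affine_hull_vertices by auto
  then show ?thesis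
    by (intro exI[of _ "\<lambda>c. if c \<in> C then u c else 0"])
      (auto simp: is_coords_def cong: sum.cong)
qed

lemma is_coords_barycentric: "is_coords x (barycentric C x)"
proof -
  have "barycentric C x = (THE w. is_coords x w)"
    by (simp add: barycentric_def is_coords_def)
  then show ?thesis using is_coords_exists is_coords_unique by (metis theI)
qed

text \<open>Affine combinations of coordinate vectors are coordinate vectors of the combined point,
  so by uniqueness a coordinate is affine in \<open>x\<close>; subtracting its value at 0 leaves a
  linear map.\<close>

lemma real_polynomial_barycentric: "real_polynomial_function (\<lambda>x. barycentric C x c)"
proof -
  let ?L = "\<lambda>x. barycentric C x c - barycentric C 0 c"
  have "linear ?L"
  proof (rule linearI)
    fix x y
    \<comment> \<open>Subtracting the coordinates of 0 brings the sum of the weights from 2 back to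
      1 without moving the point.\<close>
    have "is_coords (x + y) (\<lambda>d. barycentric C x d + barycentric C y d - barycentric C 0 d)"
      using is_coords_barycentric[of x] is_coords_barycentric[of y] is_coords_barycentric[of 0]
      by (auto simp: is_coords_def sum.distrib sum_subtractf scaleR_left_diff_distrib scaleR_left_distrib)
    then show "?L (x + y) = ?L x + ?L y"
      using is_coords_unique[OF is_coords_barycentric[of "x + y"]] by simp
  next
    fix r x
    have "is_coords (r *\<^sub>R x) (\<lambda>d. r * barycentric C x d + (1 - r) * barycentric C 0 d)"
      using is_coords_barycentric[of x] is_coords_barycentric[of 0]
      by (auto simp: is_coords_def sum.distrib scaleR_left_distrib simp flip: sum_distrib_left scaleR_scaleR scaleR_sum_right)
    then show "?L (r *\<^sub>R x) = r *\<^sub>R ?L x"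
      using is_coords_unique[OF is_coords_barycentric[of "r *\<^sub>R x"]] by (simp add: algebra_simps)
  qed
  then have "real_polynomial_function ?L"
    by (intro real_polynomial_function.intros(1)) (rule linear_conv_bounded_linear[THEN iffD1])
  from real_polynomial_function.intros(3)[OF this real_polynomial_function.intros(2)[of "barycentric C 0 c"]]
  show ?thesis by simp
qed

lemma barycentric_nonneg:
  assumes "x \<in> convex hull C"
  shows "0 \<le> barycentric C x c"
proof -
  obtain u where u: "\<forall>c\<in>C. 0 \<le> u c" "sum u C = 1" "(\<Sum>c\<in>C. u c *\<^sub>R c) = x"
    using assms convex_hull_finite[OF finite_vertices] by auto
  have "is_coords x (\<lambda>c. if c \<in> C then u c else 0)"
    using u by (auto simp: is_coords_def cong: sum.cong)
  then have "barycentric C x = (\<lambda>c. if c \<in> C then u c else 0)"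
    using is_coords_unique is_coords_barycentric by blast
  then show ?thesis using u(1) by simp
qed

text \<open>The interior of a full simplex consists of the points with all coordinates positive, so
  on the boundary some factor is 0.\<close>

lemma prod_barycentric_eq_0:
  assumes "x \<in> convex hull C" "x \<notin> interior (convex hull C)"
  shows "(\<Prod>c\<in>C. barycentric C x c) = 0"
proof (rule ccontr)
  assume "(\<Prod>c\<in>C. barycentric C x c) \<noteq> 0"
  then have "\<forall>c\<in>C. 0 < barycentric C x c"
    using barycentric_nonneg[OF assms(1)] finite_vertices by (auto simp: less_le)
  then have "x \<in> interior (convex hull C)"
    using is_coords_barycentric[of x] card
    unfolding interior_convex_hull_explicit_minimal[OF indep] is_coords_def by auto
  then show False using assms(2) by blast
qed

lemma interior_nonempty: "interior (convex hull C) \<noteq> {}"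
proof -
  have "C \<noteq> {}" using card by auto
  then have "rel_interior (convex hull C) \<noteq> {}"
    by (simp add: rel_interior_eq_empty)
  moreover have "rel_interior (convex hull C) = interior (convex hull C)"
    by (rule rel_interior_interior) (simp add: affine_hull_vertices)
  ultimately show ?thesis by simp
qed

lemma bubble_convex_hull:
  "bubble (convex hull C) x = (if x \<in> convex hull C then \<Prod>c\<in>C. barycentric C x c else 0)"
  by (simp add: bubble_def Let_def extreme_point_of_convex_hull_affine_independent[OF indep])

lemma compact_hull: "compact (convex hull C)"
  using finite_vertices by (rule finite_imp_compact_convex_hull)

lemma real_polynomial_prod_barycentric: "real_polynomial_function (\<lambda>x. \<Prod>c\<in>C. barycentric C x c)"
  using finite_vertices real_polynomial_barycentric by (intro real_polynomial_function_prod) auto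

text \<open>The two branches agree on the boundary of the simplex, where the product
  vanishes.\<close>

lemma continuous_on_bubble: "continuous_on UNIV (bubble (convex hull C))"
proof -
  let ?S = "convex hull C"
  have "continuous_on (?S \<union> closure (- ?S))
      (\<lambda>x. if x \<in> ?S then \<Prod>c\<in>C. barycentric C x c else 0)"
  proof (rule continuous_on_cases)
    show "closed ?S" using compact_hull compact_imp_closed by blast
    show "continuous_on ?S (\<lambda>x. \<Prod>c\<in>C. barycentric C x c)"
      using real_polynomial_prod_barycentric by (rule continuous_on_real_polynomial)
    show "\<forall>x. x \<in> ?S \<and> x \<notin> ?S \<or> x \<in> closure (- ?S) \<and> x \<in> ?S \<longrightarrow> (\<Prod>c\<in>C. barycentric C x c) = 0"
      using prod_barycentric_eq_0 by (auto simp: closure_complement)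
  qed auto
  moreover have "?S \<union> closure (- ?S) = UNIV" using closure_subset[of "- ?S"] by blast
  moreover have "(\<lambda>x. if x \<in> ?S then \<Prod>c\<in>C. barycentric C x c else 0) = bubble ?S"
    by (rule ext) (rule bubble_convex_hull[symmetric])
  ultimately show ?thesis by metis
qed

end

lemma simplex_obtain_full:
  fixes S :: "(real^'n) set"
  assumes "int CARD('n) simplex S"
  obtains C where "full_simplex C" "S = convex hull C"
proof -
  obtain C where "\<not> affine_dependent C" "int (card C) = int CARD('n) + 1" "S = convex hull C"
    using assms unfolding simplex_def by blast
  then show ?thesis
    by (intro that[of C]) (auto simp: full_simplex_def)
qed

lemma mesh_cells:
  fixes \<T> :: "(real^'n) set set"
  assumes "mesh \<Omega> h \<T>"
  shows "cells \<T>"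
proof
  show "finite \<T>" using assms by (simp add: mesh_def triangulation_def)
  fix S assume "S \<in> \<T>"
  then have "int CARD('n) simplex S" using assms by (simp add: mesh_def)
  then obtain C where C: "full_simplex C" "S = convex hull C" by (rule simplex_obtain_full)
  then show "compact S \<and> convex S \<and> interior S \<noteq> {}"
    using full_simplex.compact_hull full_simplex.interior_nonempty convex_convex_hull by blast
qed

section \<open>Finite-element functions as piecewise polynomials\<close>

context cells
begin

lemma piecewise_poly_on_cell:
  "piecewise_poly f \<Longrightarrow> S \<in> \<T> \<Longrightarrow> \<exists>p. real_polynomial_function p \<and> (\<forall>x\<in>S. f x = p x)"
  by (simp add: piecewise_poly_def)

lemma subspace_piecewise_poly: "subspace {f. piecewise_poly f}"
  unfolding subspace_def
proof (intro conjI ballI allI)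
  have "\<exists>p. real_polynomial_function p \<and> (\<forall>x\<in>S. (0::real) = p x)" for S :: "'a set"
    by (rule exI[of _ "\<lambda>x. 0"]) auto
  then show "0 \<in> {f. piecewise_poly f}"
    by (simp add: piecewise_poly_def zero_fun_def)
next
  fix f g assume "f \<in> {f. piecewise_poly f}" "g \<in> {f. piecewise_poly f}"
  then have fg: "piecewise_poly f" "piecewise_poly g" by auto
  have "\<exists>p. real_polynomial_function p \<and> (\<forall>x\<in>S. f x + g x = p x)" if S: "S \<in> \<T>" for S
  proof -
    obtain p where "real_polynomial_function p" "\<forall>x\<in>S. f x = p x"
      using piecewise_poly_on_cell[OF fg(1) S] by blast
    moreover obtain q where "real_polynomial_function q" "\<forall>x\<in>S. g x = q x"
      using piecewise_poly_on_cell[OF fg(2) S] by blast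
    ultimately show ?thesis
      by (intro exI[of _ "\<lambda>x. p x + q x"]) (auto intro: real_polynomial_function.intros(3))
  qed
  then show "f + g \<in> {f. piecewise_poly f}"
    using fg by (auto simp: piecewise_poly_def plus_fun_def intro!: continuous_intros)
next
  fix c f assume "f \<in> {f. piecewise_poly f}"
  then have f: "piecewise_poly f" by auto
  have "\<exists>p. real_polynomial_function p \<and> (\<forall>x\<in>S. c * f x = p x)" if S: "S \<in> \<T>" for S
  proof -
    obtain p where "real_polynomial_function p" "\<forall>x\<in>S. f x = p x"
      using piecewise_poly_on_cell[OF f S] by blast
    then show ?thesis
      by (intro exI[of _ "\<lambda>x. c * p x"])
        (auto intro: real_polynomial_function.intros(4)[OF real_polynomial_function.intros(2)])
  qed
  then show "c *\<^sub>R f \<in> {f. piecewise_poly f}"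
    using f by (auto simp: piecewise_poly_def scaleR_fun_def intro!: continuous_intros)
qed

end

lemma P1_piecewise_poly:
  assumes "mesh \<Omega> h \<T>" "q \<in> P1 \<Omega> \<T>"
  shows "cells.piecewise_poly \<T> q"
proof -
  interpret cells \<T> using assms(1) by (rule mesh_cells)
  have "\<exists>p. real_polynomial_function p \<and> (\<forall>x\<in>S. q x = p x)" if "S \<in> \<T>" for S
  proof -
    have "\<exists>a b. \<forall>x\<in>S. q x = a \<bullet> x + b" using assms(2) that by (simp add: P1_def)
    then obtain a b where "\<forall>x\<in>S. q x = a \<bullet> x + b" by blast
    then show ?thesis
      by (intro exI[of _ "\<lambda>x. a \<bullet> x + b"])
        (auto intro: real_polynomial_function.intros(3)[OF real_polynomial_function.intros(1)
            [OF bounded_linear_inner_right] real_polynomial_function.intros(2)])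
  qed
  then show ?thesis using assms(2) by (auto simp: piecewise_poly_def P1_def)
qed

text \<open>On its own cell the bubble is a product of affine functions. Any other cell meets
  \<open>S\<close> in a proper face of \<open>S\<close>, because the mesh is conforming, and there
  the bubble vanishes.\<close>

lemma bubble_piecewise_poly:
  fixes \<T> :: "(real^'n) set set"
  assumes "mesh \<Omega> h \<T>" "S \<in> \<T>"
  shows "cells.piecewise_poly \<T> (bubble S)"
proof -
  interpret cells \<T> using assms(1) by (rule mesh_cells)
  have "int CARD('n) simplex S" using assms by (simp add: mesh_def)
  then obtain C where "full_simplex C" and S: "S = convex hull C" by (rule simplex_obtain_full)
  then interpret full_simplex C by simp
  have "\<exists>p. real_polynomial_function p \<and> (\<forall>x\<in>R. bubble S x = p x)" if R: "R \<in> \<T>" for R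
  proof (cases "R = S")
    case True
    then show ?thesis using real_polynomial_prod_barycentric
      by (intro exI[of _ "\<lambda>x. \<Prod>c\<in>C. barycentric C x c"]) (auto simp: S bubble_convex_hull)
  next
    case False
    have face: "S \<inter> R face_of S" "R \<inter> S face_of R"
      using assms R by (auto simp: mesh_def triangulation_def)
    \<comment> \<open>Otherwise \<open>S\<close> would be a face of \<open>R\<close> different from
      \<open>R\<close>, hence disjoint from the interior of \<open>R\<close>, although it has
      interior points itself.\<close>
    have "S \<inter> R \<noteq> S"
    proof
      assume "S \<inter> R = S"
      then have "S face_of R" "S \<subseteq> R" using face by (auto simp: Int_commute)
      then have "S \<inter> interior R = {}" using face_of_disjoint_interior False by metis
      then show False
        using interior_mono[OF \<open>S \<subseteq> R\<close>] interior_nonempty interior_subset[of S] S by blast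
    qed
    then have "S \<inter> R \<inter> interior S = {}" using face(1) face_of_disjoint_interior by blast
    then have "bubble S x = 0" if "x \<in> R" for x
      using that prod_barycentric_eq_0[of x] by (auto simp: S bubble_convex_hull)
    then show ?thesis by (intro exI[of _ "\<lambda>x. 0"]) (auto intro: real_polynomial_function.intros(2))
  qed
  moreover have "bubble S x = 0" if "x \<notin> \<Union>\<T>" for x
    using that assms(2) by (auto simp: bubble_def)
  moreover have "continuous_on UNIV (bubble S)" using continuous_on_bubble S by simp
  ultimately show ?thesis by (simp add: piecewise_poly_def)
qed

section \<open>Finite-element spaces on a mesh\<close>

text \<open>Cauchy-Schwarz between the diagonal and the vector of ones. This is where the dimension
  enters the estimates.\<close>

lemma trace_square_le:
  fixes A :: "real^'n^'n"
  shows "(trace A)\<^sup>2 \<le> real CARD('n) * (A \<bullet> A)"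
proof -
  have "(trace A)\<^sup>2 \<le> (\<Sum>i\<in>(UNIV :: 'n set). (A $ i $ i)\<^sup>2) * (\<Sum>i\<in>(UNIV :: 'n set). 1\<^sup>2)"
    using Cauchy_Schwarz_ineq_sum[of "\<lambda>i. A $ i $ i" "\<lambda>_. 1" UNIV] by (simp add: trace_def)
  also have "\<dots> \<le> (A \<bullet> A) * (\<Sum>i\<in>(UNIV :: 'n set). 1\<^sup>2)"
  proof (rule mult_right_mono)
    have "(\<Sum>i\<in>UNIV. (A $ i $ i)\<^sup>2) \<le> (\<Sum>i\<in>UNIV. \<Sum>j\<in>UNIV. (A $ i $ j)\<^sup>2)"
    proof (rule sum_mono)
      fix i
      show "(A $ i $ i)\<^sup>2 \<le> (\<Sum>j\<in>UNIV. (A $ i $ j)\<^sup>2)"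
        by (rule member_le_sum[of i UNIV "\<lambda>j. (A $ i $ j)\<^sup>2"]) auto
    qed
    then show "(\<Sum>i\<in>UNIV. (A $ i $ i)\<^sup>2) \<le> A \<bullet> A" by (simp add: inner_vec_def power2_eq_square)
  qed simp
  finally show ?thesis by (simp add: mult.commute)
qed

text \<open>Separates the algebra of the strain from differentiation, so that almost everywhere
  linearity is inherited from \<open>Jac\<close>.\<close>

definition sym_part :: "real^'n^'n \<Rightarrow> real^'n^'n" where
  "sym_part A = (1/2) *\<^sub>R (A + transpose A)"

lemma inner_transpose_self:
  fixes A :: "real^'n^'n"
  shows "transpose A \<bullet> transpose A = A \<bullet> A"
  unfolding inner_vec_def transpose_def by (simp, rule sum.swap)

lemma sym_part_inner_le: "sym_part A \<bullet> sym_part A \<le> A \<bullet> A"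
proof -
  have "norm (transpose A) = norm A" by (simp add: norm_eq_sqrt_inner inner_transpose_self)
  then have "norm (sym_part A) \<le> norm A"
    using norm_triangle_ineq[of A "transpose A"] by (simp add: sym_part_def)
  then have "(norm (sym_part A))\<^sup>2 \<le> (norm A)\<^sup>2" by (intro power_mono) auto
  then show ?thesis by (simp add: power2_norm_eq_inner)
qed

lemma trace_sym_part: "trace (sym_part A) = trace A"
  by (simp add: trace_def sym_part_def transpose_def)

lemma bounded_linear_sym_part: "bounded_linear sym_part"
  by (subst linear_conv_bounded_linear[symmetric], rule linearI)
    (auto simp: sym_part_def transpose_def vec_eq_iff algebra_simps)

lemma bounded_linear_trace: "bounded_linear (trace :: real^'n^'n \<Rightarrow> real)"
  by (subst linear_conv_bounded_linear[symmetric], rule linearI)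
    (auto simp: trace_def sum.distrib sum_distrib_left)

lemma strain_eq: "strain u x = sym_part (Jac u x)"
  by (simp add: strain_def sym_part_def)

locale mesh_domain = bounded_domain \<Omega> for \<Omega> :: "(real^'n) set" +
  fixes h :: real and \<T> :: "(real^'n) set set"
  assumes mesh: "mesh \<Omega> h \<T>"
begin

sublocale cells \<T>
  using mesh by (rule mesh_cells)

lemma cells_subset_closure: "\<Union>\<T> \<subseteq> closure \<Omega>"
  using mesh by (simp add: mesh_def)

section \<open>Differential operators on piecewise polynomial fields\<close>

definition piecewise_poly_vec :: "(real^'n \<Rightarrow> real^'n) \<Rightarrow> bool" where
  "piecewise_poly_vec v \<longleftrightarrow> (\<forall>i. piecewise_poly (\<lambda>x. v x $ i))"

lemma piecewise_poly_vec_comp: "piecewise_poly_vec v \<Longrightarrow> piecewise_poly (\<lambda>x. v x $ i)"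
  by (simp add: piecewise_poly_vec_def)

lemma piecewise_poly_add: "piecewise_poly f \<Longrightarrow> piecewise_poly g \<Longrightarrow> piecewise_poly (\<lambda>x. f x + g x)"
  using subspace_add[OF subspace_piecewise_poly, of f g] by (simp add: plus_fun_def)

lemma piecewise_poly_scale: "piecewise_poly f \<Longrightarrow> piecewise_poly (\<lambda>x. c * f x)"
  using subspace_scale[OF subspace_piecewise_poly, of f c] by (simp add: scaleR_fun_def)

lemma piecewise_poly_zero: "piecewise_poly (\<lambda>x. 0)"
  using subspace_0[OF subspace_piecewise_poly] by (simp add: zero_fun_def)

lemma subspace_piecewise_poly_vec: "subspace {v. piecewise_poly_vec v}"
  unfolding subspace_def
  using piecewise_poly_add piecewise_poly_scale piecewise_poly_zero
  by (auto simp: piecewise_poly_vec_def scaleR_fun_def zero_fun_def)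

lemma piecewise_poly_has_derivative:
  "piecewise_poly f \<Longrightarrow> x \<notin> skeleton \<Longrightarrow> (f has_derivative frechet_derivative f (at x)) (at x)"
  using piecewise_poly_differentiable frechet_derivative_works by blast

lemma partial_add:
  assumes "piecewise_poly f" "piecewise_poly g" "x \<notin> skeleton"
  shows "frechet_derivative (\<lambda>x. f x + g x) (at x) e =
    frechet_derivative f (at x) e + frechet_derivative g (at x) e"
  using frechet_derivative_at[OF has_derivative_add[OF piecewise_poly_has_derivative[OF assms(1,3)]
        piecewise_poly_has_derivative[OF assms(2,3)]]] by metis

lemma partial_scale:
  assumes "piecewise_poly f" "x \<notin> skeleton"
  shows "frechet_derivative (\<lambda>x. c * f x) (at x) e = c * frechet_derivative f (at x) e"
  using frechet_derivative_at[OF has_derivative_mult_right[OF piecewise_poly_has_derivative[OF assms], of c]]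
  by metis

text \<open>Off the skeleton all components are differentiable, so the field is too and its
  derivative is assembled from theirs. Elsewhere the two sides need not agree.\<close>

lemma Jac_entry:
  assumes v: "piecewise_poly_vec v" and x: "x \<notin> skeleton"
  shows "Jac v x $ i $ j = frechet_derivative (\<lambda>x. v x $ i) (at x) (axis j 1)"
proof -
  let ?D = "\<lambda>y. \<chi> i. frechet_derivative (\<lambda>x. v x $ i) (at x) y"
  have "(v has_derivative ?D) (at x)"
    unfolding has_derivative_componentwise_within[of v]
    using piecewise_poly_has_derivative[OF piecewise_poly_vec_comp[OF v] x]
    by (auto simp: Basis_vec_def inner_axis)
  then have "frechet_derivative v (at x) = ?D" using frechet_derivative_at by metis
  then show ?thesis by (simp add: Jac_def jacobian_def matrix_def)
qed

lemma AE_linear_grad: "AE_linear {q. piecewise_poly q} grad"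
  unfolding AE_linear_def
proof (intro conjI ballI allI)
  show "subspace {q. piecewise_poly q}" by (rule subspace_piecewise_poly)
next
  fix p assume p: "p \<in> {q. piecewise_poly q}"
  show "ess_bounded (grad p)"
    by (rule ess_bounded_componentwise)
      (use p ess_bounded_derivative[of p] in \<open>auto simp: Basis_vec_def inner_axis grad_def\<close>)
  show "AE x in lebesgue. grad (c *\<^sub>R p) x = c *\<^sub>R grad p x" for c
    using AE_off_skeleton
    by eventually_elim (use p in \<open>auto simp: grad_def vec_eq_iff scaleR_fun_def partial_scale\<close>)
  fix q assume q: "q \<in> {q. piecewise_poly q}"
  show "AE x in lebesgue. grad (p + q) x = grad p x + grad q x"
    using AE_off_skeleton
    by eventually_elim (use p q in \<open>auto simp: grad_def vec_eq_iff plus_fun_def partial_add\<close>)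
qed

lemma AE_linear_Jac: "AE_linear {v. piecewise_poly_vec v} Jac"
  unfolding AE_linear_def
proof (intro conjI ballI allI)
  show sub: "subspace {v. piecewise_poly_vec v}" by (rule subspace_piecewise_poly_vec)
  fix u assume "u \<in> {v. piecewise_poly_vec v}"
  then have u: "piecewise_poly_vec u" by simp
  have entry: "ess_bounded (\<lambda>x. Jac u x $ i $ j)" for i j
  proof (rule ess_bounded_cong_AE)
    show "ess_bounded (\<lambda>x. frechet_derivative (\<lambda>x. u x $ i) (at x) (axis j 1))"
      by (rule ess_bounded_derivative[OF piecewise_poly_vec_comp[OF u]])
    show "AE x in lebesgue. frechet_derivative (\<lambda>x. u x $ i) (at x) (axis j 1) = Jac u x $ i $ j"
      using AE_off_skeleton by eventually_elim (simp add: Jac_entry[OF u])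
  qed
  show "ess_bounded (Jac u)"
    by (rule ess_bounded_componentwise) (use entry in \<open>auto simp: Basis_vec_def inner_axis\<close>)
  show "AE x in lebesgue. Jac (c *\<^sub>R u) x = c *\<^sub>R Jac u x" for c
  proof -
    have cu: "piecewise_poly_vec (c *\<^sub>R u)" using subspace_scale[OF sub, of u c] u by simp
    show ?thesis
      using AE_off_skeleton
      by eventually_elim (simp add: vec_eq_iff Jac_entry[OF u] Jac_entry[OF cu, unfolded scaleR_fun_def] scaleR_fun_def
          partial_scale[OF piecewise_poly_vec_comp[OF u]])
  qed
  fix v assume "v \<in> {v. piecewise_poly_vec v}"
  then have v: "piecewise_poly_vec v" by simp
  have uv: "piecewise_poly_vec (u + v)" using subspace_add[OF sub, of u v] u v by simp
  show "AE x in lebesgue. Jac (u + v) x = Jac u x + Jac v x"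
    using AE_off_skeleton
    by eventually_elim (simp add: vec_eq_iff Jac_entry[OF u] Jac_entry[OF v] Jac_entry[OF uv]
        partial_add[OF piecewise_poly_vec_comp[OF u] piecewise_poly_vec_comp[OF v]])
qed

lemma AE_linear_compose:
  assumes D: "AE_linear W D" and L: "bounded_linear L"
  shows "AE_linear W (\<lambda>u x. L (D u x))"
  unfolding AE_linear_def
proof (intro conjI ballI allI)
  interpret L: bounded_linear L by (rule L)
  show "subspace W" using D by (simp add: AE_linear_def)
  fix u assume u: "u \<in> W"
  show "ess_bounded (\<lambda>x. L (D u x))"
    by (rule ess_bounded_linear[OF AE_linear_ess_bounded[OF D u] L])
  show "AE x in lebesgue. L (D (c *\<^sub>R u) x) = c *\<^sub>R L (D u x)" for c
  proof -
    have "AE x in lebesgue. D (c *\<^sub>R u) x = c *\<^sub>R D u x" using D u by (simp add: AE_linear_def)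
    then show ?thesis by eventually_elim (simp add: L.scaleR)
  qed
  fix v assume v: "v \<in> W"
  have "AE x in lebesgue. D (u + v) x = D u x + D v x" using D u v by (simp add: AE_linear_def)
  then show "AE x in lebesgue. L (D (u + v) x) = L (D u x) + L (D v x)"
    by eventually_elim (simp add: L.add)
qed

lemma AE_linear_strain: "AE_linear {v. piecewise_poly_vec v} strain"
  using AE_linear_compose[OF AE_linear_Jac bounded_linear_sym_part]
  by (simp add: strain_eq[abs_def])

lemma AE_linear_divg: "AE_linear {v. piecewise_poly_vec v} divg"
  using AE_linear_compose[OF AE_linear_Jac bounded_linear_trace]
  by (simp add: divg_def[abs_def])

lemma piecewise_poly_ess_bounded: "piecewise_poly f \<Longrightarrow> ess_bounded f"
  by (rule ess_bounded_continuous_compact_support[OF piecewise_poly_continuous compact_Union_cells])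
    (auto intro: piecewise_poly_outside)

lemma AE_linear_id: "AE_linear {q. piecewise_poly q} (\<lambda>q. q)"
  using subspace_piecewise_poly piecewise_poly_ess_bounded
  by (auto simp: AE_linear_def scaleR_fun_def)

text \<open>A matrix and its symmetric part have the same trace, so the trace inequality applies to
  the strain. This is the reason for the summand 2 \<mu> / d in \<zeta>^2.\<close>

lemma L2_inner_divg_le_strain:
  assumes "piecewise_poly_vec v"
  shows "L2_inner \<Omega> (divg v) (divg v) \<le> real CARD('n) * L2_inner \<Omega> (strain v) (strain v)"
proof (rule L2_inner_mono)
  have "divg v x = trace (strain v x)" for x by (simp add: divg_def strain_eq trace_sym_part)
  then show "AE x in lebesgue. divg v x \<bullet> divg v x \<le> real CARD('n) * (strain v x \<bullet> strain v x)"
    using trace_square_le[of "strain v _"] by (simp add: power2_eq_square)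
qed (use assms AE_linear_ess_bounded[OF AE_linear_divg] AE_linear_ess_bounded[OF AE_linear_strain] in auto)

lemma L2_inner_divg_le_Jac:
  assumes "piecewise_poly_vec v"
  shows "L2_inner \<Omega> (divg v) (divg v) \<le> real CARD('n) * L2_inner \<Omega> (Jac v) (Jac v)"
proof (rule L2_inner_mono)
  show "AE x in lebesgue. divg v x \<bullet> divg v x \<le> real CARD('n) * (Jac v x \<bullet> Jac v x)"
    using trace_square_le[of "Jac v _"] by (simp add: divg_def power2_eq_square)
qed (use assms AE_linear_ess_bounded[OF AE_linear_divg] AE_linear_ess_bounded[OF AE_linear_Jac] in auto)

lemma L2_inner_strain_le_Jac:
  assumes "piecewise_poly_vec v"
  shows "L2_inner \<Omega> (strain v) (strain v) \<le> L2_inner \<Omega> (Jac v) (Jac v)"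
proof -
  have "L2_inner \<Omega> (strain v) (strain v) \<le> 1 * L2_inner \<Omega> (Jac v) (Jac v)"
  proof (rule L2_inner_mono)
    show "AE x in lebesgue. strain v x \<bullet> strain v x \<le> 1 * (Jac v x \<bullet> Jac v x)"
      by (simp add: strain_eq sym_part_inner_le)
  qed (use assms AE_linear_ess_bounded[OF AE_linear_strain] AE_linear_ess_bounded[OF AE_linear_Jac] in auto)
  then show ?thesis by simp
qed

text \<open>Instead of Korn's inequality: a vanishing strain has a vanishing diagonal, that is,
  \<open>\<partial>\<^sub>i v\<^sub>i = 0\<close>, so \<open>v\<^sub>i\<close> is constant along direction \<open>i\<close>.\<close>

lemma strain_definite:
  assumes v: "piecewise_poly_vec v" and z: "L2_inner \<Omega> (strain v) (strain v) = 0"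
  shows "v = 0"
proof -
  have "ess_bounded (strain v)" using v AE_linear_ess_bounded[OF AE_linear_strain] by simp
  then have 0: "AE x in lebesgue. x \<in> \<Omega> \<longrightarrow> strain v x = 0" using z by (rule L2_inner_eq_0D)
  have "v x $ i = 0" for x i
  proof (rule piecewise_poly_eq_0_if_derivative_0[OF piecewise_poly_vec_comp[OF v] open_domain
        cells_subset_closure])
    show "axis i (1::real) \<noteq> 0" by (simp add: axis_eq_0_iff)
    show "AE x in lebesgue. x \<in> \<Omega> \<longrightarrow> frechet_derivative (\<lambda>x. v x $ i) (at x) (axis i 1) = 0"
      using 0 AE_off_skeleton
    proof eventually_elim
      case (elim x)
      have "strain v x $ i $ i = Jac v x $ i $ i" by (simp add: strain_def transpose_def)
      then show ?case using elim Jac_entry[OF v, of x i i] by auto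
    qed
  qed
  then show ?thesis by (simp add: fun_eq_iff vec_eq_iff)
qed

text \<open>Inside \<Omega> the set where \<open>q\<close> is nonzero is open and null, hence empty;
  outside, \<open>q\<close> vanishes by the definition of \<open>P1\<close>.\<close>

lemma P1_L2_definite:
  assumes q: "q \<in> P1 \<Omega> \<T>" and z: "L2_inner \<Omega> q q = 0"
  shows "q = 0"
proof -
  have q': "piecewise_poly q" using P1_piecewise_poly[OF mesh q] .
  have "AE x in lebesgue. x \<in> \<Omega> \<longrightarrow> q x = 0"
    using L2_inner_eq_0D[OF piecewise_poly_ess_bounded[OF q'] z] .
  then have "negligible (\<Omega> \<inter> {x. q x \<noteq> 0})"
    by (auto simp: AE_lebesgue_negligible elim!: negligible_subset)
  moreover have "open (\<Omega> \<inter> {x. q x \<noteq> 0})"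
    using open_domain piecewise_poly_continuous[OF q', of UNIV]
    by (intro open_Int open_Collect_neq) auto
  ultimately have "\<Omega> \<inter> {x. q x \<noteq> 0} = {}" using open_not_negligible by blast
  then show ?thesis using q by (auto simp: P1_def fun_eq_iff)
qed

section \<open>Finite dimension of the element spaces\<close>

lemma subspace_P1: "subspace (P1 \<Omega> \<T>)"
  unfolding subspace_def
proof (intro conjI ballI allI)
  show "0 \<in> P1 \<Omega> \<T>" by (auto simp: P1_def zero_fun_def intro!: exI[of _ 0])
next
  fix p q assume pq: "p \<in> P1 \<Omega> \<T>" "q \<in> P1 \<Omega> \<T>"
  have "\<exists>a b. \<forall>x\<in>S. p x + q x = a \<bullet> x + b" if S: "S \<in> \<T>" for S
  proof -
    have "\<exists>a b. \<forall>x\<in>S. p x = a \<bullet> x + b" "\<exists>a b. \<forall>x\<in>S. q x = a \<bullet> x + b"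
      using pq S by (simp_all add: P1_def)
    then obtain a b a' b' where "\<forall>x\<in>S. p x = a \<bullet> x + b" "\<forall>x\<in>S. q x = a' \<bullet> x + b'" by blast
    then show ?thesis by (intro exI[of _ "a + a'"] exI[of _ "b + b'"]) (auto simp: inner_add_left)
  qed
  then show "p + q \<in> P1 \<Omega> \<T>"
    using pq by (auto simp: P1_def plus_fun_def intro!: continuous_intros)
next
  fix c p assume p: "p \<in> P1 \<Omega> \<T>"
  have "\<exists>a b. \<forall>x\<in>S. c * p x = a \<bullet> x + b" if S: "S \<in> \<T>" for S
  proof -
    have "\<exists>a b. \<forall>x\<in>S. p x = a \<bullet> x + b" using p S by (simp add: P1_def)
    then obtain a b where "\<forall>x\<in>S. p x = a \<bullet> x + b" by blast
    then show ?thesis by (intro exI[of _ "c *\<^sub>R a"] exI[of _ "c * b"]) (auto simp: algebra_simps)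
  qed
  then show "c *\<^sub>R p \<in> P1 \<Omega> \<T>"
    using p by (auto simp: P1_def scaleR_fun_def intro!: continuous_intros)
qed

text \<open>The chosen cell of a point makes the supports of the spanning functions disjoint.\<close>

lemma finite_dim_P1: "finite_dim (P1 \<Omega> \<T>)"
proof -
  define ch where "ch = (\<lambda>x. SOME S. S \<in> \<T> \<and> x \<in> S)"
  have ch: "ch x \<in> \<T> \<and> x \<in> ch x" if "x \<in> \<Union>\<T>" for x
    using someI_ex[of "\<lambda>S. S \<in> \<T> \<and> x \<in> S"] that by (auto simp: ch_def)
  define lin :: "(real^'n) set \<Rightarrow> 'n \<Rightarrow> real^'n \<Rightarrow> real"
    where "lin = (\<lambda>S i x. if x \<in> \<Union>\<T> \<and> ch x = S then x $ i else 0)"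
  define one :: "(real^'n) set \<Rightarrow> real^'n \<Rightarrow> real"
    where "one = (\<lambda>S x. if x \<in> \<Union>\<T> \<and> ch x = S then 1 else 0)"
  let ?B = "(\<lambda>(S, i). lin S i) ` (\<T> \<times> UNIV) \<union> one ` \<T>"
  have "q \<in> span ?B" if q: "q \<in> P1 \<Omega> \<T>" for q
  proof -
    have "\<forall>S\<in>\<T>. \<exists>a b. \<forall>x\<in>S. q x = a \<bullet> x + b" using q by (simp add: P1_def)
    then obtain a b where ab: "\<And>S x. S \<in> \<T> \<Longrightarrow> x \<in> S \<Longrightarrow> q x = a S \<bullet> x + b S" by metis
    have "q x = (\<Sum>S\<in>\<T>. (\<Sum>i\<in>UNIV. a S $ i *\<^sub>R lin S i) + b S *\<^sub>R one S) x" for x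
    proof (cases "x \<in> \<Union>\<T>")
      case True
      have "(\<Sum>S\<in>\<T>. (\<Sum>i\<in>UNIV. a S $ i *\<^sub>R lin S i) + b S *\<^sub>R one S) x =
          (\<Sum>S\<in>\<T>. if S = ch x then a S \<bullet> x + b S else 0)"
        unfolding sum_fun_apply plus_fun_apply scaleR_fun_def
        by (rule sum.cong) (use True in \<open>auto simp: lin_def one_def inner_vec_def\<close>)
      also have "\<dots> = q x" using ch[OF True] ab[of "ch x" x] finite_cells by simp
      finally show ?thesis by simp
    next
      case False
      then have "q x = 0" using q by (auto simp: P1_def)
      then show ?thesis
        unfolding sum_fun_apply plus_fun_apply scaleR_fun_def using False by (simp add: lin_def one_def)
    qed
    then have "q = (\<Sum>S\<in>\<T>. (\<Sum>i\<in>UNIV. a S $ i *\<^sub>R lin S i) + b S *\<^sub>R one S)" by (rule ext)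
    moreover have "\<dots> \<in> span ?B"
      by (intro span_sum span_add span_scale span_base) auto
    ultimately show ?thesis by simp
  qed
  then show ?thesis
    unfolding finite_dim_def using subspace_P1 finite_cells by (intro conjI exI[of _ ?B]) auto
qed

definition embed :: "'n \<Rightarrow> (real^'n \<Rightarrow> real) \<Rightarrow> real^'n \<Rightarrow> real^'n" where
  "embed i f = (\<lambda>x. axis i (f x))"

lemma linear_embed: "linear (embed i)"
  by (rule linearI) (auto simp: embed_def fun_eq_iff scaleR_fun_def vec_eq_iff axis_def)

lemma sum_embed: "v = (\<Sum>i\<in>UNIV. embed i (\<lambda>x. v x $ i))"
  by (auto simp: fun_eq_iff sum_fun_apply embed_def vec_eq_iff axis_def if_distrib cong: if_cong)

lemma subspace_P1_vec: "subspace (P1_vec \<Omega> \<T>)"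
  using subspace_P1 unfolding subspace_def P1_vec_def
  by (auto simp: plus_fun_def scaleR_fun_def zero_fun_def)

lemma finite_dim_P1_vec: "finite_dim (P1_vec \<Omega> \<T>)"
proof -
  obtain B where B: "finite B" "P1 \<Omega> \<T> \<subseteq> span B" using finite_dim_P1 by (auto simp: finite_dim_def)
  let ?B = "\<Union>i. embed i ` B"
  have "v \<in> span ?B" if v: "v \<in> P1_vec \<Omega> \<T>" for v
  proof -
    have "embed i (\<lambda>x. v x $ i) \<in> span ?B" for i
    proof -
      have "(\<lambda>x. v x $ i) \<in> span B" using v B(2) by (auto simp: P1_vec_def)
      then have "embed i (\<lambda>x. v x $ i) \<in> span (embed i ` B)"
        using linear_span_image[OF linear_embed, of i B] by blast
      moreover have "span (embed i ` B) \<subseteq> span ?B" by (rule span_mono) blast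
      ultimately show ?thesis by blast
    qed
    then have "(\<Sum>i\<in>UNIV. embed i (\<lambda>x. v x $ i)) \<in> span ?B" by (intro span_sum) auto
    then show ?thesis by (simp flip: sum_embed)
  qed
  then show ?thesis
    unfolding finite_dim_def using subspace_P1_vec B(1) by (intro conjI exI[of _ ?B]) auto
qed

lemma subspace_Mini_vec: "subspace (Mini_vec \<Omega> \<T>)"
  unfolding subspace_def
proof (intro conjI ballI allI)
  show "0 \<in> Mini_vec \<Omega> \<T>"
    using subspace_0[OF subspace_P1_vec] unfolding Mini_vec_def
    by (auto intro!: bexI[of _ 0] exI[of _ "\<lambda>_. 0"])
next
  fix u v assume "u \<in> Mini_vec \<Omega> \<T>" "v \<in> Mini_vec \<Omega> \<T>"
  then obtain w \<beta> w' \<beta>' where w: "w \<in> P1_vec \<Omega> \<T>" "w' \<in> P1_vec \<Omega> \<T>"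
    and "\<And>x. u x = w x + (\<Sum>S\<in>\<T>. bubble S x *\<^sub>R \<beta> S)" "\<And>x. v x = w' x + (\<Sum>S\<in>\<T>. bubble S x *\<^sub>R \<beta>' S)"
    unfolding Mini_vec_def by blast
  then have "\<forall>x. (u + v) x = (w + w') x + (\<Sum>S\<in>\<T>. bubble S x *\<^sub>R (\<beta> S + \<beta>' S))"
    by (simp add: scaleR_add_right sum.distrib)
  then show "u + v \<in> Mini_vec \<Omega> \<T>"
    unfolding Mini_vec_def using subspace_add[OF subspace_P1_vec w]
    by (intro CollectI bexI[of _ "w + w'"] exI[of _ "\<lambda>S. \<beta> S + \<beta>' S"])
next
  fix c u assume "u \<in> Mini_vec \<Omega> \<T>"
  then obtain w \<beta> where w: "w \<in> P1_vec \<Omega> \<T>"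
    and "\<And>x. u x = w x + (\<Sum>S\<in>\<T>. bubble S x *\<^sub>R \<beta> S)"
    unfolding Mini_vec_def by blast
  then have "\<forall>x. (c *\<^sub>R u) x = (c *\<^sub>R w) x + (\<Sum>S\<in>\<T>. bubble S x *\<^sub>R (c *\<^sub>R \<beta> S))"
    by (simp add: scaleR_fun_def scaleR_add_right scaleR_sum_right mult.commute)
  then show "c *\<^sub>R u \<in> Mini_vec \<Omega> \<T>"
    unfolding Mini_vec_def using subspace_scale[OF subspace_P1_vec w]
    by (intro CollectI bexI[of _ "c *\<^sub>R w"] exI[of _ "\<lambda>S. c *\<^sub>R \<beta> S"])
qed

lemma finite_dim_Mini_vec: "finite_dim (Mini_vec \<Omega> \<T>)"
proof -
  obtain B where B: "finite B" "P1_vec \<Omega> \<T> \<subseteq> span B"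
    using finite_dim_P1_vec by (auto simp: finite_dim_def)
  let ?B = "B \<union> (\<lambda>(S, i). embed i (bubble S)) ` (\<T> \<times> UNIV)"
  have "v \<in> span ?B" if "v \<in> Mini_vec \<Omega> \<T>" for v
  proof -
    obtain w \<beta> where w: "w \<in> P1_vec \<Omega> \<T>"
      and v: "\<And>x. v x = w x + (\<Sum>S\<in>\<T>. bubble S x *\<^sub>R \<beta> S)"
      using \<open>v \<in> Mini_vec \<Omega> \<T>\<close> unfolding Mini_vec_def by blast
    have "v = w + (\<Sum>S\<in>\<T>. \<Sum>i\<in>UNIV. \<beta> S $ i *\<^sub>R embed i (bubble S))"
      by (auto simp: fun_eq_iff v sum_fun_apply embed_def vec_eq_iff axis_def scaleR_fun_def
          if_distrib mult.commute cong: if_cong)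
    moreover have "w \<in> span ?B" using w B(2) span_mono[of B ?B] by auto
    moreover have "(\<Sum>S\<in>\<T>. \<Sum>i\<in>UNIV. \<beta> S $ i *\<^sub>R embed i (bubble S)) \<in> span ?B"
      by (intro span_sum span_scale span_base) auto
    ultimately show ?thesis by (simp add: span_add)
  qed
  then show ?thesis
    unfolding finite_dim_def using subspace_Mini_vec B(1) finite_cells by (intro conjI exI[of _ ?B]) auto
qed

lemma P1_vec_piecewise_poly: "P1_vec \<Omega> \<T> \<subseteq> {v. piecewise_poly_vec v}"
  using P1_piecewise_poly[OF mesh] by (auto simp: P1_vec_def piecewise_poly_vec_def)

lemma Mini_vec_piecewise_poly: "Mini_vec \<Omega> \<T> \<subseteq> {v. piecewise_poly_vec v}"
proof
  fix v assume "v \<in> Mini_vec \<Omega> \<T>"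
  then obtain w \<beta> where w: "w \<in> P1_vec \<Omega> \<T>"
    and v: "\<And>x. v x = w x + (\<Sum>S\<in>\<T>. bubble S x *\<^sub>R \<beta> S)"
    unfolding Mini_vec_def by blast
  have "piecewise_poly (\<lambda>x. v x $ i)" for i
  proof -
    have "(\<lambda>x. w x $ i) + (\<Sum>S\<in>\<T>. \<beta> S $ i *\<^sub>R bubble S) \<in> {f. piecewise_poly f}"
      using subspace_piecewise_poly w P1_vec_piecewise_poly bubble_piecewise_poly[OF mesh]
      by (intro subspace_add subspace_sum subspace_scale) (auto simp: piecewise_poly_vec_def)
    moreover have "(\<lambda>x. w x $ i) + (\<Sum>S\<in>\<T>. \<beta> S $ i *\<^sub>R bubble S) = (\<lambda>x. v x $ i)"
      by (auto simp: fun_eq_iff v sum_fun_apply scaleR_fun_def mult.commute)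
    ultimately show ?thesis by simp
  qed
  then show "v \<in> {v. piecewise_poly_vec v}" by (simp add: piecewise_poly_vec_def)
qed

end

section \<open>The discrete Biot operator\<close>

text \<open>The form \<open>c\<close> of the overview: the negative of the pressure block of
  \<open>A_block\<close>. Adding the mass term gives \<open>pressure_form\<close>, the form
  \<open>s\<close> behind \<open>S_p\<close>.\<close>

definition stabilization_form ::
  "(real^'n) set \<Rightarrow> real \<Rightarrow> real \<Rightarrow> real \<Rightarrow> real \<Rightarrow> real \<Rightarrow> real \<Rightarrow> real
    \<Rightarrow> (real^'n \<Rightarrow> real) \<Rightarrow> (real^'n \<Rightarrow> real) \<Rightarrow> real" where
  "stabilization_form \<Omega> \<delta> lam \<mu> \<alpha> K h \<tau> p q =
     \<tau> * ap_form \<Omega> K p q + eta TYPE('n) \<delta> \<alpha> lam \<mu> * h\<^sup>2 * L2_inner \<Omega> (grad p) (grad q)"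

definition pressure_form ::
  "(real^'n) set \<Rightarrow> real \<Rightarrow> real \<Rightarrow> real \<Rightarrow> real \<Rightarrow> real \<Rightarrow> real \<Rightarrow> real
    \<Rightarrow> (real^'n \<Rightarrow> real) \<Rightarrow> (real^'n \<Rightarrow> real) \<Rightarrow> real" where
  "pressure_form \<Omega> \<delta> lam \<mu> \<alpha> K h \<tau> p q =
     stabilization_form \<Omega> \<delta> lam \<mu> \<alpha> K h \<tau> p q + \<alpha>\<^sup>2 / (zeta TYPE('n) lam \<mu>)\<^sup>2 * L2_inner \<Omega> p q"

lemma ap_form_eq: "ap_form \<Omega> K p q = K * L2_inner \<Omega> (grad p) (grad q)"
  unfolding ap_form_def L2_inner_def inner_scaleR_left by (rule set_integral_mult_right)

lemma L2_norm_power2: "(L2_norm \<Omega> f)\<^sup>2 = L2_inner \<Omega> f f"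
  by (simp add: L2_norm_def L2_inner_nonneg)

lemma L2_norm_nonneg: "0 \<le> L2_norm \<Omega> f"
  by (simp add: L2_norm_def L2_inner_nonneg)

lemma H1_norm_nonneg: "0 \<le> H1_norm \<Omega> v"
  by (simp add: H1_norm_def)

lemma Jac_le_H1_norm: "L2_inner \<Omega> (Jac v) (Jac v) \<le> (H1_norm \<Omega> v)\<^sup>2"
  by (simp add: H1_norm_def L2_norm_power2)
    (simp flip: L2_norm_power2)

lemma zeta_power2:
  "0 \<le> lam \<Longrightarrow> 0 < \<mu> \<Longrightarrow> (zeta TYPE('n::finite) lam \<mu>)\<^sup>2 = lam + 2 * \<mu> / real CARD('n)"
  by (simp add: zeta_def)

lemma zeta_pos: "0 \<le> lam \<Longrightarrow> 0 < \<mu> \<Longrightarrow> 0 < zeta TYPE('n::finite) lam \<mu>"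
  by (simp add: zeta_def add_nonneg_pos)

context mesh_domain
begin

lemma divg_le_a_form:
  assumes "piecewise_poly_vec v" "0 \<le> lam" "0 < \<mu>"
  shows "(zeta TYPE('n) lam \<mu>)\<^sup>2 * L2_inner \<Omega> (divg v) (divg v) \<le> a_form \<Omega> lam \<mu> v v"
proof -
  have "2 * \<mu> / real CARD('n) * L2_inner \<Omega> (divg v) (divg v)
      \<le> 2 * \<mu> / real CARD('n) * (real CARD('n) * L2_inner \<Omega> (strain v) (strain v))"
    using L2_inner_divg_le_strain[OF assms(1)] assms(3) by (intro mult_left_mono) auto
  then show ?thesis
    using assms by (simp add: zeta_power2 a_form_def distrib_right)
qed

lemma a_form_le_H1_norm:
  assumes v: "piecewise_poly_vec v" and lam: "0 \<le> lam" and mu: "0 < \<mu>"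
  shows "sqrt (a_form \<Omega> lam \<mu> v v) \<le> sqrt (real CARD('n)) * zeta TYPE('n) lam \<mu> * H1_norm \<Omega> v"
proof -
  let ?J = "L2_inner \<Omega> (Jac v) (Jac v)"
  have "a_form \<Omega> lam \<mu> v v \<le> 2 * \<mu> * ?J + lam * (real CARD('n) * ?J)"
    unfolding a_form_def
    using L2_inner_strain_le_Jac[OF v] L2_inner_divg_le_Jac[OF v] lam mu
    by (intro add_mono mult_left_mono) auto
  \<comment> \<open>Since d \<zeta>^2 = d \<lambda> + 2 \<mu>, nothing is lost here.\<close>
  also have "\<dots> = real CARD('n) * (zeta TYPE('n) lam \<mu>)\<^sup>2 * ?J"
    using lam mu by (simp add: zeta_power2 field_simps)
  also have "\<dots> \<le> real CARD('n) * (zeta TYPE('n) lam \<mu>)\<^sup>2 * (H1_norm \<Omega> v)\<^sup>2"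
    by (intro mult_left_mono Jac_le_H1_norm) auto
  finally have "sqrt (a_form \<Omega> lam \<mu> v v) \<le>
      sqrt (real CARD('n) * (zeta TYPE('n) lam \<mu>)\<^sup>2 * (H1_norm \<Omega> v)\<^sup>2)"
    by (rule real_sqrt_le_mono)
  also have "\<dots> = sqrt (real CARD('n)) * zeta TYPE('n) lam \<mu> * H1_norm \<Omega> v"
    using zeta_pos[OF lam mu, where 'n = 'n] by (simp add: real_sqrt_mult H1_norm_nonneg)
  finally show ?thesis .
qed

lemma inner_form_a_form:
  assumes V: "finite_dim V" "V \<subseteq> {v. piecewise_poly_vec v}" and lam: "0 \<le> lam" and mu: "0 < \<mu>"
  shows "inner_form V (a_form \<Omega> lam \<mu>)"
proof -
  have sub: "subspace V" using V(1) by (simp add: finite_dim_def)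
  have s: "psd_form V (\<lambda>u v. L2_inner \<Omega> (strain u) (strain v))"
    and d: "psd_form V (\<lambda>u v. L2_inner \<Omega> (divg u) (divg v))"
    using AE_linear_subset[OF AE_linear_strain V(2) sub] AE_linear_subset[OF AE_linear_divg V(2) sub]
    by (auto intro: psd_form_L2_inner)
  have "psd_form V (\<lambda>u v. 2 * \<mu> * L2_inner \<Omega> (strain u) (strain v) + lam * L2_inner \<Omega> (divg u) (divg v))"
    using lam mu by (intro psd_form_add psd_form_scale s d) auto
  then have a: "psd_form V (a_form \<Omega> lam \<mu>)" by (simp add: a_form_def[abs_def])
  have "v = 0" if v: "v \<in> V" "a_form \<Omega> lam \<mu> v v = 0" for v
  proof -
    have "0 \<le> 2 * \<mu> * L2_inner \<Omega> (strain v) (strain v)" "0 \<le> lam * L2_inner \<Omega> (divg v) (divg v)"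
      using lam mu by (auto intro!: mult_nonneg_nonneg L2_inner_nonneg)
    then have "2 * \<mu> * L2_inner \<Omega> (strain v) (strain v) = 0"
      using v(2) unfolding a_form_def by linarith
    then show ?thesis using strain_definite[of v] v(1) V(2) mu by auto
  qed
  then show ?thesis
    using a V(1) by (simp add: inner_form_def inner_form_axioms_def)
qed

lemma psd_form_stabilization_form:
  assumes Q: "subspace Q" "Q \<subseteq> {q. piecewise_poly q}" and pos: "0 \<le> \<tau>" "0 \<le> K" "0 \<le> \<delta>"
  shows "psd_form Q (stabilization_form \<Omega> \<delta> lam \<mu> \<alpha> K h' \<tau>)"
proof -
  have g: "psd_form Q (\<lambda>p q. L2_inner \<Omega> (grad p) (grad q))"
    using AE_linear_subset[OF AE_linear_grad Q(2,1)] by (rule psd_form_L2_inner)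
  have "psd_form Q (\<lambda>p q. \<tau> * (K * L2_inner \<Omega> (grad p) (grad q)) +
      eta TYPE('n) \<delta> \<alpha> lam \<mu> * h'\<^sup>2 * L2_inner \<Omega> (grad p) (grad q))"
    using pos by (intro psd_form_add psd_form_scale g) (auto simp: eta_def)
  then show ?thesis by (simp add: stabilization_form_def[abs_def] ap_form_eq)
qed

lemma inner_form_pressure_form:
  assumes pos: "0 \<le> \<tau>" "0 \<le> K" "0 \<le> \<delta>" "0 < \<alpha>" "0 \<le> lam" "0 < \<mu>"
  shows "inner_form (P1 \<Omega> \<T>) (pressure_form \<Omega> \<delta> lam \<mu> \<alpha> K h' \<tau>)"
proof -
  let ?Q = "P1 \<Omega> \<T>" and ?c = "stabilization_form \<Omega> \<delta> lam \<mu> \<alpha> K h' \<tau>"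
  let ?m = "\<alpha>\<^sup>2 / (zeta TYPE('n) lam \<mu>)\<^sup>2"
  have Q: "?Q \<subseteq> {q. piecewise_poly q}" using P1_piecewise_poly[OF mesh] by blast
  have c: "psd_form ?Q ?c" using subspace_P1 Q pos by (intro psd_form_stabilization_form)
  have m: "0 < ?m" using zeta_pos[OF pos(5,6), where 'n = 'n] pos(4) by simp
  have "psd_form ?Q (\<lambda>p q. L2_inner \<Omega> p q)"
    using AE_linear_subset[OF AE_linear_id Q subspace_P1] by (rule psd_form_L2_inner)
  then have "psd_form ?Q (\<lambda>p q. ?c p q + ?m * L2_inner \<Omega> p q)"
    using m by (intro psd_form_add psd_form_scale c) auto
  then have s: "psd_form ?Q (pressure_form \<Omega> \<delta> lam \<mu> \<alpha> K h' \<tau>)"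
    by (simp add: pressure_form_def[abs_def])
  have "q = 0" if q: "q \<in> ?Q" "pressure_form \<Omega> \<delta> lam \<mu> \<alpha> K h' \<tau> q q = 0" for q
  proof -
    have "0 \<le> ?c q q" using psd_form.nonneg[OF c q(1)] .
    moreover have "0 \<le> ?m * L2_inner \<Omega> q q" using mult_nonneg_nonneg[OF less_imp_le[OF m] L2_inner_nonneg] .
    ultimately have "?m * L2_inner \<Omega> q q = 0" using q(2) unfolding pressure_form_def by linarith
    then show ?thesis using P1_L2_definite[OF q(1)] m by (auto simp del: divide_eq_0_iff times_divide_eq_left)
  qed
  then show ?thesis using s finite_dim_P1 by (simp add: inner_form_def inner_form_axioms_def)
qed

end

text \<open>Trades the supremum for an arbitrary bound \<open>c\<close> of the divergence
  functional. A nonzero \<open>v\<close> of norm 0 would contribute the quotient 0, whence the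
  condition \<open>0 \<le> c\<close>.\<close>

lemma weak_inf_sup_bound:
  assumes "weak_inf_sup \<Omega> h \<gamma> \<xi> V Q" "q \<in> Q" "0 \<le> c"
    and le: "\<And>v. v \<in> V \<Longrightarrow> L2_inner \<Omega> (divg v) q \<le> c * H1_norm \<Omega> v"
  shows "\<gamma> * L2_norm \<Omega> q \<le> \<xi> * h * L2_norm \<Omega> (grad q) + c"
proof -
  have "ereal (\<gamma> * L2_norm \<Omega> q - \<xi> * h * L2_norm \<Omega> (grad q)) \<le>
      (SUP v\<in>V - {0}. ereal (L2_inner \<Omega> (divg v) q / H1_norm \<Omega> v))"
    using assms(1,2) by (auto simp: weak_inf_sup_def)
  also have "\<dots> \<le> ereal c"
  proof (rule SUP_least)
    fix v assume "v \<in> V - {0}"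
    then show "ereal (L2_inner \<Omega> (divg v) q / H1_norm \<Omega> v) \<le> ereal c"
      using le[of v] H1_norm_nonneg[of \<Omega> v] assms(3)
      by (cases "H1_norm \<Omega> v = 0") (auto simp: divide_le_eq)
  qed
  finally show ?thesis by simp
qed

text \<open>The point where all parameters disappear. A bound \<open>R\<close> on the coupling gives
  the divergence functional the H1 bound R sqrt(d) \<zeta> / \<alpha>; multiplying the inf-sup
  inequality by \<alpha> / (\<zeta> \<gamma>) turns its left-hand side into the root of the mass
  term and leaves sqrt(d) / \<gamma> as the coefficient of \<open>R\<close>.\<close>

lemma admissible_saddle_point:
  fixes \<Omega> :: "(real^'n) set"
  assumes adm: "admissible \<Omega> V Q \<gamma> \<xi> lam \<mu> \<alpha> K h \<tau>"
    and pos: "0 < \<delta>" "0 < \<gamma>" "0 \<le> \<xi>"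
  shows "saddle_point V (a_form \<Omega> lam \<mu>) Q (pressure_form \<Omega> \<delta> lam \<mu> \<alpha> K h \<tau>)
    (stabilization_form \<Omega> \<delta> lam \<mu> \<alpha> K h \<tau>) (\<lambda>v q. \<alpha> * B_op \<Omega> Q v q)
    (\<xi> / (\<gamma> * sqrt \<delta>)) (sqrt (real CARD('n)) / \<gamma>)"
proof -
  have par: "0 \<le> lam" "0 < \<mu>" "0 < \<alpha>" "0 < K" "0 < h" "0 < \<tau>" and inf_sup: "weak_inf_sup \<Omega> h \<gamma> \<xi> V Q"
    and dom: "open \<Omega>" "bounded \<Omega>"
    using adm by (auto simp: admissible_def fe_pair_def)
  obtain \<T> where \<T>: "mesh \<Omega> h \<T>" "Q = P1 \<Omega> \<T>" "V = P1_vec \<Omega> \<T> \<or> V = Mini_vec \<Omega> \<T>"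
    using adm by (auto simp: admissible_def fe_pair_def)
  interpret mesh_domain \<Omega> h \<T>
    using dom \<T>(1) by unfold_locales
  have V: "finite_dim V" "V \<subseteq> {v. piecewise_poly_vec v}"
    using \<T>(3) finite_dim_P1_vec finite_dim_Mini_vec P1_vec_piecewise_poly Mini_vec_piecewise_poly by auto
  have subV: "subspace V" using V(1) by (simp add: finite_dim_def)
  have Q: "Q \<subseteq> {q. piecewise_poly q}" "subspace Q"
    using P1_piecewise_poly[OF mesh] subspace_P1 \<T>(2) by auto
  let ?a = "a_form \<Omega> lam \<mu>" and ?s = "pressure_form \<Omega> \<delta> lam \<mu> \<alpha> K h \<tau>"
  let ?c = "stabilization_form \<Omega> \<delta> lam \<mu> \<alpha> K h \<tau>" and ?b = "\<lambda>v q. \<alpha> * B_op \<Omega> Q v q"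
  define \<zeta> where "\<zeta> = zeta TYPE('n) lam \<mu>"
  have \<zeta>: "0 < \<zeta>" using zeta_pos par by (simp add: \<zeta>_def)
  interpret a: inner_form V ?a by (rule inner_form_a_form[OF V par(1,2)])
  interpret s: inner_form Q ?s
    unfolding \<T>(2) by (rule inner_form_pressure_form) (use par pos in auto)
  interpret c: psd_form Q ?c
    by (rule psd_form_stabilization_form[OF Q(2,1)]) (use par pos in auto)
  have Qb: "ess_bounded q" if "q \<in> Q" for q using Q(1) that piecewise_poly_ess_bounded by blast
  have Vd: "ess_bounded (divg v)" if "v \<in> V" for v
    using AE_linear_ess_bounded[OF AE_linear_divg] V(2) that by blast
  have B: "B_op \<Omega> Q v q = - L2_inner \<Omega> (divg v) q" if "q \<in> Q" for v q
    using that by (simp add: B_op_def functional_on_def)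
  have divg: "AE_linear V divg" using AE_linear_subset[OF AE_linear_divg V(2) subV] .
  have s_c: "?s q q - ?c q q = (\<alpha> / \<zeta> * L2_norm \<Omega> q)\<^sup>2" for q
    by (simp add: pressure_form_def \<zeta>_def power_mult_distrib power_divide L2_norm_power2)
  have sqrt_s_c: "sqrt (?s q q - ?c q q) = \<alpha> / \<zeta> * L2_norm \<Omega> q" for q
    using \<zeta> par by (simp add: s_c L2_norm_nonneg abs_mult)
  show ?thesis
  proof (unfold_locales, goal_cases)
    \<comment> \<open>The axioms of the three forms are already interpreted. The goals left are
      bilinearity of the coupling (1 to 4), \<open>c \<le> s\<close> (5), boundedness (6), the signs
      of the constants (7, 8) and the inf-sup condition (9).\<close>
    case (1 u v q)
    then show ?case using L2_inner_add_AE[OF divg 1(1,2) Qb[OF 1(3)]] by (simp add: B algebra_simps)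
  next
    case (2 v q r)
    then show ?case using L2_inner_scaleR_AE[OF divg 2(1) Qb[OF 2(2)]] by (simp add: B)
  next
    case (3 v p q)
    then show ?case
      using L2_inner_add_left[OF Qb[OF 3(2)] Qb[OF 3(3)] Vd[OF 3(1)]] s.mem(1)[OF 3(2,3)]
      by (simp add: B L2_inner_commute[of "divg v"] plus_fun_def algebra_simps)
  next
    case (4 v q r)
    then show ?case
      using L2_inner_scaleR_left[of r q "divg v"] s.mem(2)[OF 4(2), of r]
      by (simp add: B L2_inner_commute[of "divg v"] scaleR_fun_def)
  next
    case (5 q)
    have "0 \<le> ?s q q - ?c q q" unfolding s_c by simp
    then show ?case by simp
  next
    case (6 v q)
    have "\<zeta> * L2_norm \<Omega> (divg v) \<le> sqrt (?a v v)"
    proof (rule real_le_rsqrt)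
      show "(\<zeta> * L2_norm \<Omega> (divg v))\<^sup>2 \<le> ?a v v"
        using divg_le_a_form[of v lam \<mu>] par V(2) 6(1)
        by (auto simp: \<zeta>_def power_mult_distrib L2_norm_power2)
    qed
    moreover have "\<alpha> / \<zeta> * L2_norm \<Omega> q \<le> sqrt (?s q q)"
      unfolding sqrt_s_c[symmetric] using c.nonneg[OF 6(2)] by simp
    ultimately have "(\<zeta> * L2_norm \<Omega> (divg v)) * (\<alpha> / \<zeta> * L2_norm \<Omega> q) \<le> sqrt (?a v v) * sqrt (?s q q)"
      using \<zeta> par a.nonneg[OF 6(1)]
      by (intro mult_mono mult_nonneg_nonneg divide_nonneg_nonneg) (auto simp: L2_norm_nonneg)
    moreover have "\<bar>?b v q\<bar> \<le> (\<zeta> * L2_norm \<Omega> (divg v)) * (\<alpha> / \<zeta> * L2_norm \<Omega> q)"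
      using L2_Cauchy_Schwarz[OF Vd[OF 6(1)] Qb[OF 6(2)]] par \<zeta>
      by (simp add: B[OF 6(2)] abs_mult mult.assoc)
    ultimately show ?case by linarith
  next
    case 7
    show ?case using pos by simp
  next
    case 8
    show ?case using pos by simp
  next
    case (9 q R)
    let ?n = "sqrt (real CARD('n))"
    have div_le: "L2_inner \<Omega> (divg v) q \<le> (R * ?n * \<zeta> / \<alpha>) * H1_norm \<Omega> v" if v: "v \<in> V" for v
    proof -
      \<comment> \<open>\<open>B_op\<close> carries a minus sign, so the bound on the coupling is
        used at \<open>- v\<close> to estimate the divergence from above.\<close>
      have "L2_inner \<Omega> (divg (- v)) q = - L2_inner \<Omega> (divg v) q"
        using L2_inner_scaleR_AE[OF divg v Qb[OF 9(1)], of "-1"] by simp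
      then have "\<alpha> * L2_inner \<Omega> (divg v) q \<le> R * sqrt (?a v v)"
        using 9(3)[of "- v"] v a.mem(4)[OF v]
        by (simp add: B[OF 9(1)] a.neg_left a.neg_right)
      also have "\<dots> \<le> R * (?n * \<zeta> * H1_norm \<Omega> v)"
        using a_form_le_H1_norm[of v lam \<mu>] par V(2) v 9(2)
        by (intro mult_left_mono) (auto simp: \<zeta>_def)
      finally show ?thesis using par by (simp add: field_simps)
    qed
    have "\<gamma> * L2_norm \<Omega> q \<le> \<xi> * h * L2_norm \<Omega> (grad q) + R * ?n * \<zeta> / \<alpha>"
      by (rule weak_inf_sup_bound[OF inf_sup 9(1) _ div_le]) (use 9 \<zeta> par in auto)
    then have "\<alpha> / (\<zeta> * \<gamma>) * (\<gamma> * L2_norm \<Omega> q) \<le>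
        \<alpha> / (\<zeta> * \<gamma>) * (\<xi> * h * L2_norm \<Omega> (grad q) + R * ?n * \<zeta> / \<alpha>)"
      using \<zeta> par pos by (intro mult_left_mono) auto
    moreover have "\<alpha> / (\<zeta> * \<gamma>) * (\<gamma> * L2_norm \<Omega> q) = \<alpha> / \<zeta> * L2_norm \<Omega> q"
      using pos by simp
    moreover have "\<alpha> / (\<zeta> * \<gamma>) * (\<xi> * h * L2_norm \<Omega> (grad q) + R * ?n * \<zeta> / \<alpha>) =
        \<xi> / \<gamma> * (\<alpha> / \<zeta> * h * L2_norm \<Omega> (grad q)) + ?n / \<gamma> * R"
      using \<zeta> par pos by (simp add: field_simps)
    ultimately have "\<alpha> / \<zeta> * L2_norm \<Omega> q \<le>
        \<xi> / \<gamma> * (\<alpha> / \<zeta> * h * L2_norm \<Omega> (grad q)) + ?n / \<gamma> * R"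
      by simp
    \<comment> \<open>The value of \<eta> gives the inf-sup defect, after scaling by \<alpha> /
      \<zeta>, the weight of the stabilization up to sqrt \<delta>; hence sqrt \<delta> in the
      denominator of \<open>k\<^sub>0\<close>.\<close>
    moreover have "\<alpha> / \<zeta> * h * L2_norm \<Omega> (grad q) \<le> sqrt (?c q q) / sqrt \<delta>"
    proof -
      have "(sqrt \<delta> * (\<alpha> / \<zeta> * h * L2_norm \<Omega> (grad q)))\<^sup>2 =
          eta TYPE('n) \<delta> \<alpha> lam \<mu> * h\<^sup>2 * L2_inner \<Omega> (grad q) (grad q)"
        using pos by (simp add: power_mult_distrib power_divide L2_norm_power2 eta_def \<zeta>_def)
      also have "\<dots> \<le> ?c q q"
        using par L2_inner_nonneg[of \<Omega> "grad q"] by (simp add: stabilization_form_def ap_form_eq)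
      finally have "sqrt \<delta> * (\<alpha> / \<zeta> * h * L2_norm \<Omega> (grad q)) \<le> sqrt (?c q q)"
        by (rule real_le_rsqrt)
      then show ?thesis using pos by (simp add: field_simps)
    qed
    then have "\<xi> / \<gamma> * (\<alpha> / \<zeta> * h * L2_norm \<Omega> (grad q)) \<le> \<xi> / \<gamma> * (sqrt (?c q q) / sqrt \<delta>)"
      using pos by (intro mult_left_mono) auto
    ultimately show ?case unfolding sqrt_s_c by simp
  qed
qed

section \<open>Identification with the operators of the theorem\<close>

lemma S_p_eq:
  "S_p \<Omega> Q \<delta> lam \<mu> \<alpha> K h \<tau> p = functional_on Q (pressure_form \<Omega> \<delta> lam \<mu> \<alpha> K h \<tau> p)"
  by (auto simp: fun_eq_iff S_p_def A_p_def L_p_def M_op_def functional_on_def pressure_form_def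
      stabilization_form_def scaleR_fun_def)

lemma A_block_eq:
  fixes \<Omega> :: "(real^'n) set"
  assumes "saddle_point V (a_form \<Omega> lam \<mu>) Q s (stabilization_form \<Omega> \<delta> lam \<mu> \<alpha> K h \<tau>)
    (\<lambda>v q. \<alpha> * B_op \<Omega> Q v q) k0 k1"
  shows "A_block \<Omega> V Q \<delta> lam \<mu> \<alpha> K h \<tau> =
    saddle_point.saddle_operator V (a_form \<Omega> lam \<mu>) Q
      (stabilization_form \<Omega> \<delta> lam \<mu> \<alpha> K h \<tau>) (\<lambda>v q. \<alpha> * B_op \<Omega> Q v q)"
proof (rule ext, clarify)
  fix u p
  show "A_block \<Omega> V Q \<delta> lam \<mu> \<alpha> K h \<tau> (u, p) =
    saddle_point.saddle_operator V (a_form \<Omega> lam \<mu>) Q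
      (stabilization_form \<Omega> \<delta> lam \<mu> \<alpha> K h \<tau>) (\<lambda>v q. \<alpha> * B_op \<Omega> Q v q) (u, p)"
    unfolding saddle_point.saddle_operator.simps[OF assms]
    by (auto simp: fun_eq_iff A_block_def A_u_def BT_op_def B_op_def A_p_def L_p_def
        functional_on_def stabilization_form_def scaleR_fun_def)
qed

text \<open>The abstract bound takes a single pair of constants for both blocks, so the given ones
  must be weakened to a common pair; \<open>f (H f)\<close> being nonnegative permits this.\<close>

lemma (in inner_form) equivalent_preconditionerI:
  assumes spd: "spd W H" and c: "0 < c" "c \<le> c\<^sub>1" "0 < c\<^sub>2" "c\<^sub>2 \<le> c'"
    and eq: "spectrally_equivalent W c\<^sub>1 c\<^sub>2 H (\<lambda>x. functional_on W (k x))"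
  shows "equivalent_preconditioner W k H c c'"
proof unfold_locales
  fix f assume f: "f \<in> dual W"
  have nn: "0 \<le> f (H f)"
  proof (cases "f = 0")
    case False
    then show ?thesis using spd f unfolding spd_def by (simp add: less_imp_le)
  qed simp
  have "c * f (H f) \<le> c\<^sub>1 * f (H f)" using c nn by (intro mult_right_mono)
  also have "\<dots> \<le> f (unriesz f)" using eq f by (simp add: spectrally_equivalent_def)
  finally show "c * f (H f) \<le> f (unriesz f)" .
  have "f (unriesz f) \<le> c\<^sub>2 * f (H f)" using eq f by (simp add: spectrally_equivalent_def)
  also have "\<dots> \<le> c' * f (H f)" using c nn by (intro mult_right_mono)
  finally show "f (unriesz f) \<le> c' * f (H f)" .
qed (use spd c in auto)

lemma (in inner_form) equivalent_preconditioner_unriesz: "equivalent_preconditioner W k unriesz 1 1"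
  by (rule equivalent_preconditionerI[OF spd_unriesz, of 1 1 1 1])
    (auto simp: spectrally_equivalent_def)

lemma A_u_eq: "A_u \<Omega> V lam \<mu> = (\<lambda>u. functional_on V (a_form \<Omega> lam \<mu> u))"
  by (simp add: A_u_def[abs_def])

lemma cond_number_A_block_le:
  fixes \<Omega> :: "(real^'n) set"
  assumes adm: "admissible \<Omega> V Q \<gamma> \<xi> lam \<mu> \<alpha> K h \<tau>"
    and pos: "0 < \<delta>" "0 < \<gamma>" "0 \<le> \<xi>"
    and Hu: "equivalent_preconditioner V (a_form \<Omega> lam \<mu>) Hu c\<^sub>1 c\<^sub>2"
    and Hp: "equivalent_preconditioner Q (pressure_form \<Omega> \<delta> lam \<mu> \<alpha> K h \<tau>) Hp c\<^sub>1 c\<^sub>2"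
    and M: "\<And>f g. f \<in> dual V \<Longrightarrow> g \<in> dual Q \<Longrightarrow> M (f, g) = (Hu f, Hp g)"
  shows "cond_number V Q M (A_block \<Omega> V Q \<delta> lam \<mu> \<alpha> K h \<tau>) \<le>
    ennreal (2 * saddle_point.stability_constant (\<xi> / (\<gamma> * sqrt \<delta>)) (sqrt (real CARD('n)) / \<gamma>) * c\<^sub>2 / c\<^sub>1)"
  unfolding A_block_eq[OF admissible_saddle_point[OF adm pos]]
  by (rule saddle_point.cond_number_saddle_operator_le[OF admissible_saddle_point[OF adm pos] Hu Hp M])

text \<open>On pairs of dual functionals the inverse of the block diagonal map acts blockwise, by
  injectivity of both Riesz maps.\<close>

lemma B_D_apply:
  assumes "inner_form V (a_form \<Omega> lam \<mu>)" "inner_form Q (pressure_form \<Omega> \<delta> lam \<mu> \<alpha> K h \<tau>)"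
    and f: "f \<in> dual V" and g: "g \<in> dual Q"
  shows "B_D \<Omega> V Q \<delta> lam \<mu> \<alpha> K h \<tau> (f, g) =
    (the_inv_into V (\<lambda>u. functional_on V (a_form \<Omega> lam \<mu> u)) f,
     the_inv_into Q (\<lambda>p. functional_on Q (pressure_form \<Omega> \<delta> lam \<mu> \<alpha> K h \<tau> p)) g)"
proof -
  interpret a: inner_form V "a_form \<Omega> lam \<mu>" by (rule assms(1))
  interpret s: inner_form Q "pressure_form \<Omega> \<delta> lam \<mu> \<alpha> K h \<tau>" by (rule assms(2))
  have S: "S_p \<Omega> Q \<delta> lam \<mu> \<alpha> K h \<tau> = s.riesz" by (rule ext) (rule S_p_eq)
  show ?thesis
    unfolding B_D_def A_u_eq S
  proof (rule the_inv_into_f_eq)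
    show "inj_on (map_prod a.riesz s.riesz) (V \<times> Q)"
      using map_prod_inj_on[OF a.riesz_inj s.riesz_inj] .
    show "map_prod a.riesz s.riesz (a.unriesz f, s.unriesz g) = (f, g)"
      using a.riesz_unriesz[OF f] s.riesz_unriesz[OF g] by simp
    show "(a.unriesz f, s.unriesz g) \<in> V \<times> Q"
      using a.unriesz_mem[OF f] s.unriesz_mem[OF g] by simp
  qed
qed

lemma admissible_inner_forms:
  fixes \<Omega> :: "(real^'n) set"
  assumes "admissible \<Omega> V Q \<gamma> \<xi> lam \<mu> \<alpha> K h \<tau>" "0 < \<delta>" "0 < \<gamma>" "0 \<le> \<xi>"
  shows "inner_form V (a_form \<Omega> lam \<mu>)" "inner_form Q (pressure_form \<Omega> \<delta> lam \<mu> \<alpha> K h \<tau>)"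
  using admissible_saddle_point[OF assms] by (auto simp: saddle_point_def)

theorem mainTheorem2:
  fixes \<delta> \<gamma> \<xi> :: real
  assumes "CARD('n::finite) \<in> {2, 3}" and "0 < \<delta>" and "0 < \<gamma>" and "0 \<le> \<xi>"
  shows "(\<exists>C::real. \<forall>(\<Omega> :: (real^'n) set) V Q lam \<mu> \<alpha> K h \<tau>.
            admissible \<Omega> V Q \<gamma> \<xi> lam \<mu> \<alpha> K h \<tau> \<longrightarrow>
            cond_number V Q (B_D \<Omega> V Q \<delta> lam \<mu> \<alpha> K h \<tau>) (A_block \<Omega> V Q \<delta> lam \<mu> \<alpha> K h \<tau>) \<le> ennreal C)
       \<and> (\<forall>c1u c2u c1p c2p :: real. 0 < c1u \<and> 0 < c2u \<and> 0 < c1p \<and> 0 < c2p \<longrightarrow>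
            (\<exists>C::real. \<forall>(\<Omega> :: (real^'n) set) V Q lam \<mu> \<alpha> K h \<tau> H_u H_p.
               admissible \<Omega> V Q \<gamma> \<xi> lam \<mu> \<alpha> K h \<tau> \<longrightarrow>
               spd V H_u \<longrightarrow> spd Q H_p \<longrightarrow>
               spectrally_equivalent V c1u c2u H_u (A_u \<Omega> V lam \<mu>) \<longrightarrow>
               spectrally_equivalent Q c1p c2p H_p (S_p \<Omega> Q \<delta> lam \<mu> \<alpha> K h \<tau>) \<longrightarrow>
               cond_number V Q (map_prod H_u H_p) (A_block \<Omega> V Q \<delta> lam \<mu> \<alpha> K h \<tau>) \<le> ennreal C))"
proof (intro conjI allI impI)
  show "\<exists>C::real. \<forall>(\<Omega> :: (real^'n) set) V Q lam \<mu> \<alpha> K h \<tau>.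
      admissible \<Omega> V Q \<gamma> \<xi> lam \<mu> \<alpha> K h \<tau> \<longrightarrow>
      cond_number V Q (B_D \<Omega> V Q \<delta> lam \<mu> \<alpha> K h \<tau>) (A_block \<Omega> V Q \<delta> lam \<mu> \<alpha> K h \<tau>) \<le> ennreal C"
  \<comment> \<open>The witness stays schematic until the closing bound. As it is introduced before
    the domain, the spaces and the parameters, it cannot depend on them.\<close>
  proof (intro exI allI impI)
    fix \<Omega> :: "(real^'n) set" and V Q lam \<mu> \<alpha> K h \<tau>
    assume adm: "admissible \<Omega> V Q \<gamma> \<xi> lam \<mu> \<alpha> K h \<tau>"
    note forms = admissible_inner_forms[OF adm assms(2-4)]
    \<comment> \<open>The trailing factors 1 are the equivalence constants of the exact inverses,
      kept so that the bound matches the general one.\<close>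
    show "cond_number V Q (B_D \<Omega> V Q \<delta> lam \<mu> \<alpha> K h \<tau>) (A_block \<Omega> V Q \<delta> lam \<mu> \<alpha> K h \<tau>) \<le>
      ennreal (2 * saddle_point.stability_constant (\<xi> / (\<gamma> * sqrt \<delta>)) (sqrt (real CARD('n)) / \<gamma>) * 1 / 1)"
      by (rule cond_number_A_block_le[OF adm assms(2-4)
            forms[THEN inner_form.equivalent_preconditioner_unriesz] B_D_apply[OF forms]])
  qed
next
  fix c1u c2u c1p c2p :: real
  assume c: "0 < c1u \<and> 0 < c2u \<and> 0 < c1p \<and> 0 < c2p"
  show "\<exists>C::real. \<forall>(\<Omega> :: (real^'n) set) V Q lam \<mu> \<alpha> K h \<tau> H_u H_p.
      admissible \<Omega> V Q \<gamma> \<xi> lam \<mu> \<alpha> K h \<tau> \<longrightarrow> spd V H_u \<longrightarrow> spd Q H_p \<longrightarrow>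
      spectrally_equivalent V c1u c2u H_u (A_u \<Omega> V lam \<mu>) \<longrightarrow>
      spectrally_equivalent Q c1p c2p H_p (S_p \<Omega> Q \<delta> lam \<mu> \<alpha> K h \<tau>) \<longrightarrow>
      cond_number V Q (map_prod H_u H_p) (A_block \<Omega> V Q \<delta> lam \<mu> \<alpha> K h \<tau>) \<le> ennreal C"
  proof (intro exI allI impI)
    fix \<Omega> :: "(real^'n) set" and V Q lam \<mu> \<alpha> K h \<tau> H_u H_p
    assume adm: "admissible \<Omega> V Q \<gamma> \<xi> lam \<mu> \<alpha> K h \<tau>" and spd: "spd V H_u" "spd Q H_p"
      and eq: "spectrally_equivalent V c1u c2u H_u (A_u \<Omega> V lam \<mu>)"
        "spectrally_equivalent Q c1p c2p H_p (S_p \<Omega> Q \<delta> lam \<mu> \<alpha> K h \<tau>)"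
    note forms = admissible_inner_forms[OF adm assms(2-4)]
    \<comment> \<open>The smaller of the lower and the larger of the upper constants serve both
      blocks.\<close>
    have u: "equivalent_preconditioner V (a_form \<Omega> lam \<mu>) H_u (min c1u c1p) (max c2u c2p)"
      by (rule inner_form.equivalent_preconditionerI[OF forms(1) spd(1) _ _ _ _ eq(1)[unfolded A_u_eq]])
        (use c in auto)
    have p: "equivalent_preconditioner Q (pressure_form \<Omega> \<delta> lam \<mu> \<alpha> K h \<tau>) H_p (min c1u c1p) (max c2u c2p)"
      by (rule inner_form.equivalent_preconditionerI[OF forms(2) spd(2) _ _ _ _ eq(2)[unfolded S_p_eq[abs_def]]])
        (use c in auto)
    show "cond_number V Q (map_prod H_u H_p) (A_block \<Omega> V Q \<delta> lam \<mu> \<alpha> K h \<tau>) \<le>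
      ennreal (2 * saddle_point.stability_constant (\<xi> / (\<gamma> * sqrt \<delta>)) (sqrt (real CARD('n)) / \<gamma>) *
        max c2u c2p / min c1u c1p)"
      by (rule cond_number_A_block_le[OF adm assms(2-4) u p]) simp
  qed
qed

end
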